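(* Let $\Bbbk$ be a commutative ring. The categories of symmetric brace algebras over $\Bbbk$ and of pre-Lie algebras over $\Bbbk$ are isomorphic.
   Context: All modules and linear maps are over a fixed commutative ring $\Bbbk$. A pre-Lie algebra is a module $L$ with a bilinear product $\circ$ satisfying $X\circ (Y\circ Z)-(X\circ Y)\circ Z = X\circ (Z\circ Y)-(X\circ Z)\circ Y$ for all $X,Y,Z\in L$. A symmetric brace algebra is a module $V$ equipped with a linear map $V\otimes S(V)\to V$, $X\otimes A\mapsto X\{A\}$, where $S(V)$ is the symmetric algebra, such that for all $X,Y_1,\dots,Y_n\in V$ and $A\in S(V)$: $$X\{1\}=X,\qquad X\{Y_1,\cdots ,Y_n\}\{A\} = X\{Y_1\{A_{(1)}\},\cdots,Y_n\{A_{(n)}\},A_{(n+1)}\}.$$ Here $X\{Y_1,\dots,Y_n\}$ means $X\{Y_1\cdots Y_n\}$ (commas denote the product of $S(V)$), and $A_{(1)}\otimes\cdots\otimes A_{(n+1)}$ is the Sweedler notation for the iterated usual coproduct $\Delta$ of $S(V)$ (the algebra morphism with $\Delta(X)=X\otimes 1+1\otimes X$ for $X\in V$). Morphisms in each category are the linear maps compatible with the structure (with $\circ$, respectively with the braces). *)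

theory Defs
  imports "HOL-Algebra.QuotRing" "HOL-Algebra.Module" "HOL-Library.Multiset"
begin

section \<open>Categories and isomorphisms of categories\<close>

record ('o, 'm) cat =
  Obj :: "'o set"
  Hom :: "'o \<Rightarrow> 'o \<Rightarrow> 'm set"
  Ident :: "'o \<Rightarrow> 'm"
  Comp :: "'o \<Rightarrow> 'o \<Rightarrow> 'o \<Rightarrow> 'm \<Rightarrow> 'm \<Rightarrow> 'm"
    \<comment> \<open>\<open>Comp C x y z g f\<close> is the composite of \<open>f: x \<rightarrow> y\<close> followed by \<open>g: y \<rightarrow> z\<close>\<close>

locale category =
  fixes C :: "('o, 'm) cat"
  assumes Ident_in_Hom: "x \<in> Obj C \<Longrightarrow> Ident C x \<in> Hom C x x"
    and Comp_in_Hom: "\<lbrakk>x \<in> Obj C; y \<in> Obj C; z \<in> Obj C; f \<in> Hom C x y; g \<in> Hom C y z\<rbrakk>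
      \<Longrightarrow> Comp C x y z g f \<in> Hom C x z"
    and Comp_Ident_right: "\<lbrakk>x \<in> Obj C; y \<in> Obj C; f \<in> Hom C x y\<rbrakk>
      \<Longrightarrow> Comp C x x y f (Ident C x) = f"
    and Comp_Ident_left: "\<lbrakk>x \<in> Obj C; y \<in> Obj C; f \<in> Hom C x y\<rbrakk>
      \<Longrightarrow> Comp C x y y (Ident C y) f = f"
    and Comp_assoc: "\<lbrakk>w \<in> Obj C; x \<in> Obj C; y \<in> Obj C; z \<in> Obj C;
        f \<in> Hom C w x; g \<in> Hom C x y; h \<in> Hom C y z\<rbrakk>
      \<Longrightarrow> Comp C w x z (Comp C x y z h g) f = Comp C w y z h (Comp C w x y g f)"

locale cat_functor = C: category C + D: category D
  for C :: "('o, 'm) cat" and D :: "('p, 'n) cat" +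
  fixes Fo :: "'o \<Rightarrow> 'p" and Fm :: "'o \<Rightarrow> 'o \<Rightarrow> 'm \<Rightarrow> 'n"
  assumes Fo_Obj: "x \<in> Obj C \<Longrightarrow> Fo x \<in> Obj D"
    and Fm_Hom: "\<lbrakk>x \<in> Obj C; y \<in> Obj C; f \<in> Hom C x y\<rbrakk> \<Longrightarrow> Fm x y f \<in> Hom D (Fo x) (Fo y)"
    and Fm_Ident: "x \<in> Obj C \<Longrightarrow> Fm x x (Ident C x) = Ident D (Fo x)"
    and Fm_Comp: "\<lbrakk>x \<in> Obj C; y \<in> Obj C; z \<in> Obj C; f \<in> Hom C x y; g \<in> Hom C y z\<rbrakk>
      \<Longrightarrow> Fm x z (Comp C x y z g f) = Comp D (Fo x) (Fo y) (Fo z) (Fm y z g) (Fm x y f)"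

definition left_inverse_functor ::
  "('o, 'm) cat \<Rightarrow> ('o \<Rightarrow> 'p) \<Rightarrow> ('o \<Rightarrow> 'o \<Rightarrow> 'm \<Rightarrow> 'n)
    \<Rightarrow> ('p \<Rightarrow> 'o) \<Rightarrow> ('p \<Rightarrow> 'p \<Rightarrow> 'n \<Rightarrow> 'm) \<Rightarrow> bool"
  \<comment> \<open>\<open>G \<circ> F\<close> is the identity functor of \<open>C\<close>\<close>
  where "left_inverse_functor C Fo Fm Go Gm \<longleftrightarrow>
    (\<forall>x \<in> Obj C. Go (Fo x) = x) \<and>
    (\<forall>x \<in> Obj C. \<forall>y \<in> Obj C. \<forall>f \<in> Hom C x y. Gm (Fo x) (Fo y) (Fm x y f) = f)"

definition isomorphic_categories :: "('o, 'm) cat \<Rightarrow> ('p, 'n) cat \<Rightarrow> bool"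
  where "isomorphic_categories C D \<longleftrightarrow>
    (\<exists>Fo Fm Go Gm. cat_functor C D Fo Fm \<and> cat_functor D C Go Gm \<and>
      left_inverse_functor C Fo Fm Go Gm \<and> left_inverse_functor D Go Gm Fo Fm)"


section \<open>Modules and (multi)linear maps\<close>

text \<open>
  The record type of modules has ring components that the notion of a module does not use, and its
  operations are total functions.  So that equality of records is equality of modules, the
  operations are required to be extensional and the unused components to be \<^const>\<open>undefined\<close>.
\<close>

definition proper_module :: "('k, 'r) ring_scheme \<Rightarrow> ('k, 'v, 's) module_scheme \<Rightarrow> bool"
  where "proper_module R M \<longleftrightarrow> module R M \<and>
    ring.add M \<in> carrier M \<rightarrow>\<^sub>E carrier M \<rightarrow>\<^sub>E carrier M \<and>
    smult M \<in> carrier R \<rightarrow>\<^sub>E carrier M \<rightarrow>\<^sub>E carrier M \<and>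
    monoid.mult M = undefined \<and> monoid.one M = undefined"

definition linear_maps ::
  "('k, 'r) ring_scheme \<Rightarrow> ('k, 'a, 's) module_scheme \<Rightarrow> ('k, 'b, 't) module_scheme \<Rightarrow> ('a \<Rightarrow> 'b) set"
  where "linear_maps R M N = {f \<in> carrier M \<rightarrow>\<^sub>E carrier N.
    (\<forall>x \<in> carrier M. \<forall>y \<in> carrier M. f (x \<oplus>\<^bsub>M\<^esub> y) = f x \<oplus>\<^bsub>N\<^esub> f y) \<and>
    (\<forall>c \<in> carrier R. \<forall>x \<in> carrier M. f (c \<odot>\<^bsub>M\<^esub> x) = c \<odot>\<^bsub>N\<^esub> f x)}"

definition bilinear_maps ::
  "('k, 'r) ring_scheme \<Rightarrow> ('k, 'a, 's) module_scheme \<Rightarrow> ('k, 'b, 't) module_scheme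
    \<Rightarrow> ('k, 'c, 'u) module_scheme \<Rightarrow> ('a \<Rightarrow> 'b \<Rightarrow> 'c) set"
  where "bilinear_maps R M N P = {b \<in> carrier M \<rightarrow>\<^sub>E linear_maps R N P.
    \<forall>y \<in> carrier N. (\<lambda>x \<in> carrier M. b x y) \<in> linear_maps R M P}"

definition algebra_homs ::
  "('k, 'r) ring_scheme \<Rightarrow> ('k, 'a, 's) module_scheme \<Rightarrow> ('k, 'b, 't) module_scheme \<Rightarrow> ('a \<Rightarrow> 'b) set"
  where "algebra_homs R A B = linear_maps R A B \<inter> ring_hom A B"


section \<open>Monoid algebras and quotient algebras\<close>

definition monoid_algebra ::
  "('k, 'r) ring_scheme \<Rightarrow> ('g, 'm) monoid_scheme \<Rightarrow> ('k, 'g \<Rightarrow> 'k) module"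
  where "monoid_algebra R G =
    \<lparr>carrier = {f. finite {g. f g \<noteq> \<zero>\<^bsub>R\<^esub>} \<and> {g. f g \<noteq> \<zero>\<^bsub>R\<^esub>} \<subseteq> carrier G \<and> range f \<subseteq> carrier R},
     monoid.mult = (\<lambda>f h g. \<Oplus>\<^bsub>R\<^esub>p \<in> {(a, b). f a \<noteq> \<zero>\<^bsub>R\<^esub> \<and> h b \<noteq> \<zero>\<^bsub>R\<^esub> \<and> a \<otimes>\<^bsub>G\<^esub> b = g}. f (fst p) \<otimes>\<^bsub>R\<^esub> h (snd p)),
     one = (\<lambda>g. if g = \<one>\<^bsub>G\<^esub> then \<one>\<^bsub>R\<^esub> else \<zero>\<^bsub>R\<^esub>),
     ring.zero = (\<lambda>g. \<zero>\<^bsub>R\<^esub>),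
     ring.add = (\<lambda>f h g. f g \<oplus>\<^bsub>R\<^esub> h g),
     smult = (\<lambda>c f g. c \<otimes>\<^bsub>R\<^esub> f g)\<rparr>"

definition basis_elt :: "('k, 'r) ring_scheme \<Rightarrow> 'g \<Rightarrow> 'g \<Rightarrow> 'k"
  where "basis_elt R g = (\<lambda>h. if h = g then \<one>\<^bsub>R\<^esub> else \<zero>\<^bsub>R\<^esub>)"

text \<open>The library's \<^const>\<open>FactRing\<close>, with the scalar multiplication of cosets added.\<close>

definition quotient_algebra :: "('k, 'a, 's) module_scheme \<Rightarrow> 'a set \<Rightarrow> ('k, 'a set) module"
  where "quotient_algebra A I = ring.extend (A Quot I)
    \<lparr>smult = (\<lambda>c X. \<Union>x \<in> X. I +>\<^bsub>A\<^esub> (c \<odot>\<^bsub>A\<^esub> x))\<rparr>"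


section \<open>The symmetric algebra of a module\<close>

text \<open>
  \<open>S(V)\<close> is constructed as the polynomial algebra with one variable \<open>[x]\<close> for each \<open>x \<in> V\<close>, modulo
  the ideal generated by all \<open>[x + y] - [x] - [y]\<close> and \<open>[c x] - c [x]\<close>.  Monomials are multisets.
\<close>

type_synonym ('k, 'v) sym = "('v multiset \<Rightarrow> 'k) set"

definition monomials :: "'v set \<Rightarrow> 'v multiset monoid"
  where "monomials X = \<lparr>carrier = {m. set_mset m \<subseteq> X}, monoid.mult = (+), one = {#}\<rparr>"

definition sym_ideal ::
  "('k, 'r) ring_scheme \<Rightarrow> ('k, 'v, 's) module_scheme \<Rightarrow> ('v multiset \<Rightarrow> 'k) set"
  where "sym_ideal R V = (let P = monoid_algebra R (monomials (carrier V)); var = (\<lambda>x. basis_elt R {#x#}) in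
    Idl\<^bsub>P\<^esub> ({var (x \<oplus>\<^bsub>V\<^esub> y) \<ominus>\<^bsub>P\<^esub> var x \<ominus>\<^bsub>P\<^esub> var y | x y. x \<in> carrier V \<and> y \<in> carrier V} \<union>
            {var (c \<odot>\<^bsub>V\<^esub> x) \<ominus>\<^bsub>P\<^esub> c \<odot>\<^bsub>P\<^esub> var x | c x. c \<in> carrier R \<and> x \<in> carrier V}))"

definition sym_algebra ::
  "('k, 'r) ring_scheme \<Rightarrow> ('k, 'v, 's) module_scheme \<Rightarrow> ('k, ('k, 'v) sym) module"
  where "sym_algebra R V =
    quotient_algebra (monoid_algebra R (monomials (carrier V))) (sym_ideal R V)"

definition sym_incl ::
  "('k, 'r) ring_scheme \<Rightarrow> ('k, 'v, 's) module_scheme \<Rightarrow> 'v \<Rightarrow> ('k, 'v) sym"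
  \<comment> \<open>the canonical map \<open>V \<rightarrow> S(V)\<close>\<close>
  where "sym_incl R V x =
    sym_ideal R V +>\<^bsub>monoid_algebra R (monomials (carrier V))\<^esub> basis_elt R {#x#}"

definition sym_prod ::
  "('k, 'r) ring_scheme \<Rightarrow> ('k, 'v, 's) module_scheme \<Rightarrow> 'v list \<Rightarrow> ('k, 'v) sym"
  \<comment> \<open>the product \<open>Y\<^sub>1 \<cdots> Y\<^sub>n\<close> in \<open>S(V)\<close>\<close>
  where "sym_prod R V Ys =
    foldr (\<lambda>Y A. sym_incl R V Y \<otimes>\<^bsub>sym_algebra R V\<^esub> A) Ys \<one>\<^bsub>sym_algebra R V\<^esub>"


section \<open>Tensor powers of a commutative algebra\<close>

text \<open>
  The \<open>n\<close>-th tensor power of \<open>A\<close> over \<open>R\<close> is the free \<open>R\<close>-module on the set of \<open>n\<close>-tuples of elements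
  of \<open>A\<close>, modulo multilinearity.  With the componentwise product of tuples this free module is a monoid
  algebra; the multilinearity relations already span an ideal of it, so that generating an ideal
  or a submodule makes no difference, and the quotient has the product of the tensor power.
\<close>

type_synonym ('k, 'a) tensor = "('a list \<Rightarrow> 'k) set"

definition tuples :: "nat \<Rightarrow> ('a, 'm) monoid_scheme \<Rightarrow> 'a list monoid"
  where "tuples n A = \<lparr>carrier = {xs. length xs = n \<and> set xs \<subseteq> carrier A},
    monoid.mult = map2 (monoid.mult A), one = replicate n \<one>\<^bsub>A\<^esub>\<rparr>"

definition tensor_ideal ::
  "('k, 'r) ring_scheme \<Rightarrow> ('k, 'a, 's) module_scheme \<Rightarrow> nat \<Rightarrow> ('a list \<Rightarrow> 'k) set"
  where "tensor_ideal R A n = (let P = monoid_algebra R (tuples n A); e = basis_elt R in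
    Idl\<^bsub>P\<^esub> ({e (xs[i := x \<oplus>\<^bsub>A\<^esub> y]) \<ominus>\<^bsub>P\<^esub> e (xs[i := x]) \<ominus>\<^bsub>P\<^esub> e (xs[i := y]) | xs i x y.
              xs \<in> carrier (tuples n A) \<and> i < n \<and> x \<in> carrier A \<and> y \<in> carrier A} \<union>
            {e (xs[i := c \<odot>\<^bsub>A\<^esub> x]) \<ominus>\<^bsub>P\<^esub> c \<odot>\<^bsub>P\<^esub> e (xs[i := x]) | xs i c x.
              xs \<in> carrier (tuples n A) \<and> i < n \<and> c \<in> carrier R \<and> x \<in> carrier A}))"

definition tensor_power ::
  "('k, 'r) ring_scheme \<Rightarrow> ('k, 'a, 's) module_scheme \<Rightarrow> nat \<Rightarrow> ('k, ('k, 'a) tensor) module"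
  where "tensor_power R A n = quotient_algebra (monoid_algebra R (tuples n A)) (tensor_ideal R A n)"

definition pure_tensor ::
  "('k, 'r) ring_scheme \<Rightarrow> ('k, 'a, 's) module_scheme \<Rightarrow> 'a list \<Rightarrow> ('k, 'a) tensor"
  \<comment> \<open>\<open>x\<^sub>1 \<otimes> \<cdots> \<otimes> x\<^sub>n\<close>, where \<open>n\<close> is the length of the list\<close>
  where "pure_tensor R A xs = tensor_ideal R A (length xs)
    +>\<^bsub>monoid_algebra R (tuples (length xs) A)\<^esub> basis_elt R xs"

text \<open>
  The linear map on the \<open>n\<close>-th tensor power induced by an \<open>n\<close>-linear map \<open>F\<close>, whose \<open>n\<close> arguments are
  passed as a list.
\<close>

definition tensor_lift ::
  "('k, 'r) ring_scheme \<Rightarrow> ('k, 'a, 's) module_scheme \<Rightarrow> nat \<Rightarrow> ('k, 'w, 't) module_scheme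
    \<Rightarrow> ('a list \<Rightarrow> 'w) \<Rightarrow> ('k, 'a) tensor \<Rightarrow> 'w"
  where "tensor_lift R A n W F = (THE h. h \<in> linear_maps R (tensor_power R A n) W \<and>
    (\<forall>xs \<in> carrier (tuples n A). h (pure_tensor R A xs) = F xs))"


section \<open>The coproduct of the symmetric algebra\<close>

definition sym_coproduct ::
  "('k, 'r) ring_scheme \<Rightarrow> ('k, 'v, 's) module_scheme \<Rightarrow> ('k, 'v) sym \<Rightarrow> ('k, ('k, 'v) sym) tensor"
  where "sym_coproduct R V = (let S = sym_algebra R V in
    THE d. d \<in> algebra_homs R S (tensor_power R S 2) \<and>
      (\<forall>X \<in> carrier V. d (sym_incl R V X) =
        pure_tensor R S [sym_incl R V X, \<one>\<^bsub>S\<^esub>] \<oplus>\<^bsub>tensor_power R S 2\<^esub>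
        pure_tensor R S [\<one>\<^bsub>S\<^esub>, sym_incl R V X]))"

definition coproduct_first ::
  "('k, 'r) ring_scheme \<Rightarrow> ('k, 'v, 's) module_scheme \<Rightarrow> nat
    \<Rightarrow> ('k, ('k, 'v) sym) tensor \<Rightarrow> ('k, ('k, 'v) sym) tensor"
  \<comment> \<open>\<open>\<Delta> \<otimes> id \<otimes> \<cdots> \<otimes> id\<close> with \<open>n\<close> factors \<open>id\<close>, from the tensor power \<open>n + 1\<close> to the tensor power \<open>n + 2\<close>\<close>
  where "coproduct_first R V n = (let S = sym_algebra R V; T = tensor_power R S (n + 2) in
    tensor_lift R S (n + 1) T
      (\<lambda>As. tensor_lift R S 2 T (\<lambda>Bs. pure_tensor R S (Bs @ tl As)) (sym_coproduct R V (hd As))))"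

primrec iterated_coproduct ::
  "('k, 'r) ring_scheme \<Rightarrow> ('k, 'v, 's) module_scheme \<Rightarrow> nat
    \<Rightarrow> ('k, 'v) sym \<Rightarrow> ('k, ('k, 'v) sym) tensor"
  \<comment> \<open>the map written \<open>A\<^sub>(\<^sub>1\<^sub>) \<otimes> \<cdots> \<otimes> A\<^sub>(\<^sub>n\<^sub>+\<^sub>1\<^sub>)\<close> in Sweedler notation\<close>
  where
    "iterated_coproduct R V 0 A = pure_tensor R (sym_algebra R V) [A]"
  | "iterated_coproduct R V (Suc n) A = coproduct_first R V n (iterated_coproduct R V n A)"


section \<open>Symmetric brace algebras\<close>

record ('k, 'v) brace_alg = "('k, 'v) module" +
  brace :: "'v \<Rightarrow> ('k, 'v) sym \<Rightarrow> 'v"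

text \<open>
  The linear map \<open>V \<otimes> S(V) \<rightarrow> V\<close> is given as the corresponding bilinear map.  In the last axiom, the
  right-hand side in Sweedler notation is the value on the iterated coproduct of \<open>A\<close> of the linear map
  \<open>B\<^sub>1 \<otimes> \<cdots> \<otimes> B\<^sub>n \<otimes> B\<^sub>n\<^sub>+\<^sub>1 \<mapsto> X{Y\<^sub>1{B\<^sub>1}, \<dots>, Y\<^sub>n{B\<^sub>n}, B\<^sub>n\<^sub>+\<^sub>1}\<close>.
\<close>

locale symmetric_brace_algebra =
  fixes R :: "('k, 'r) ring_scheme" and V :: "('k, 'v) brace_alg"
  assumes proper_module: "proper_module R V"
    and brace_bilinear: "brace V \<in> bilinear_maps R V (sym_algebra R V) V"
    and brace_one: "X \<in> carrier V \<Longrightarrow> brace V X \<one>\<^bsub>sym_algebra R V\<^esub> = X"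
    and brace_brace: "\<lbrakk>X \<in> carrier V; set Ys \<subseteq> carrier V; A \<in> carrier (sym_algebra R V)\<rbrakk> \<Longrightarrow>
      brace V (brace V X (sym_prod R V Ys)) A =
      tensor_lift R (sym_algebra R V) (length Ys + 1) V
        (\<lambda>Bs. brace V X (sym_prod R V (map2 (brace V) Ys (butlast Bs)) \<otimes>\<^bsub>sym_algebra R V\<^esub> last Bs))
        (iterated_coproduct R V (length Ys) A)"

definition brace_homs ::
  "('k, 'r) ring_scheme \<Rightarrow> ('k, 'v) brace_alg \<Rightarrow> ('k, 'w) brace_alg \<Rightarrow> ('v \<Rightarrow> 'w) set"
  where "brace_homs R V W = {f \<in> linear_maps R V W.
    \<forall>X \<in> carrier V. \<forall>Ys. set Ys \<subseteq> carrier V \<longrightarrow>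
      f (brace V X (sym_prod R V Ys)) = brace W (f X) (sym_prod R W (map f Ys))}"

definition brace_cat :: "('k, 'r) ring_scheme \<Rightarrow> (('k, 'v) brace_alg, 'v \<Rightarrow> 'v) cat"
  where "brace_cat R =
    \<lparr>Obj = {V. symmetric_brace_algebra R V},
     Hom = brace_homs R,
     Ident = (\<lambda>V. \<lambda>x \<in> carrier V. x),
     Comp = (\<lambda>U V W g f. compose (carrier U) g f)\<rparr>"


section \<open>Pre-Lie algebras\<close>

record ('k, 'v) prelie_alg = "('k, 'v) module" +
  circ :: "'v \<Rightarrow> 'v \<Rightarrow> 'v"

abbreviation circ_syntax ::
  "'v \<Rightarrow> ('k, 'v) prelie_alg \<Rightarrow> 'v \<Rightarrow> 'v"  (\<open>(_ \<circ>\<^bsub>_\<^esub> _)\<close> [71, 0, 71] 70)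
  where "X \<circ>\<^bsub>L\<^esub> Y \<equiv> circ L X Y"

locale prelie_algebra =
  fixes R :: "('k, 'r) ring_scheme" and L :: "('k, 'v) prelie_alg"
  assumes proper_module: "proper_module R L"
    and circ_bilinear: "circ L \<in> bilinear_maps R L L L"
    and prelie_identity: "\<lbrakk>X \<in> carrier L; Y \<in> carrier L; Z \<in> carrier L\<rbrakk> \<Longrightarrow>
      X \<circ>\<^bsub>L\<^esub> (Y \<circ>\<^bsub>L\<^esub> Z) \<ominus>\<^bsub>L\<^esub> (X \<circ>\<^bsub>L\<^esub> Y) \<circ>\<^bsub>L\<^esub> Z = X \<circ>\<^bsub>L\<^esub> (Z \<circ>\<^bsub>L\<^esub> Y) \<ominus>\<^bsub>L\<^esub> (X \<circ>\<^bsub>L\<^esub> Z) \<circ>\<^bsub>L\<^esub> Y"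

definition prelie_homs ::
  "('k, 'r) ring_scheme \<Rightarrow> ('k, 'v) prelie_alg \<Rightarrow> ('k, 'w) prelie_alg \<Rightarrow> ('v \<Rightarrow> 'w) set"
  where "prelie_homs R L M = {f \<in> linear_maps R L M.
    \<forall>X \<in> carrier L. \<forall>Y \<in> carrier L. f (X \<circ>\<^bsub>L\<^esub> Y) = f X \<circ>\<^bsub>M\<^esub> f Y}"

definition prelie_cat :: "('k, 'r) ring_scheme \<Rightarrow> (('k, 'v) prelie_alg, 'v \<Rightarrow> 'v) cat"
  where "prelie_cat R =
    \<lparr>Obj = {L. prelie_algebra R L},
     Hom = prelie_homs R,
     Ident = (\<lambda>L. \<lambda>x \<in> carrier L. x),
     Comp = (\<lambda>L M N g f. compose (carrier L) g f)\<rparr>"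

end

theory Submission
  imports Defs
begin

text \<open>
  A brace algebra becomes pre-Lie through \<open>X \<circ> Y = X{Y}\<close>: the brace axiom for one argument \<open>Z\<close> reads
  \<open>X{Y\<^sub>1,\<dots>,Y\<^sub>n} \<circ> Z = X{Z,Y\<^sub>1,\<dots>,Y\<^sub>n} + \<Sum>\<^sub>i X{Y\<^sub>1,\<dots>,Y\<^sub>i \<circ> Z,\<dots>,Y\<^sub>n}\<close>, so that the associator of \<open>X, Y, Z\<close> is
  \<open>X{Y,Z}\<close> up to sign, which is symmetric in \<open>Y\<close> and \<open>Z\<close>.  The same formula determines all braces recursively from \<open>\<circ>\<close>,
  and conversely (Oudom and Guin) serves to define them in a pre-Lie algebra.  There the pre-Lie identity
  makes them symmetric, hence they descend to \<open>S(L)\<close>, and the brace axiom follows by induction on \<open>A\<close>,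
  since right multiplication by \<open>Z\<close> extends to a derivation and coderivation of \<open>S(L)\<close>.

  Elements of \<open>S(V)\<close> are handled as lists of factors, and the iterated coproduct of \<open>z\<^sub>1 \<cdots> z\<^sub>m\<close> as
  the multiset of all ways to distribute the factors over the tensor slots.
\<close>

section \<open>Derivations and unshuffles of lists\<close>

text \<open>Write R_Z for right multiplication by Z. The pre-Lie identity says R_W R_Z - R_Z R_W =
  R_(Z \<circ> W) - R_(W \<circ> Z), and exchanging the first two arguments of a brace uses it
  twice: for multiplications applied to the outer brace, and for the induced derivations applied to
  the arguments. The delicate terms are those where both derivations hit the same entry.

  The recursion singles out the first argument, so braces must exist on lists before their symmetry
  can be proved, and only then do they pass to S(L). Repetitions are counted by multisets, so no
  factorials are divided out and any commutative ring is allowed.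

  S(V), its tensor powers and the coproduct are quotients and definite descriptions. Nothing can be
  computed in them before existence and uniqueness of the maps concerned are known; hence the
  universal properties that precede the algebra. Linear identities are then checked on spanning
  sets: products in S(V), pure tensors in tensor powers.

  An isomorphism, unlike an equivalence, demands equality of records after a round trip. Both
  constructions keep the module, and extensionality settles the values outside the carrier.\<close>

text \<open>
  For \<open>\<phi> y = {#y \<circ> Z#}\<close> this is, on words, the derivation extending right multiplication by \<open>Z\<close>.
\<close>

primrec alter_one :: "('a \<Rightarrow> 'a multiset) \<Rightarrow> 'a list \<Rightarrow> 'a list multiset" where
  "alter_one \<phi> [] = {#}"
| "alter_one \<phi> (y # ys) = image_mset (\<lambda>u. u # ys) (\<phi> y) + image_mset ((#) y) (alter_one \<phi> ys)"

abbreviation insert_one :: "'a \<Rightarrow> 'a list list \<Rightarrow> 'a list list multiset" where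
  "insert_one z \<equiv> alter_one (\<lambda>L. {#z # L#})"

text \<open>The summands of the iterated coproduct, with \<open>n\<close> tensor factors, of the product of the list.\<close>

primrec unshuffles :: "nat \<Rightarrow> 'a list \<Rightarrow> 'a list list multiset" where
  "unshuffles n [] = {#replicate n []#}"
| "unshuffles n (z # zs) = (\<Sum>Ls\<in>#unshuffles n zs. insert_one z Ls)"

lemma image_mset_sum_single: "image_mset f M = (\<Sum>x\<in>#M. {#f x#})"
  by (induction M) auto

lemma sum_mset_image_mset_swap:
  "(\<Sum>u\<in>#M. image_mset (f u) N) = (\<Sum>v\<in>#N. image_mset (\<lambda>u. f u v) M)"
proof -
  have "(\<Sum>u\<in>#M. \<Sum>v\<in>#N. {#f u v#}) = (\<Sum>v\<in>#N. \<Sum>u\<in>#M. {#f u v#})"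
    by (rule sum_mset.swap)
  then show ?thesis by (simp flip: image_mset_sum_single)
qed

lemma image_mset_sum_mset: "image_mset g (\<Sum>x\<in>#M. f x) = (\<Sum>x\<in>#M. image_mset g (f x))"
  by (induction M) auto

lemma sum_mset_image: "(\<Sum>x\<in>#image_mset g M. f x) = (\<Sum>x\<in>#M. f (g x))"
  by (induction M) auto

lemma sum_mset_bind:
  fixes f :: "'b \<Rightarrow> 'c multiset"
  shows "(\<Sum>x\<in>#(\<Sum>y\<in>#M. g y). f x) = (\<Sum>y\<in>#M. \<Sum>x\<in>#g y. f x)"
  by (induction M) auto

lemma alter_one_append:
  "alter_one \<phi> (xs @ ys) =
    image_mset (\<lambda>us. us @ ys) (alter_one \<phi> xs) + image_mset ((@) xs) (alter_one \<phi> ys)"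
  by (induction xs) (auto simp: image_mset.compositionality comp_def)

lemma length_alter_one: "us \<in># alter_one \<phi> xs \<Longrightarrow> length us = length xs"
  by (induction xs arbitrary: us) auto

lemma set_alter_one:
  "us \<in># alter_one \<phi> xs \<Longrightarrow> set xs \<subseteq> C \<Longrightarrow> (\<And>y u. y \<in> C \<Longrightarrow> u \<in># \<phi> y \<Longrightarrow> u \<in> C) \<Longrightarrow> set us \<subseteq> C"
  by (induction xs arbitrary: us) (simp, fastforce)

lemma alter_one_plus: "alter_one (\<lambda>y. \<phi> y + \<psi> y) xs = alter_one \<phi> xs + alter_one \<psi> xs"
  by (induction xs) auto

lemma alter_one_sum_mset: "alter_one (\<lambda>y. \<Sum>u\<in>#M. f u y) xs = (\<Sum>u\<in>#M. alter_one (f u) xs)"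
proof (induction M)
  case empty
  show ?case by (induction xs) auto
next
  case (add a M)
  then show ?case by (simp add: alter_one_plus)
qed

text \<open>Altering two different entries commutes, so only alterations of the same entry contribute.\<close>

lemma alter_one_commutator:
  "(\<Sum>us\<in>#alter_one \<psi> xs. alter_one \<phi> us) + alter_one (\<lambda>y. \<Sum>u\<in>#\<phi> y. \<psi> u) xs =
   (\<Sum>us\<in>#alter_one \<phi> xs. alter_one \<psi> us) + alter_one (\<lambda>y. \<Sum>u\<in>#\<psi> y. \<phi> u) xs"
proof (induction xs)
  case Nil
  show ?case by simp
next
  case (Cons y ys)
  have IH: "image_mset ((#) y) (\<Sum>us\<in>#alter_one \<psi> ys. alter_one \<phi> us)
      + image_mset ((#) y) (alter_one (\<lambda>y. \<Sum>u\<in>#\<phi> y. \<psi> u) ys)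
    = image_mset ((#) y) (\<Sum>us\<in>#alter_one \<phi> ys. alter_one \<psi> us)
      + image_mset ((#) y) (alter_one (\<lambda>y. \<Sum>u\<in>#\<psi> y. \<phi> u) ys)"
    using Cons.IH by (metis image_mset_union)
  show ?case
    using IH
    by (simp add: sum_mset.distrib sum_mset_image image_mset_sum_mset
        sum_mset_image_mset_swap[where f = "(#)" and M = "\<psi> y"]
        sum_mset_image_mset_swap[where f = "(#)" and M = "\<phi> y"] ac_simps)
qed

text \<open>Leibniz rule: a derivation applied after inserting \<open>z\<close> hits either the new
  \<open>z\<close> or an old entry. Prepending \<open>z\<close> to a slot is itself an alteration of
  a list of lists, so \<open>alter_one_commutator\<close> applies; of its two same-entry terms, one
  cancels against the part of \<open>alter_one \<phi> (z # L)\<close> that keeps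
  \<open>z\<close>.\<close>

lemma insert_one_alter_one:
  "(\<Sum>Ms\<in>#insert_one (z :: 'a) Ls. alter_one (alter_one \<phi>) Ms) =
    (\<Sum>u\<in>#\<phi> z. insert_one u Ls) + (\<Sum>Ms\<in>#alter_one (alter_one \<phi>) Ls. insert_one z Ms)"
proof -
  have "alter_one (\<lambda>L. \<Sum>u\<in>#{#z # L#}. alter_one \<phi> u) Ls =
     alter_one (\<lambda>L. \<Sum>u\<in>#\<phi> z. {#u # L#}) (Ls :: 'a list list) + alter_one (\<lambda>L. \<Sum>M\<in>#alter_one \<phi> L. {#z # M#}) Ls"
    unfolding alter_one_plus[symmetric] by (simp flip: image_mset_sum_single)
  also have "alter_one (\<lambda>L. \<Sum>u\<in>#\<phi> z. {#u # L#}) Ls = (\<Sum>u\<in>#\<phi> z. insert_one u Ls)"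
    by (rule alter_one_sum_mset)
  finally show ?thesis
    using alter_one_commutator[where \<psi> = "\<lambda>L. {#z # L#}" and \<phi> = "alter_one \<phi>" and xs = Ls]
    by (simp add: ac_simps)
qed

text \<open>Derivations of this kind are coderivations.\<close>

lemma unshuffles_alter_one:
  "(\<Sum>us\<in>#alter_one \<phi> zs. unshuffles n us) = (\<Sum>Ls\<in>#unshuffles n zs. alter_one (alter_one \<phi>) Ls)"
proof (induction zs)
  case Nil
  have "alter_one (alter_one \<phi>) (replicate n []) = {#}" by (induction n) auto
  then show ?case by simp
next
  case (Cons z zs)
  have "(\<Sum>us\<in>#alter_one \<phi> zs. unshuffles n (z # us)) =
      (\<Sum>Ls\<in>#(\<Sum>us\<in>#alter_one \<phi> zs. unshuffles n us). insert_one z Ls)"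
    by (simp add: sum_mset_bind)
  then show ?case
    by (simp add: Cons.IH sum_mset_image sum_mset_bind insert_one_alter_one sum_mset.distrib)
      (rule sum_mset.swap)
qed

section \<open>Shape and coassociativity of unshuffles\<close>

lemma unshuffles_1: "unshuffles (Suc 0) zs = {#[zs]#}"
  by (induction zs) auto

lemma length_unshuffles: "Ls \<in># unshuffles n zs \<Longrightarrow> length Ls = n"
  by (induction zs arbitrary: Ls) (auto dest: length_alter_one)

lemma set_unshuffles: "Ls \<in># unshuffles n zs \<Longrightarrow> set zs \<subseteq> C \<Longrightarrow> set Ls \<subseteq> lists C"
proof (induction zs arbitrary: Ls)
  case Nil
  then show ?case by (auto split: if_splits)
next
  case (Cons z zs)
  then obtain Ms where "Ms \<in># unshuffles n zs" "Ls \<in># insert_one z Ms" by auto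
  with Cons show ?case by (intro set_alter_one[of Ls _ Ms]) auto
qed

text \<open>Coassociativity in the form matching \<open>iterated_coproduct\<close>, where each step
  splits the first tensor slot in two and leaves the others alone.\<close>

lemma unshuffles_Suc:
  "unshuffles (Suc (Suc n)) zs =
    (\<Sum>Ls\<in>#unshuffles (Suc n) zs. image_mset (\<lambda>Bs. Bs @ tl Ls) (unshuffles 2 (hd Ls)))"
proof (induction zs)
  case Nil
  show ?case by (simp add: numeral_2_eq_2)
next
  case (Cons z zs)
  \<comment> \<open>Inserting \<open>z\<close> into \<open>Bs @ tl Ls\<close> hits one of the two
    halves \<open>Bs\<close>, which amounts to inserting it into the head before splitting, or it
    hits the untouched tail.\<close>
  have step: "(\<Sum>Bs\<in>#unshuffles 2 (hd Ls). insert_one z (Bs @ tl Ls)) =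
      (\<Sum>Ms\<in>#insert_one z Ls. image_mset (\<lambda>Bs. Bs @ tl Ms) (unshuffles 2 (hd Ms)))"
    if Ls_in: "Ls \<in># unshuffles (Suc n) zs" for Ls
  proof -
    obtain L Ls' where Ls: "Ls = L # Ls'"
      using length_unshuffles[OF Ls_in] by (cases Ls) auto
    have "(\<Sum>Bs\<in>#unshuffles 2 L. image_mset ((@) Bs) (insert_one z Ls')) =
        (\<Sum>Ms\<in>#insert_one z Ls'. image_mset (\<lambda>Bs. Bs @ Ms) (unshuffles 2 L))"
      by (rule sum_mset_image_mset_swap)
    then show ?thesis
      by (simp add: Ls alter_one_append sum_mset.distrib sum_mset_image image_mset_sum_mset)
  qed
  have "(\<Sum>Ls\<in>#unshuffles (Suc n) zs. \<Sum>Bs\<in>#unshuffles 2 (hd Ls). insert_one z (Bs @ tl Ls)) =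
      (\<Sum>Ls\<in>#unshuffles (Suc n) zs. \<Sum>Ms\<in>#insert_one z Ls.
        image_mset (\<lambda>Bs. Bs @ tl Ms) (unshuffles 2 (hd Ms)))"
    by (rule arg_cong[where f = sum_mset], rule image_mset_cong, rule step)
  then show ?case
    by (simp only: unshuffles.simps Cons.IH sum_mset_bind sum_mset_image)
qed

section \<open>Linear maps and sums in modules\<close>

text \<open>Summands outside the carrier are skipped; this makes most laws of sums unconditional.\<close>

definition msum :: "('b, 'm) ring_scheme \<Rightarrow> ('a \<Rightarrow> 'b) \<Rightarrow> 'a multiset \<Rightarrow> 'b" where
  "msum N F K =
    fold_mset (\<lambda>x a. if F x \<in> carrier N \<and> a \<in> carrier N then F x \<oplus>\<^bsub>N\<^esub> a else a) \<zero>\<^bsub>N\<^esub> K"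

context abelian_monoid
begin

lemma msum_empty [simp]: "msum G F {#} = \<zero>"
  by (simp add: msum_def)

text \<open>Commutation is demanded for every accumulator, also for one outside the carrier; this is
  why the step tests \<open>a\<close> as well as \<open>F x\<close>.\<close>

lemma msum_step_commute:
  "comp_fun_commute (\<lambda>x a. if F x \<in> carrier G \<and> a \<in> carrier G then F x \<oplus> a else a)"
  by unfold_locales (auto simp: fun_eq_iff a_lcomm)

lemma msum_closed [simp, intro]: "msum G F K \<in> carrier G"
  by (induction K)
    (auto simp: msum_def comp_fun_commute.fold_mset_add_mset[OF msum_step_commute])

lemma msum_add_mset_if:
  "msum G F (add_mset x K) = (if F x \<in> carrier G then F x \<oplus> msum G F K else msum G F K)"
  using msum_closed[of F K]
  by (simp add: msum_def comp_fun_commute.fold_mset_add_mset[OF msum_step_commute])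

lemma msum_add_mset [simp]: "F x \<in> carrier G \<Longrightarrow> msum G F (add_mset x K) = F x \<oplus> msum G F K"
  by (simp add: msum_add_mset_if)

lemma msum_union [simp]: "msum G F (K + L) = msum G F K \<oplus> msum G F L"
  by (induction K) (auto simp: msum_add_mset_if a_assoc)

lemma msum_cong: "(\<And>x. x \<in># K \<Longrightarrow> F x = H x) \<Longrightarrow> msum G F K = msum G H K"
  by (induction K) (auto simp: msum_add_mset_if)

lemma msum_image [simp]: "msum G F (image_mset h K) = msum G (\<lambda>x. F (h x)) K"
  by (induction K) (auto simp: msum_add_mset_if)

lemma msum_bind: "msum G F (\<Sum>x\<in>#K. h x) = msum G (\<lambda>x. msum G F (h x)) K"
  by (induction K) auto

lemma msum_add:
  "(\<And>x. x \<in># K \<Longrightarrow> F x \<in> carrier G) \<Longrightarrow> (\<And>x. x \<in># K \<Longrightarrow> H x \<in> carrier G) \<Longrightarrow>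
    msum G (\<lambda>x. F x \<oplus> H x) K = msum G F K \<oplus> msum G H K"
  by (induction K) (auto simp: a_ac)

text \<open>Fubini for finite sums, needed to rewrite the convolution product of a monoid algebra as
  an iterated sum.\<close>

lemma finsum_Times:
  assumes "finite A" "finite B" "\<And>a b. a \<in> A \<Longrightarrow> b \<in> B \<Longrightarrow> F a b \<in> carrier G"
  shows "(\<Oplus>p\<in>A \<times> B. F (fst p) (snd p)) = (\<Oplus>a\<in>A. \<Oplus>b\<in>B. F a b)"
  using assms(1,3)
proof (induction A)
  case empty
  show ?case by simp
next
  case (insert a A)
  have eq: "insert a A \<times> B = Pair a ` B \<union> A \<times> B" by auto
  have row: "(\<Oplus>p\<in>Pair a ` B. F (fst p) (snd p)) = (\<Oplus>b\<in>B. F a b)"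
    using insert.prems by (subst finsum_reindex) (auto simp: inj_on_def)
  have union: "(\<Oplus>p\<in>Pair a ` B \<union> A \<times> B. F (fst p) (snd p)) =
      (\<Oplus>p\<in>Pair a ` B. F (fst p) (snd p)) \<oplus> (\<Oplus>p\<in>A \<times> B. F (fst p) (snd p))"
    using insert assms(2) by (intro finsum_Un_disjoint) auto
  have "(\<lambda>a. \<Oplus>b\<in>B. F a b) \<in> A \<rightarrow> carrier G" "(\<Oplus>b\<in>B. F a b) \<in> carrier G"
    using insert.prems by (auto intro!: finsum_closed)
  moreover have "(\<Oplus>p\<in>A \<times> B. F (fst p) (snd p)) = (\<Oplus>a\<in>A. \<Oplus>b\<in>B. F a b)"
    using insert.prems by (intro insert.IH) simp
  ultimately show ?case
    using finsum_insert[OF insert.hyps, of "\<lambda>a. \<Oplus>b\<in>B. F a b"] by (simp only: eq union row)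
qed

end

lemma (in abelian_group) minus_eq_iff:
  assumes "a \<in> carrier G" "b \<in> carrier G" "c \<in> carrier G"
  shows "a \<ominus> b = c \<longleftrightarrow> a = c \<oplus> b"
  using assms by (auto simp: a_minus_def a_assoc l_neg r_neg)

text \<open>Unlike \<^const>\<open>linear_maps\<close>, this does not require \<open>f\<close> to be extensional.\<close>

definition lin_map ::
  "('k, 'r) ring_scheme \<Rightarrow> ('k, 'a, 's) module_scheme \<Rightarrow> ('k, 'b, 't) module_scheme \<Rightarrow> ('a \<Rightarrow> 'b) \<Rightarrow> bool"
  where "lin_map R M N f \<longleftrightarrow> (\<forall>x\<in>carrier M. f x \<in> carrier N) \<and>
    (\<forall>x\<in>carrier M. \<forall>y\<in>carrier M. f (x \<oplus>\<^bsub>M\<^esub> y) = f x \<oplus>\<^bsub>N\<^esub> f y) \<and>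
    (\<forall>c\<in>carrier R. \<forall>x\<in>carrier M. f (c \<odot>\<^bsub>M\<^esub> x) = c \<odot>\<^bsub>N\<^esub> f x)"

section \<open>Linear maps and the operations that preserve linearity\<close>

lemma lin_mapI:
  assumes "\<And>x. x \<in> carrier M \<Longrightarrow> f x \<in> carrier N"
    and "\<And>x y. x \<in> carrier M \<Longrightarrow> y \<in> carrier M \<Longrightarrow> f (x \<oplus>\<^bsub>M\<^esub> y) = f x \<oplus>\<^bsub>N\<^esub> f y"
    and "\<And>c x. c \<in> carrier R \<Longrightarrow> x \<in> carrier M \<Longrightarrow> f (c \<odot>\<^bsub>M\<^esub> x) = c \<odot>\<^bsub>N\<^esub> f x"
  shows "lin_map R M N f"
  using assms by (auto simp: lin_map_def)

lemma lin_map_closed: "lin_map R M N f \<Longrightarrow> x \<in> carrier M \<Longrightarrow> f x \<in> carrier N"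
  and lin_map_plus: "lin_map R M N f \<Longrightarrow> x \<in> carrier M \<Longrightarrow> y \<in> carrier M \<Longrightarrow> f (x \<oplus>\<^bsub>M\<^esub> y) = f x \<oplus>\<^bsub>N\<^esub> f y"
  and lin_map_smult: "lin_map R M N f \<Longrightarrow> c \<in> carrier R \<Longrightarrow> x \<in> carrier M \<Longrightarrow> f (c \<odot>\<^bsub>M\<^esub> x) = c \<odot>\<^bsub>N\<^esub> f x"
  by (auto simp: lin_map_def)

lemma linear_maps_iff: "f \<in> linear_maps R M N \<longleftrightarrow> lin_map R M N f \<and> f \<in> extensional (carrier M)"
  by (auto simp: linear_maps_def lin_map_def PiE_def)

lemma linear_maps_lin: "f \<in> linear_maps R M N \<Longrightarrow> lin_map R M N f"
  by (simp add: linear_maps_iff)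

lemma lin_map_cong:
  assumes "module R M" "\<And>x. x \<in> carrier M \<Longrightarrow> f x = g x"
  shows "lin_map R M N f = lin_map R M N g"
proof -
  interpret module R M by fact
  show ?thesis using assms(2) by (simp add: lin_map_def)
qed

lemma restrict_linear_maps:
  assumes "module R M" "lin_map R M N f"
  shows "restrict f (carrier M) \<in> linear_maps R M N"
  using assms(2) lin_map_cong[OF assms(1), of "restrict f (carrier M)" f N]
  by (simp add: linear_maps_iff)

lemma linear_maps_eqI:
  "f \<in> linear_maps R M N \<Longrightarrow> g \<in> linear_maps R M N \<Longrightarrow> (\<And>x. x \<in> carrier M \<Longrightarrow> f x = g x) \<Longrightarrow> f = g"
  by (auto simp: linear_maps_iff intro: extensionalityI)

lemma lin_map_compose: "lin_map R M N f \<Longrightarrow> lin_map R N P g \<Longrightarrow> lin_map R M P (\<lambda>x. g (f x))"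
  by (simp add: lin_map_def)

lemma lin_map_id: "lin_map R M M (\<lambda>x. x)"
  by (simp add: lin_map_def)

context module
begin

lemma lin_map_0: "lin_map R N M (\<lambda>x. \<zero>\<^bsub>M\<^esub>)"
  by (simp add: lin_map_def)

lemma lin_map_add: "lin_map R N M f \<Longrightarrow> lin_map R N M g \<Longrightarrow> lin_map R N M (\<lambda>x. f x \<oplus>\<^bsub>M\<^esub> g x)"
  by (auto simp: lin_map_def smult_r_distr M.a_ac)

lemma lin_map_scale: "c \<in> carrier R \<Longrightarrow> lin_map R N M f \<Longrightarrow> lin_map R N M (\<lambda>x. c \<odot>\<^bsub>M\<^esub> f x)"
  by (auto simp: lin_map_def smult_r_distr smult_assoc1[symmetric] R.m_comm)

lemma lin_map_neg: "lin_map R N M f \<Longrightarrow> lin_map R N M (\<lambda>x. \<ominus>\<^bsub>M\<^esub> f x)"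
  by (auto simp: lin_map_def smult_r_minus M.minus_add)

lemma lin_map_diff: "lin_map R N M f \<Longrightarrow> lin_map R N M g \<Longrightarrow> lin_map R N M (\<lambda>x. f x \<ominus>\<^bsub>M\<^esub> g x)"
  by (simp add: a_minus_def lin_map_add lin_map_neg)

lemma lin_map_msum:
  assumes "module R N" "\<And>l. l \<in># K \<Longrightarrow> lin_map R N M (f l)"
  shows "lin_map R N M (\<lambda>x. msum M (\<lambda>l. f l x) K)"
  using assms(2)
proof (induction K)
  case empty
  show ?case by (simp add: lin_map_0)
next
  case (add l K)
  then have "lin_map R N M (\<lambda>x. f l x \<oplus>\<^bsub>M\<^esub> msum M (\<lambda>l. f l x) K)"
    by (intro lin_map_add) auto
  moreover have "f l x \<in> carrier M" if "x \<in> carrier N" for x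
    using add.prems that by (auto intro: lin_map_closed)
  ultimately show ?case
    by (subst lin_map_cong[OF assms(1), where g = "\<lambda>x. f l x \<oplus>\<^bsub>M\<^esub> msum M (\<lambda>l. f l x) K"]) auto
qed

lemma lin_map_finsum:
  assumes "finite A" "module R N" "\<And>l. l \<in> A \<Longrightarrow> lin_map R N M (f l)"
  shows "lin_map R N M (\<lambda>x. \<Oplus>\<^bsub>M\<^esub>l\<in>A. f l x)"
  using assms(1,3)
proof (induction A)
  case empty
  show ?case by (simp add: lin_map_0)
next
  case (insert l A)
  then have "lin_map R N M (\<lambda>x. f l x \<oplus>\<^bsub>M\<^esub> (\<Oplus>\<^bsub>M\<^esub>l\<in>A. f l x))"
    by (intro lin_map_add) auto
  moreover have "f l' x \<in> carrier M" if "x \<in> carrier N" "l' \<in> insert l A" for x l'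
    using insert.prems that by (auto intro: lin_map_closed)
  ultimately show ?case
    using insert.hyps
    by (subst lin_map_cong[OF assms(2), where g = "\<lambda>x. f l x \<oplus>\<^bsub>M\<^esub> (\<Oplus>\<^bsub>M\<^esub>l\<in>A. f l x)"])
      (auto simp: Pi_def)
qed

lemma lin_map_zero:
  assumes "lin_map R M N f" "module R N"
  shows "f \<zero>\<^bsub>M\<^esub> = \<zero>\<^bsub>N\<^esub>"
proof -
  interpret N: module R N by fact
  have "f (\<zero> \<odot>\<^bsub>M\<^esub> \<zero>\<^bsub>M\<^esub>) = \<zero> \<odot>\<^bsub>N\<^esub> f \<zero>\<^bsub>M\<^esub>"
    using assms(1) by (intro lin_map_smult) auto
  then show ?thesis using lin_map_closed[OF assms(1)] by simp
qed

lemma lin_map_uminus: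
  assumes "lin_map R M N f" "module R N" "x \<in> carrier M"
  shows "f (\<ominus>\<^bsub>M\<^esub> x) = \<ominus>\<^bsub>N\<^esub> f x"
proof -
  interpret N: module R N by fact
  have "f (\<ominus>\<^bsub>M\<^esub> x) \<oplus>\<^bsub>N\<^esub> f x = \<zero>\<^bsub>N\<^esub>"
    using lin_map_plus[OF assms(1), of "\<ominus>\<^bsub>M\<^esub> x" x] lin_map_zero[OF assms(1,2)] assms(3)
    by (simp add: M.l_neg)
  then show ?thesis
    using lin_map_closed[OF assms(1)] assms(3) by (intro N.minus_equality[symmetric]) auto
qed

lemma lin_map_minus:
  assumes "lin_map R M N f" "module R N" "x \<in> carrier M" "y \<in> carrier M"
  shows "f (x \<ominus>\<^bsub>M\<^esub> y) = f x \<ominus>\<^bsub>N\<^esub> f y"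
  using assms by (simp add: a_minus_def lin_map_plus lin_map_uminus)

lemma lin_map_msum_apply:
  assumes "lin_map R M N f" "module R N" "\<And>x. x \<in># K \<Longrightarrow> F x \<in> carrier M"
  shows "f (msum M F K) = msum N (\<lambda>x. f (F x)) K"
proof -
  interpret N: module R N by fact
  show ?thesis
    using assms(3)
    by (induction K)
      (auto simp: lin_map_zero[OF assms(1,2)] lin_map_plus[OF assms(1)] lin_map_closed[OF assms(1)])
qed

end

text \<open>Phrased as an induction principle over arbitrary sets \<open>U\<close> instead of
  through generated submodules, because its purpose is to transfer properties from generators to all
  elements.\<close>

definition spanning :: "('k, 'r) ring_scheme \<Rightarrow> ('k, 'a, 's) module_scheme \<Rightarrow> 'a set \<Rightarrow> bool" where
  "spanning R M X \<longleftrightarrow> X \<subseteq> carrier M \<and> (\<forall>U. X \<subseteq> U \<longrightarrow> \<zero>\<^bsub>M\<^esub> \<in> U \<longrightarrow>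
    (\<forall>x\<in>carrier M. \<forall>y\<in>carrier M. x \<in> U \<longrightarrow> y \<in> U \<longrightarrow> x \<oplus>\<^bsub>M\<^esub> y \<in> U) \<longrightarrow>
    (\<forall>c\<in>carrier R. \<forall>x\<in>carrier M. x \<in> U \<longrightarrow> c \<odot>\<^bsub>M\<^esub> x \<in> U) \<longrightarrow> carrier M \<subseteq> U)"

lemma spanning_subset: "spanning R M X \<Longrightarrow> X \<subseteq> carrier M"
  by (simp add: spanning_def)

lemma spanning_induct [consumes 2, case_names base zero add smult]:
  assumes "spanning R M X" "x \<in> carrier M"
    and "\<And>x. x \<in> X \<Longrightarrow> P x" "P \<zero>\<^bsub>M\<^esub>"
    and "\<And>x y. x \<in> carrier M \<Longrightarrow> y \<in> carrier M \<Longrightarrow> P x \<Longrightarrow> P y \<Longrightarrow> P (x \<oplus>\<^bsub>M\<^esub> y)"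
    and "\<And>c x. c \<in> carrier R \<Longrightarrow> x \<in> carrier M \<Longrightarrow> P x \<Longrightarrow> P (c \<odot>\<^bsub>M\<^esub> x)"
  shows "P x"
proof -
  have "carrier M \<subseteq> Collect P"
    using assms(1,3-) unfolding spanning_def by (elim conjE allE[of _ "Collect P"]) auto
  then show ?thesis using assms(2) by auto
qed

lemma lin_map_eq_on_spanning:
  assumes "spanning R M X" "module R M" "module R N" "lin_map R M N f" "lin_map R M N g"
    and "\<And>x. x \<in> X \<Longrightarrow> f x = g x" "x \<in> carrier M"
  shows "f x = g x"
  using assms(1,7)
proof (induction rule: spanning_induct)
  case zero
  show ?case using assms by (simp add: module.lin_map_zero)
qed (use assms in \<open>auto simp: lin_map_plus lin_map_smult\<close>)

lemma spanning_image:
  assumes "spanning R M X" "module R M" "module R N" "lin_map R M N f" "f ` carrier M = carrier N"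
  shows "spanning R N (f ` X)"
  unfolding spanning_def
proof (intro conjI allI impI)
  show "f ` X \<subseteq> carrier N" using assms(5) spanning_subset[OF assms(1)] by auto
  fix U
  assume U: "f ` X \<subseteq> U" "\<zero>\<^bsub>N\<^esub> \<in> U"
    "\<forall>x\<in>carrier N. \<forall>y\<in>carrier N. x \<in> U \<longrightarrow> y \<in> U \<longrightarrow> x \<oplus>\<^bsub>N\<^esub> y \<in> U"
    "\<forall>c\<in>carrier R. \<forall>x\<in>carrier N. x \<in> U \<longrightarrow> c \<odot>\<^bsub>N\<^esub> x \<in> U"
  have "f x \<in> U" if "x \<in> carrier M" for x
    using assms(1) that
  proof (induction rule: spanning_induct)
    case zero
    show ?case using U assms by (simp add: module.lin_map_zero)
  qed (use U assms(4) in \<open>auto simp: lin_map_plus lin_map_smult lin_map_closed\<close>)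
  then show "carrier N \<subseteq> U" unfolding assms(5)[symmetric] by auto
qed

lemma (in algebra) lin_map_mult_right: "a \<in> carrier M \<Longrightarrow> lin_map R M M (\<lambda>x. x \<otimes>\<^bsub>M\<^esub> a)"
  by (rule lin_mapI) (auto simp: cring.cring_simprules(5,13)[OF M_cring] smult_assoc2)

lemma (in algebra) lin_map_mult_left: "a \<in> carrier M \<Longrightarrow> lin_map R M M (\<lambda>x. a \<otimes>\<^bsub>M\<^esub> x)"
  using lin_map_mult_right[of a] lin_map_cong[OF module, of "\<lambda>x. a \<otimes>\<^bsub>M\<^esub> x" "\<lambda>x. x \<otimes>\<^bsub>M\<^esub> a" M]
  by (simp add: cring.cring_simprules(14)[OF M_cring])

text \<open>The elements \<open>t\<close> for which \<open>y \<mapsto> g y t\<close> is linear are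
  closed under the module operations, since each \<open>g y\<close> is linear. This gives linearity
  in a parameter for maps that were constructed separately for each parameter value by a universal
  property.\<close>

lemma lin_map_param_spanning:
  assumes "spanning R M X" "module R M" "module R N" "module R P"
    and g: "\<And>y. y \<in> carrier N \<Longrightarrow> lin_map R M P (g y)"
    and base: "\<And>x. x \<in> X \<Longrightarrow> lin_map R N P (\<lambda>y. g y x)"
    and "t \<in> carrier M"
  shows "lin_map R N P (\<lambda>y. g y t)"
  using assms(1,7)
proof (induction t rule: spanning_induct)
  case (base t)
  then show ?case by (rule assms(6))
next
  case zero
  have "g y \<zero>\<^bsub>M\<^esub> = \<zero>\<^bsub>P\<^esub>" if "y \<in> carrier N" for y
    by (rule module.lin_map_zero[OF assms(2) g[OF that] assms(4)])
  then show ?case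
    using module.lin_map_0[OF assms(4), of N] by (subst lin_map_cong[OF assms(3)]) auto
next
  case (add s t)
  have "g y (s \<oplus>\<^bsub>M\<^esub> t) = g y s \<oplus>\<^bsub>P\<^esub> g y t" if "y \<in> carrier N" for y
    by (rule lin_map_plus[OF g[OF that] add.hyps])
  then show ?case
    using module.lin_map_add[OF assms(4) add.IH] by (subst lin_map_cong[OF assms(3)]) auto
next
  case (smult c t)
  have "g y (c \<odot>\<^bsub>M\<^esub> t) = c \<odot>\<^bsub>P\<^esub> g y t" if "y \<in> carrier N" for y
    by (rule lin_map_smult[OF g[OF that] smult.hyps])
  then show ?case
    using module.lin_map_scale[OF assms(4) smult.hyps(1) smult.IH] by (subst lin_map_cong[OF assms(3)]) auto
qed

lemma bilin_eq_on_spanning: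
  assumes "spanning R M X" "spanning R N Y" "module R M" "module R N" "module R P"
    and "\<And>y. y \<in> carrier N \<Longrightarrow> lin_map R M P (\<lambda>x. f x y)" "\<And>x. x \<in> carrier M \<Longrightarrow> lin_map R N P (f x)"
    and "\<And>y. y \<in> carrier N \<Longrightarrow> lin_map R M P (\<lambda>x. g x y)" "\<And>x. x \<in> carrier M \<Longrightarrow> lin_map R N P (g x)"
    and "\<And>x y. x \<in> X \<Longrightarrow> y \<in> Y \<Longrightarrow> f x y = g x y"
    and "x \<in> carrier M" "y \<in> carrier N"
  shows "f x y = g x y"
proof -
  have "f x y = g x y" if "x \<in> X" for x
    using that spanning_subset[OF assms(1)] assms
    by (intro lin_map_eq_on_spanning[OF assms(2,4,5), of "f x" "g x" y]) auto
  then show ?thesis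
    using assms by (intro lin_map_eq_on_spanning[OF assms(1,3,5), of "\<lambda>x. f x y" "\<lambda>x. g x y" x]) auto
qed

text \<open>Both sides are bilinear in \<open>x\<close> and \<open>y\<close>, so multiplicativity
  only has to be tested on generators of the module.\<close>

lemma lin_map_mult_on_spanning:
  assumes "algebra R A" "algebra R B" "spanning R A X" "lin_map R A B h"
    and "\<And>x y. x \<in> X \<Longrightarrow> y \<in> X \<Longrightarrow> h (x \<otimes>\<^bsub>A\<^esub> y) = h x \<otimes>\<^bsub>B\<^esub> h y"
    and "x \<in> carrier A" "y \<in> carrier A"
  shows "h (x \<otimes>\<^bsub>A\<^esub> y) = h x \<otimes>\<^bsub>B\<^esub> h y"
proof -
  interpret A: algebra R A by fact
  interpret B: algebra R B by fact
  note h = lin_map_closed[OF assms(4)]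
  show ?thesis
  proof (rule bilin_eq_on_spanning[OF assms(3,3) A.module A.module B.module _ _ _ _ assms(5-7)])
    show "lin_map R A B (\<lambda>x. h (x \<otimes>\<^bsub>A\<^esub> y))" "lin_map R A B (\<lambda>x. h x \<otimes>\<^bsub>B\<^esub> h y)" if "y \<in> carrier A" for y
      using lin_map_compose[OF A.lin_map_mult_right[OF that] assms(4)]
        lin_map_compose[OF assms(4) B.lin_map_mult_right[OF h[OF that]]] .
    show "lin_map R A B (\<lambda>y. h (x \<otimes>\<^bsub>A\<^esub> y))" "lin_map R A B (\<lambda>y. h x \<otimes>\<^bsub>B\<^esub> h y)" if "x \<in> carrier A" for x
      using lin_map_compose[OF A.lin_map_mult_left[OF that] assms(4)]
        lin_map_compose[OF assms(4) B.lin_map_mult_left[OF h[OF that]]] .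
  qed
qed

section \<open>Monoid algebras\<close>

definition supp :: "('k, 'r) ring_scheme \<Rightarrow> ('g \<Rightarrow> 'k) \<Rightarrow> 'g set" where
  "supp R f = {g. f g \<noteq> \<zero>\<^bsub>R\<^esub>}"

definition lin_extend ::
  "('k, 'r) ring_scheme \<Rightarrow> ('k, 'w, 's) module_scheme \<Rightarrow> ('g \<Rightarrow> 'w) \<Rightarrow> ('g \<Rightarrow> 'k) \<Rightarrow> 'w" where
  "lin_extend R W u f = (\<Oplus>\<^bsub>W\<^esub>a\<in>supp R f. f a \<odot>\<^bsub>W\<^esub> u a)"

locale comm_monoid_algebra = R?: cring R + G?: comm_monoid G
  for R :: "('k, 'r) ring_scheme" (structure) and G :: "('g, 'm) monoid_scheme"
begin

abbreviation P where "P \<equiv> monoid_algebra R G"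

lemma monoid_algebra_simps [simp]:
  "\<zero>\<^bsub>P\<^esub> = (\<lambda>g. \<zero>)" "f \<oplus>\<^bsub>P\<^esub> h = (\<lambda>g. f g \<oplus> h g)" "c \<odot>\<^bsub>P\<^esub> f = (\<lambda>g. c \<otimes> f g)"
  "\<one>\<^bsub>P\<^esub> = basis_elt R \<one>\<^bsub>G\<^esub>"
  by (simp_all add: monoid_algebra_def basis_elt_def)

lemma carrier_monoid_algebra_iff: "f \<in> carrier P \<longleftrightarrow> finite (supp R f) \<and> supp R f \<subseteq> carrier G \<and> (\<forall>g. f g \<in> carrier R)"
  by (auto simp: monoid_algebra_def supp_def)

lemma monoid_algebra_finite_supp: "f \<in> carrier P \<Longrightarrow> finite (supp R f)"
  and monoid_algebra_supp: "f \<in> carrier P \<Longrightarrow> supp R f \<subseteq> carrier G"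
  and monoid_algebra_coeff [simp]: "f \<in> carrier P \<Longrightarrow> f g \<in> carrier R"
  by (auto simp: carrier_monoid_algebra_iff)

lemma carrier_monoid_algebraI:
  "finite A \<Longrightarrow> A \<subseteq> carrier G \<Longrightarrow> supp R f \<subseteq> A \<Longrightarrow> (\<And>g. f g \<in> carrier R) \<Longrightarrow> f \<in> carrier P"
  by (auto simp: carrier_monoid_algebra_iff intro: finite_subset)

lemma basis_elt_closed [simp]: "g \<in> carrier G \<Longrightarrow> basis_elt R g \<in> carrier P"
  by (rule carrier_monoid_algebraI[of "{g}"]) (auto simp: supp_def basis_elt_def)

lemma monoid_algebra_module: "module R P"
proof (rule moduleI)
  show "cring R" by (rule R.is_cring)
  have add: "(\<lambda>g. f g \<oplus> h g) \<in> carrier P" if "f \<in> carrier P" "h \<in> carrier P" for f h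
  proof (rule carrier_monoid_algebraI[of "supp R f \<union> supp R h"])
    show "supp R (\<lambda>g. f g \<oplus> h g) \<subseteq> supp R f \<union> supp R h" by (auto simp: supp_def)
  qed (use that in \<open>auto simp: carrier_monoid_algebra_iff\<close>)
  have zero: "(\<lambda>g. \<zero>) \<in> carrier P"
    by (rule carrier_monoid_algebraI[of "{}"]) (auto simp: supp_def)
  have smult: "(\<lambda>g. c \<otimes> f g) \<in> carrier P" if "c \<in> carrier R" "f \<in> carrier P" for c f
  proof (rule carrier_monoid_algebraI[of "supp R f"])
    show "supp R (\<lambda>g. c \<otimes> f g) \<subseteq> supp R f" using that by (auto simp: supp_def)
  qed (use that in \<open>auto simp: carrier_monoid_algebra_iff\<close>)
  show "abelian_group P"
  proof (rule abelian_groupI)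
    fix f assume f: "f \<in> carrier P"
    have "(\<lambda>g. \<ominus> \<one> \<otimes> f g) \<in> carrier P" using f by (intro smult) auto
    moreover have "(\<lambda>g. \<ominus> \<one> \<otimes> f g) \<oplus>\<^bsub>P\<^esub> f = \<zero>\<^bsub>P\<^esub>"
      using f by (auto simp: R.l_minus R.l_neg)
    ultimately show "\<exists>h\<in>carrier P. h \<oplus>\<^bsub>P\<^esub> f = \<zero>\<^bsub>P\<^esub>" by blast
  qed (auto simp: add zero R.a_ac)
  show "\<And>a f. a \<in> carrier R \<Longrightarrow> f \<in> carrier P \<Longrightarrow> a \<odot>\<^bsub>P\<^esub> f \<in> carrier P"
    by (simp add: smult)
qed (auto simp: R.l_distr R.r_distr R.m_assoc)

lemma monoid_algebra_finsum_apply: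
  assumes "finite A" "F \<in> A \<rightarrow> carrier P"
  shows "(finsum P F A) g = (\<Oplus>a\<in>A. F a g)"
proof -
  interpret P: module R P by (rule monoid_algebra_module)
  show ?thesis
    using assms
  proof (induction A)
    case (insert a A)
    then show ?case
      using R.finsum_insert[of A a "\<lambda>a. F a g"] by (auto simp: P.M.finsum_insert Pi_def)
  qed simp
qed

text \<open>Two functions and their sum have different supports, so additivity of
  \<open>lin_extend\<close> requires all three sums over one common finite index set; the extra
  terms have coefficient zero.\<close>

lemma lin_extend_superset:
  assumes "module R W" "u \<in> carrier G \<rightarrow> carrier W"
    and "f \<in> carrier P" "finite A" "supp R f \<subseteq> A" "A \<subseteq> carrier G"
  shows "lin_extend R W u f = (\<Oplus>\<^bsub>W\<^esub>a\<in>A. f a \<odot>\<^bsub>W\<^esub> u a)"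
proof -
  interpret W: module R W by fact
  show ?thesis
    unfolding lin_extend_def
    by (rule W.M.add.finprod_mono_neutral_cong_left)
      (use assms in \<open>auto simp: supp_def Pi_def subset_iff\<close>)
qed

lemma lin_extend_lin:
  assumes "module R W" "u \<in> carrier G \<rightarrow> carrier W"
  shows "lin_map R P W (lin_extend R W u)"
proof -
  interpret W: module R W by fact
  interpret P: module R P by (rule monoid_algebra_module)
  have closed: "(\<lambda>a. f a \<odot>\<^bsub>W\<^esub> u a) \<in> A \<rightarrow> carrier W" if "f \<in> carrier P" "A \<subseteq> carrier G" for f A
    using that monoid_algebra_coeff[OF that(1)] assms(2) W.smult_closed by blast
  show ?thesis
  proof (rule lin_mapI)
    fix f assume f: "f \<in> carrier P"
    show "lin_extend R W u f \<in> carrier W"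
      unfolding lin_extend_def by (rule W.M.finsum_closed[OF closed[OF f monoid_algebra_supp[OF f]]])
  next
    fix f h assume f: "f \<in> carrier P" and h: "h \<in> carrier P"
    define A where "A = supp R f \<union> supp R h"
    have A: "finite A" "A \<subseteq> carrier G" using f h by (auto simp: A_def carrier_monoid_algebra_iff)
    have fh: "f \<oplus>\<^bsub>P\<^esub> h \<in> carrier P" "supp R (f \<oplus>\<^bsub>P\<^esub> h) \<subseteq> A"
      using f h P.M.a_closed[OF f h] by (auto simp: A_def supp_def)
    have "(\<Oplus>\<^bsub>W\<^esub>a\<in>A. (f \<oplus>\<^bsub>P\<^esub> h) a \<odot>\<^bsub>W\<^esub> u a) = (\<Oplus>\<^bsub>W\<^esub>a\<in>A. f a \<odot>\<^bsub>W\<^esub> u a \<oplus>\<^bsub>W\<^esub> h a \<odot>\<^bsub>W\<^esub> u a)"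
      by (rule W.M.finsum_cong')
        (use closed[OF f A(2)] closed[OF h A(2)] A f h assms(2) in
          \<open>auto simp: Pi_iff intro!: W.smult_l_distr\<close>)
    also have "\<dots> = (\<Oplus>\<^bsub>W\<^esub>a\<in>A. f a \<odot>\<^bsub>W\<^esub> u a) \<oplus>\<^bsub>W\<^esub> (\<Oplus>\<^bsub>W\<^esub>a\<in>A. h a \<odot>\<^bsub>W\<^esub> u a)"
      by (rule W.M.finsum_addf) (use closed f h A in auto)
    finally show "lin_extend R W u (f \<oplus>\<^bsub>P\<^esub> h) = lin_extend R W u f \<oplus>\<^bsub>W\<^esub> lin_extend R W u h"
      using lin_extend_superset[OF assms _ A(1) _ A(2)] f h fh by (simp add: A_def)
  next
    fix c f assume c: "c \<in> carrier R" and f: "f \<in> carrier P"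
    have cf: "c \<odot>\<^bsub>P\<^esub> f \<in> carrier P" "supp R (c \<odot>\<^bsub>P\<^esub> f) \<subseteq> supp R f"
      using c f P.smult_closed[OF c f] by (auto simp: supp_def)
    have "lin_extend R W u (c \<odot>\<^bsub>P\<^esub> f) = (\<Oplus>\<^bsub>W\<^esub>a\<in>supp R f. (c \<odot>\<^bsub>P\<^esub> f) a \<odot>\<^bsub>W\<^esub> u a)"
      using f cf by (intro lin_extend_superset[OF assms]) (auto simp: monoid_algebra_finite_supp dest: monoid_algebra_supp)
    also have "\<dots> = (\<Oplus>\<^bsub>W\<^esub>a\<in>supp R f. c \<odot>\<^bsub>W\<^esub> (f a \<odot>\<^bsub>W\<^esub> u a))"
      by (rule W.M.finsum_cong')
        (use c f monoid_algebra_supp[OF f] closed[OF f monoid_algebra_supp[OF f]] assms(2) in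
          \<open>auto simp: Pi_iff intro!: W.smult_assoc1\<close>)
    also have "\<dots> = c \<odot>\<^bsub>W\<^esub> lin_extend R W u f"
      unfolding lin_extend_def
      using c f closed monoid_algebra_supp by (intro W.finsum_smult_ldistr[symmetric]) (auto simp: monoid_algebra_finite_supp)
    finally show "lin_extend R W u (c \<odot>\<^bsub>P\<^esub> f) = c \<odot>\<^bsub>W\<^esub> lin_extend R W u f" .
  qed
qed

lemma lin_extend_basis:
  assumes "module R W" "u \<in> carrier G \<rightarrow> carrier W" "g \<in> carrier G"
  shows "lin_extend R W u (basis_elt R g) = u g"
proof -
  interpret W: module R W by fact
  have "u g \<in> carrier W" using assms by auto
  moreover have "lin_extend R W u (basis_elt R g) = (\<Oplus>\<^bsub>W\<^esub>a\<in>{g}. basis_elt R g a \<odot>\<^bsub>W\<^esub> u a)"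
  proof (rule lin_extend_superset[OF assms(1,2) basis_elt_closed[OF assms(3)]])
    show "supp R (basis_elt R g) \<subseteq> {g}" by (auto simp: supp_def basis_elt_def)
  qed (use assms(3) in auto)
  ultimately show ?thesis by (simp add: basis_elt_def)
qed

lemma lin_extend_apply:
  assumes "f \<in> carrier P" "u \<in> carrier G \<rightarrow> carrier P"
  shows "lin_extend R P u f g = (\<Oplus>a\<in>supp R f. f a \<otimes> u a g)"
proof -
  interpret P: module R P by (rule monoid_algebra_module)
  have "(\<lambda>a. f a \<odot>\<^bsub>P\<^esub> u a) \<in> supp R f \<rightarrow> carrier P"
    using assms(2) monoid_algebra_supp[OF assms(1)] monoid_algebra_coeff[OF assms(1)] P.smult_closed by blast
  from monoid_algebra_finsum_apply[OF monoid_algebra_finite_supp[OF assms(1)] this] show ?thesis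
    unfolding lin_extend_def by simp
qed

lemma lin_extend_basis_elt:
  assumes "f \<in> carrier P"
  shows "lin_extend R P (basis_elt R) f = f"
proof
  fix g
  have "lin_extend R P (basis_elt R) f g = (\<Oplus>a\<in>supp R f. f a \<otimes> basis_elt R a g)"
    using assms by (intro lin_extend_apply) auto
  also have "\<dots> = (\<Oplus>a\<in>supp R f. if g = a then f a else \<zero>)"
    using assms by (intro R.finsum_cong') (auto simp: basis_elt_def)
  also have "\<dots> = f g"
  proof (cases "g \<in> supp R f")
    case True
    then show ?thesis using assms by (intro R.finsum_singleton) (auto simp: monoid_algebra_finite_supp)
  next
    case False
    then have "(\<Oplus>a\<in>supp R f. if g = a then f a else \<zero>) = \<zero>"
      by (intro R.add.finprod_one_eqI) auto
    then show ?thesis using False by (simp add: supp_def)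
  qed
  finally show "lin_extend R P (basis_elt R) f g = f g" .
qed

lemma basis_spanning: "spanning R P (basis_elt R ` carrier G)"
  unfolding spanning_def
proof (intro conjI allI impI subsetI)
  interpret P: module R P by (rule monoid_algebra_module)
  show "x \<in> carrier P" if "x \<in> basis_elt R ` carrier G" for x using that by auto
  fix U f
  assume U: "basis_elt R ` carrier G \<subseteq> U" "\<zero>\<^bsub>P\<^esub> \<in> U"
    "\<forall>x\<in>carrier P. \<forall>y\<in>carrier P. x \<in> U \<longrightarrow> y \<in> U \<longrightarrow> x \<oplus>\<^bsub>P\<^esub> y \<in> U"
    "\<forall>c\<in>carrier R. \<forall>x\<in>carrier P. x \<in> U \<longrightarrow> c \<odot>\<^bsub>P\<^esub> x \<in> U" and f: "f \<in> carrier P"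
  have "finsum P (\<lambda>a. f a \<odot>\<^bsub>P\<^esub> basis_elt R a) A \<in> U" if "finite A" "A \<subseteq> carrier G" for A
    using that
  proof (induction A)
    case empty
    show ?case using U(2) by (simp only: P.M.finsum_empty)
  next
    case (insert a A)
    have c: "f b \<odot>\<^bsub>P\<^esub> basis_elt R b \<in> carrier P" "f b \<odot>\<^bsub>P\<^esub> basis_elt R b \<in> U" if "b \<in> carrier G" for b
      using that U f by (auto simp del: monoid_algebra_simps)
    then have "finsum P (\<lambda>a. f a \<odot>\<^bsub>P\<^esub> basis_elt R a) (insert a A) =
        f a \<odot>\<^bsub>P\<^esub> basis_elt R a \<oplus>\<^bsub>P\<^esub> finsum P (\<lambda>a. f a \<odot>\<^bsub>P\<^esub> basis_elt R a) A"
      using insert by (intro P.M.finsum_insert) auto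
    also have "\<dots> \<in> U"
    proof -
      have "finsum P (\<lambda>a. f a \<odot>\<^bsub>P\<^esub> basis_elt R a) A \<in> carrier P"
        using insert.prems c(1) by (intro P.M.finsum_closed) auto
      then show ?thesis using U(3) c insert by (auto simp del: monoid_algebra_simps)
    qed
    finally show ?case .
  qed
  from this[OF monoid_algebra_finite_supp[OF f] monoid_algebra_supp[OF f]] show "f \<in> U"
    using lin_extend_basis_elt[OF f] unfolding lin_extend_def by simp
qed

text \<open>Identifies the convolution product with the bilinear extension of the product of
  \<open>G\<close>. Bilinearity can then be read off from \<open>lin_extend\<close>, and the ring
  axioms reduce to basis elements.\<close>

lemma monoid_algebra_mult_eq:
  assumes f: "f \<in> carrier P" and h: "h \<in> carrier P"
  shows "f \<otimes>\<^bsub>P\<^esub> h = lin_extend R P (\<lambda>a. lin_extend R P (\<lambda>b. basis_elt R (a \<otimes>\<^bsub>G\<^esub> b)) h) f"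
proof
  fix g
  let ?F = "\<lambda>a b. if a \<otimes>\<^bsub>G\<^esub> b = g then f a \<otimes> h b else \<zero>"
  have fin: "finite (supp R f)" "finite (supp R h)" and sub: "supp R f \<subseteq> carrier G" "supp R h \<subseteq> carrier G"
    and F: "?F a b \<in> carrier R" for a b
    using f h by (auto simp: carrier_monoid_algebra_iff)
  have inner: "lin_extend R P (\<lambda>b. basis_elt R (a \<otimes>\<^bsub>G\<^esub> b)) h \<in> carrier P"
      "lin_extend R P (\<lambda>b. basis_elt R (a \<otimes>\<^bsub>G\<^esub> b)) h g = (\<Oplus>b\<in>supp R h. h b \<otimes> basis_elt R (a \<otimes>\<^bsub>G\<^esub> b) g)"
    if "a \<in> carrier G" for a
    using that h by (auto intro!: lin_extend_apply lin_map_closed[OF lin_extend_lin[OF monoid_algebra_module]])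
  have "(f \<otimes>\<^bsub>P\<^esub> h) g = (\<Oplus>p\<in>{(a, b). f a \<noteq> \<zero> \<and> h b \<noteq> \<zero> \<and> a \<otimes>\<^bsub>G\<^esub> b = g}. f (fst p) \<otimes> h (snd p))"
    by (simp add: monoid_algebra_def)
  \<comment> \<open>The sum over the fibre of the product map is spread over the whole rectangle of
    supports, with zeros off the fibre, so that it splits into a double sum.\<close>
  also have "\<dots> = (\<Oplus>p\<in>supp R f \<times> supp R h. ?F (fst p) (snd p))"
    by (rule R.add.finprod_mono_neutral_cong_left) (use fin F f h in \<open>auto simp: supp_def\<close>)
  also have "\<dots> = (\<Oplus>a\<in>supp R f. \<Oplus>b\<in>supp R h. ?F a b)"
    by (rule R.finsum_Times[OF fin F])
  also have "\<dots> = (\<Oplus>a\<in>supp R f. f a \<otimes> (\<Oplus>b\<in>supp R h. h b \<otimes> basis_elt R (a \<otimes>\<^bsub>G\<^esub> b) g))"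
  proof (rule R.finsum_cong')
    fix a assume "a \<in> supp R f"
    have "(\<Oplus>b\<in>supp R h. ?F a b) = (\<Oplus>b\<in>supp R h. f a \<otimes> (h b \<otimes> basis_elt R (a \<otimes>\<^bsub>G\<^esub> b) g))"
      by (rule R.finsum_cong') (use f h in \<open>auto simp: basis_elt_def\<close>)
    also have "\<dots> = f a \<otimes> (\<Oplus>b\<in>supp R h. h b \<otimes> basis_elt R (a \<otimes>\<^bsub>G\<^esub> b) g)"
      by (rule R.finsum_rdistr[symmetric]) (use fin f h in \<open>auto simp: basis_elt_def\<close>)
    finally show "(\<Oplus>b\<in>supp R h. ?F a b) = \<dots>" .
  next
    show "(\<lambda>a. f a \<otimes> (\<Oplus>b\<in>supp R h. h b \<otimes> basis_elt R (a \<otimes>\<^bsub>G\<^esub> b) g)) \<in> supp R f \<rightarrow> carrier R"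
      using f h by (auto intro!: R.m_closed R.finsum_closed simp: basis_elt_def)
  qed simp
  also have "\<dots> = (\<Oplus>a\<in>supp R f. f a \<otimes> lin_extend R P (\<lambda>b. basis_elt R (a \<otimes>\<^bsub>G\<^esub> b)) h g)"
  proof (rule R.finsum_cong')
    show "(\<lambda>a. f a \<otimes> lin_extend R P (\<lambda>b. basis_elt R (a \<otimes>\<^bsub>G\<^esub> b)) h g) \<in> supp R f \<rightarrow> carrier R"
      using f inner(1) sub by (auto intro!: R.m_closed)
  qed (use sub inner(2) in auto)
  also have "\<dots> = lin_extend R P (\<lambda>a. lin_extend R P (\<lambda>b. basis_elt R (a \<otimes>\<^bsub>G\<^esub> b)) h) f g"
    using inner(1) by (intro lin_extend_apply[symmetric, OF f]) auto
  finally show "(f \<otimes>\<^bsub>P\<^esub> h) g = \<dots>" .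
qed

lemma monoid_algebra_mult_lin_left:
  assumes "h \<in> carrier P"
  shows "lin_map R P P (\<lambda>f. f \<otimes>\<^bsub>P\<^esub> h)"
proof -
  have "(\<lambda>a. lin_extend R P (\<lambda>b. basis_elt R (a \<otimes>\<^bsub>G\<^esub> b)) h) \<in> carrier G \<rightarrow> carrier P"
    using assms by (auto intro!: lin_map_closed[OF lin_extend_lin[OF monoid_algebra_module]])
  from lin_extend_lin[OF monoid_algebra_module this] show ?thesis
    using assms by (subst lin_map_cong[OF monoid_algebra_module]) (auto simp: monoid_algebra_mult_eq)
qed

lemma monoid_algebra_mult_lin_right:
  assumes f: "f \<in> carrier P"
  shows "lin_map R P P (\<lambda>h. f \<otimes>\<^bsub>P\<^esub> h)"
proof -
  interpret P: module R P by (rule monoid_algebra_module)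
  have inner: "lin_map R P P (lin_extend R P (\<lambda>b. basis_elt R (a \<otimes>\<^bsub>G\<^esub> b)))" if "a \<in> carrier G" for a
    using that by (intro lin_extend_lin[OF monoid_algebra_module]) auto
  have "lin_map R P P (\<lambda>h. \<Oplus>\<^bsub>P\<^esub>a\<in>A. f a \<odot>\<^bsub>P\<^esub> lin_extend R P (\<lambda>b. basis_elt R (a \<otimes>\<^bsub>G\<^esub> b)) h)"
    if "finite A" "A \<subseteq> carrier G" for A
    using that
    by (intro P.lin_map_finsum P.lin_map_scale inner monoid_algebra_coeff[OF f] monoid_algebra_module) auto
  from this[OF monoid_algebra_finite_supp[OF f] monoid_algebra_supp[OF f]] show ?thesis
    using f by (subst lin_map_cong[OF monoid_algebra_module]) (auto simp: monoid_algebra_mult_eq lin_extend_def)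
qed

lemma basis_elt_mult:
  assumes "a \<in> carrier G" "b \<in> carrier G"
  shows "basis_elt R a \<otimes>\<^bsub>P\<^esub> basis_elt R b = basis_elt R (a \<otimes>\<^bsub>G\<^esub> b)"
proof -
  have "(\<lambda>a. lin_extend R P (\<lambda>b. basis_elt R (a \<otimes>\<^bsub>G\<^esub> b)) (basis_elt R b)) \<in> carrier G \<rightarrow> carrier P"
    using assms by (auto intro!: lin_map_closed[OF lin_extend_lin[OF monoid_algebra_module]])
  then show ?thesis
    using assms by (simp add: monoid_algebra_mult_eq lin_extend_basis[OF monoid_algebra_module] Pi_def)
qed

text \<open>Commutativity, associativity and the unit law are multilinear identities, so they are
  inherited from the monoid \<open>G\<close> through the basis elements.\<close>

lemma monoid_algebra_algebra: "algebra R P"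
proof -
  interpret P: module R P by (rule monoid_algebra_module)
  note closed = lin_map_closed[OF monoid_algebra_mult_lin_left]
  note basis_closed = basis_elt_closed
  have comm: "x \<otimes>\<^bsub>P\<^esub> y = y \<otimes>\<^bsub>P\<^esub> x" if "x \<in> carrier P" "y \<in> carrier P" for x y
    by (rule bilin_eq_on_spanning[OF basis_spanning basis_spanning monoid_algebra_module monoid_algebra_module monoid_algebra_module _ _ _ _ _ that])
      (auto simp: basis_elt_mult G.m_comm intro: monoid_algebra_mult_lin_left monoid_algebra_mult_lin_right)
  \<comment> \<open>Associativity is trilinear, whereas \<open>bilin_eq_on_spanning\<close> treats
    two arguments. The third one is therefore held at a basis element here and released in
    \<open>assoc\<close>.\<close>
  have assoc_basis: "(x \<otimes>\<^bsub>P\<^esub> y) \<otimes>\<^bsub>P\<^esub> basis_elt R c = x \<otimes>\<^bsub>P\<^esub> (y \<otimes>\<^bsub>P\<^esub> basis_elt R c)"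
    if "c \<in> carrier G" "x \<in> carrier P" "y \<in> carrier P" for x y c
  proof (rule bilin_eq_on_spanning[OF basis_spanning basis_spanning monoid_algebra_module monoid_algebra_module monoid_algebra_module _ _ _ _ _ that(2,3)])
    note c = basis_elt_closed[OF that(1)]
    show "lin_map R P P (\<lambda>x. x \<otimes>\<^bsub>P\<^esub> y \<otimes>\<^bsub>P\<^esub> basis_elt R c)" if "y \<in> carrier P" for y
      by (rule lin_map_compose[OF monoid_algebra_mult_lin_left[OF that] monoid_algebra_mult_lin_left[OF c]])
    show "lin_map R P P (\<lambda>y. x \<otimes>\<^bsub>P\<^esub> y \<otimes>\<^bsub>P\<^esub> basis_elt R c)" if "x \<in> carrier P" for x
      by (rule lin_map_compose[OF monoid_algebra_mult_lin_right[OF that] monoid_algebra_mult_lin_left[OF c]])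
    show "lin_map R P P (\<lambda>x. x \<otimes>\<^bsub>P\<^esub> (y \<otimes>\<^bsub>P\<^esub> basis_elt R c))" if "y \<in> carrier P" for y
      by (rule monoid_algebra_mult_lin_left[OF closed[OF c that]])
    show "lin_map R P P (\<lambda>y. x \<otimes>\<^bsub>P\<^esub> (y \<otimes>\<^bsub>P\<^esub> basis_elt R c))" if "x \<in> carrier P" for x
      by (rule lin_map_compose[OF monoid_algebra_mult_lin_left[OF c] monoid_algebra_mult_lin_right[OF that]])
  qed (use that in \<open>auto simp: basis_elt_mult G.m_assoc\<close>)
  have assoc: "(x \<otimes>\<^bsub>P\<^esub> y) \<otimes>\<^bsub>P\<^esub> z = x \<otimes>\<^bsub>P\<^esub> (y \<otimes>\<^bsub>P\<^esub> z)"
    if "x \<in> carrier P" "y \<in> carrier P" "z \<in> carrier P" for x y z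
    by (rule lin_map_eq_on_spanning[OF basis_spanning monoid_algebra_module monoid_algebra_module _ _ _ that(3)])
      (use that assoc_basis closed in \<open>auto intro: monoid_algebra_mult_lin_right
        lin_map_compose[OF monoid_algebra_mult_lin_right monoid_algebra_mult_lin_right]\<close>)
  have one: "\<one>\<^bsub>P\<^esub> \<otimes>\<^bsub>P\<^esub> x = x" if "x \<in> carrier P" for x
    by (rule lin_map_eq_on_spanning[OF basis_spanning monoid_algebra_module monoid_algebra_module _ lin_map_id _ that])
      (auto simp: basis_elt_mult intro: monoid_algebra_mult_lin_right)
  have "comm_monoid P"
    by (rule comm_monoidI) (erule (2) assoc | erule (1) comm | erule one | simp add: closed)+
  moreover have "(x \<oplus>\<^bsub>P\<^esub> y) \<otimes>\<^bsub>P\<^esub> z = x \<otimes>\<^bsub>P\<^esub> z \<oplus>\<^bsub>P\<^esub> y \<otimes>\<^bsub>P\<^esub> z"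
    if "x \<in> carrier P" "y \<in> carrier P" "z \<in> carrier P" for x y z
    using that lin_map_plus[OF monoid_algebra_mult_lin_left] by blast
  ultimately have "cring P"
    by (intro cringI P.M.abelian_group_axioms)
  then show ?thesis
    by (intro algebraI R.is_cring)
      (auto simp: P.smult_l_distr P.smult_r_distr P.smult_assoc1 lin_map_smult[OF monoid_algebra_mult_lin_left]
        simp del: monoid_algebra_simps)
qed

end

text \<open>A linear map that vanishes on generators of an ideal need not vanish on the ideal, so
  products with a spanning set are tested too. The set \<open>U\<close> in the proof is the largest
  ideal inside the kernel of \<open>h\<close>; once it contains \<open>S\<close>, it contains the
  generated ideal.\<close>

lemma (in algebra) lin_map_genideal_zero:
  assumes h: "lin_map R M W h" and W: "module R W" and X: "spanning R M X" and S: "S \<subseteq> carrier M"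
    and zero: "\<And>x s. x \<in> X \<Longrightarrow> s \<in> S \<Longrightarrow> h (x \<otimes>\<^bsub>M\<^esub> s) = \<zero>\<^bsub>W\<^esub>"
    and a: "a \<in> Idl\<^bsub>M\<^esub> S"
  shows "h a = \<zero>\<^bsub>W\<^esub>"
proof -
  interpret W: module R W by fact
  interpret M: cring M by (rule M_cring)
  note cr = cring.cring_simprules[OF M_cring]
  define U where "U = {a \<in> carrier M. \<forall>p\<in>carrier M. h (p \<otimes>\<^bsub>M\<^esub> a) = \<zero>\<^bsub>W\<^esub>}"
  have "ideal U M"
  proof (rule idealI)
    show "ring M" using M_cring by (simp add: cring_def)
    show "subgroup U (add_monoid M)"
    proof (rule group.subgroupI[OF abelian_group.a_group])
      show "abelian_group M" by (rule M.abelian_group_axioms)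
      show "U \<subseteq> carrier (add_monoid M)" by (auto simp: U_def)
      have "\<zero>\<^bsub>M\<^esub> \<in> U" using lin_map_zero[OF h W] by (simp add: U_def cr)
      then show "U \<noteq> {}" by auto
      show "inv\<^bsub>add_monoid M\<^esub> a \<in> U" if "a \<in> U" for a
        using that lin_map_uminus[OF h W] by (auto simp: U_def cr simp flip: a_inv_def)
      show "a \<otimes>\<^bsub>add_monoid M\<^esub> b \<in> U" if "a \<in> U" "b \<in> U" for a b
        using that lin_map_plus[OF h] by (auto simp: U_def cr)
    qed
    show "x \<otimes>\<^bsub>M\<^esub> a \<in> U" if "a \<in> U" "x \<in> carrier M" for a x
      using that by (auto simp: U_def cr(5) simp flip: cr(11))
    then show "a \<otimes>\<^bsub>M\<^esub> x \<in> U" if "a \<in> U" "x \<in> carrier M" for a x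
      using that by (auto simp: U_def cr(5,14))
  qed
  moreover have "S \<subseteq> U"
  proof
    fix s assume s: "s \<in> S"
    then have sM: "s \<in> carrier M" using S by auto
    have "h (p \<otimes>\<^bsub>M\<^esub> s) = \<zero>\<^bsub>W\<^esub>" if "p \<in> carrier M" for p
      by (rule lin_map_eq_on_spanning[OF X module W _ W.lin_map_0 zero[OF _ s] that])
        (rule lin_map_compose[OF lin_map_mult_right[OF sM] h])
    then show "s \<in> U" using sM by (auto simp: U_def)
  qed
  ultimately have "a \<in> U"
    using a ring.genideal_minimal[of M U S] M_cring by (auto simp: cring_def)
  then have "h (\<one>\<^bsub>M\<^esub> \<otimes>\<^bsub>M\<^esub> a) = \<zero>\<^bsub>W\<^esub>" "a \<in> carrier M"
    using cr(6) by (auto simp only: U_def)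
  then show ?thesis by (simp add: cr)
qed

section \<open>Quotient algebras\<close>

locale algebra_ideal = A: algebra R A + A: ideal I A
  for R :: "('k, 'r) ring_scheme" and A :: "('k, 'a, 's) module_scheme" and I :: "'a set"
begin

abbreviation Q where "Q \<equiv> quotient_algebra A I"
abbreviation proj where "proj \<equiv> a_r_coset A I"

lemma quotient_algebra_simps [simp]:
  "carrier Q = carrier (A Quot I)" "monoid.mult Q = monoid.mult (A Quot I)"
  "\<one>\<^bsub>Q\<^esub> = \<one>\<^bsub>A Quot I\<^esub>" "\<zero>\<^bsub>Q\<^esub> = \<zero>\<^bsub>A Quot I\<^esub>" "ring.add Q = ring.add (A Quot I)"
  by (simp_all add: quotient_algebra_def ring.defs)

lemma carrier_quotient_algebra: "carrier Q = proj ` carrier A"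
  by (auto simp: FactRing_def A_RCOSETS_def')

lemma proj_closed [simp]: "a \<in> carrier A \<Longrightarrow> proj a \<in> carrier Q"
  unfolding carrier_quotient_algebra by simp

lemma proj_mult: "a \<in> carrier A \<Longrightarrow> b \<in> carrier A \<Longrightarrow> proj (a \<otimes>\<^bsub>A\<^esub> b) = proj a \<otimes>\<^bsub>Q\<^esub> proj b"
  and proj_add: "a \<in> carrier A \<Longrightarrow> b \<in> carrier A \<Longrightarrow> proj (a \<oplus>\<^bsub>A\<^esub> b) = proj a \<oplus>\<^bsub>Q\<^esub> proj b"
  and proj_one: "proj \<one>\<^bsub>A\<^esub> = \<one>\<^bsub>Q\<^esub>"
  using A.rcos_ring_hom by (simp_all add: ring_hom_def)

lemma proj_zero: "a \<in> I \<Longrightarrow> proj a = \<zero>\<^bsub>Q\<^esub>"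
  by (simp add: FactRing_def A.a_rcos_const)

lemma proj_zero_iff: "a \<in> carrier A \<Longrightarrow> proj a = \<zero>\<^bsub>Q\<^esub> \<longleftrightarrow> a \<in> I"
  using A.a_rcos_self[of a] proj_zero by (auto simp: FactRing_def)

lemma quotient_algebra_cring: "cring Q"
proof -
  interpret F: cring "A Quot I" by (rule A.quotient_is_cring[OF A.M_cring])
  show ?thesis
    by (intro cringI abelian_groupI comm_monoidI)
      (auto simp: F.cring_simprules intro: F.l_neg)
qed

text \<open>The scalar multiple of a coset is defined as a union of cosets over all representatives;
  the point is that these cosets all coincide.\<close>

lemma proj_smult:
  assumes c: "c \<in> carrier R" and a: "a \<in> carrier A"
  shows "proj (c \<odot>\<^bsub>A\<^esub> a) = c \<odot>\<^bsub>Q\<^esub> proj a"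
proof -
  interpret F: cring "A Quot I" by (rule A.quotient_is_cring[OF A.M_cring])
  have sub: "proj a \<subseteq> carrier A"
    using a by (intro A.a_r_coset_subset_G) (auto intro: A.a_Hcarr)
  have "proj (c \<odot>\<^bsub>A\<^esub> x) = proj (c \<odot>\<^bsub>A\<^esub> a)" if x: "x \<in> proj a" for x
  proof -
    obtain i where i: "i \<in> I" "x = i \<oplus>\<^bsub>A\<^esub> a" using x by (auto simp: a_r_coset_def')
    have iA: "i \<in> carrier A" using i by (simp add: A.a_Hcarr)
    \<comment> \<open>An ideal is closed under multiplication by ring elements; closure under
      scalars follows by writing the scalar as \<open>c \<odot> \<one>\<close>.\<close>
    have "c \<odot>\<^bsub>A\<^esub> i = (c \<odot>\<^bsub>A\<^esub> \<one>\<^bsub>A\<^esub>) \<otimes>\<^bsub>A\<^esub> i"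
      using c iA by (simp add: A.smult_assoc2)
    also have "\<dots> \<in> I" using c i by (intro A.I_l_closed) auto
    finally have "proj (c \<odot>\<^bsub>A\<^esub> i) = \<zero>\<^bsub>Q\<^esub>" by (rule proj_zero)
    moreover have "c \<odot>\<^bsub>A\<^esub> x = c \<odot>\<^bsub>A\<^esub> i \<oplus>\<^bsub>A\<^esub> c \<odot>\<^bsub>A\<^esub> a"
      using c iA a i by (simp add: A.smult_r_distr)
    moreover have "proj (c \<odot>\<^bsub>A\<^esub> a) \<in> carrier (A Quot I)"
      using proj_closed[OF A.smult_closed[OF c a]] by simp
    ultimately show ?thesis
      using c a iA proj_add[of "c \<odot>\<^bsub>A\<^esub> i" "c \<odot>\<^bsub>A\<^esub> a"] by simp
  qed
  moreover have "proj a \<noteq> {}" using A.a_rcos_self[OF a] by auto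
  ultimately have "(\<Union>x\<in>proj a. proj (c \<odot>\<^bsub>A\<^esub> x)) = proj (c \<odot>\<^bsub>A\<^esub> a)"
    by (intro SUP_eq_const)
  then show ?thesis
    by (simp add: quotient_algebra_def ring.defs)
qed

lemma quotient_algebra_algebra: "algebra R Q"
proof (rule algebraI)
  show "cring R" by (rule A.R_cring)
  show "cring Q" by (rule quotient_algebra_cring)
  have proj_ex: "\<exists>a\<in>carrier A. x = proj a" if "x \<in> carrier Q" for x
    using that unfolding carrier_quotient_algebra by auto
  show "c \<odot>\<^bsub>Q\<^esub> x \<in> carrier Q" if c: "c \<in> carrier R" and x: "x \<in> carrier Q" for c x
  proof -
    obtain a where a: "a \<in> carrier A" "x = proj a" using proj_ex x by blast
    show ?thesis unfolding a(2) proj_smult[OF c a(1), symmetric] using c a by (intro proj_closed) auto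
  qed
  show "\<one>\<^bsub>R\<^esub> \<odot>\<^bsub>Q\<^esub> x = x" if x: "x \<in> carrier Q" for x
  proof -
    obtain a where a: "a \<in> carrier A" "x = proj a" using proj_ex x by blast
    then show ?thesis using proj_smult[of "\<one>\<^bsub>R\<^esub>" a] by simp
  qed
  show "(c \<oplus>\<^bsub>R\<^esub> d) \<odot>\<^bsub>Q\<^esub> x = c \<odot>\<^bsub>Q\<^esub> x \<oplus>\<^bsub>Q\<^esub> d \<odot>\<^bsub>Q\<^esub> x"
    and "(c \<otimes>\<^bsub>R\<^esub> d) \<odot>\<^bsub>Q\<^esub> x = c \<odot>\<^bsub>Q\<^esub> (d \<odot>\<^bsub>Q\<^esub> x)"
    if c: "c \<in> carrier R" and d: "d \<in> carrier R" and x: "x \<in> carrier Q" for c d x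
  proof -
    obtain a where a: "a \<in> carrier A" "x = proj a" using proj_ex x by blast
    show "(c \<oplus>\<^bsub>R\<^esub> d) \<odot>\<^bsub>Q\<^esub> x = c \<odot>\<^bsub>Q\<^esub> x \<oplus>\<^bsub>Q\<^esub> d \<odot>\<^bsub>Q\<^esub> x"
      using c d a by (simp add: A.smult_l_distr del: quotient_algebra_simps flip: proj_smult proj_add)
    show "(c \<otimes>\<^bsub>R\<^esub> d) \<odot>\<^bsub>Q\<^esub> x = c \<odot>\<^bsub>Q\<^esub> (d \<odot>\<^bsub>Q\<^esub> x)"
      using c d a by (simp add: A.smult_assoc1 del: quotient_algebra_simps flip: proj_smult)
  qed
  show "c \<odot>\<^bsub>Q\<^esub> (x \<oplus>\<^bsub>Q\<^esub> y) = c \<odot>\<^bsub>Q\<^esub> x \<oplus>\<^bsub>Q\<^esub> c \<odot>\<^bsub>Q\<^esub> y"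
    and "(c \<odot>\<^bsub>Q\<^esub> x) \<otimes>\<^bsub>Q\<^esub> y = c \<odot>\<^bsub>Q\<^esub> (x \<otimes>\<^bsub>Q\<^esub> y)"
    if c: "c \<in> carrier R" and xy: "x \<in> carrier Q" "y \<in> carrier Q" for c x y
  proof -
    obtain a b where ab: "a \<in> carrier A" "x = proj a" "b \<in> carrier A" "y = proj b"
      using proj_ex xy by metis
    show "c \<odot>\<^bsub>Q\<^esub> (x \<oplus>\<^bsub>Q\<^esub> y) = c \<odot>\<^bsub>Q\<^esub> x \<oplus>\<^bsub>Q\<^esub> c \<odot>\<^bsub>Q\<^esub> y"
      using c ab by (simp add: A.smult_r_distr del: quotient_algebra_simps flip: proj_smult proj_add)
    show "(c \<odot>\<^bsub>Q\<^esub> x) \<otimes>\<^bsub>Q\<^esub> y = c \<odot>\<^bsub>Q\<^esub> (x \<otimes>\<^bsub>Q\<^esub> y)"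
      using c ab by (simp add: A.smult_assoc2 del: quotient_algebra_simps flip: proj_smult proj_mult)
  qed
qed

lemma proj_lin: "lin_map R A Q proj"
  by (rule lin_mapI) (auto simp del: quotient_algebra_simps simp: proj_add proj_smult)

lemma proj_minus:
  assumes "a \<in> carrier A" "b \<in> carrier A"
  shows "proj (a \<ominus>\<^bsub>A\<^esub> b) = proj a \<ominus>\<^bsub>Q\<^esub> proj b"
  by (rule A.lin_map_minus[OF proj_lin algebra.module[OF quotient_algebra_algebra] assms])

lemma quotient_lift:
  assumes W: "module R W" and h: "lin_map R A W h" and zero: "\<And>a. a \<in> I \<Longrightarrow> h a = \<zero>\<^bsub>W\<^esub>"
  obtains h' where "h' \<in> linear_maps R Q W" "\<And>a. a \<in> carrier A \<Longrightarrow> h' (proj a) = h a"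
proof -
  interpret W: module R W by fact
  interpret Q: algebra R Q by (rule quotient_algebra_algebra)
  define h' where "h' X = h (SOME a. a \<in> carrier A \<and> proj a = X)" for X
  have h'_proj: "h' (proj a) = h a" if a: "a \<in> carrier A" for a
  proof -
    define b where "b = (SOME b. b \<in> carrier A \<and> proj b = proj a)"
    have b: "b \<in> carrier A" "proj b = proj a"
      using someI[of "\<lambda>b. b \<in> carrier A \<and> proj b = proj a" a] a by (auto simp: b_def)
    \<comment> \<open>The chosen representative \<open>b\<close> and the given \<open>a\<close>
      differ by an element of \<open>I\<close>, which \<open>h\<close> kills; hence the choice in
      \<open>h'\<close> does not matter.\<close>
    have "proj (b \<ominus>\<^bsub>A\<^esub> a) = proj a \<ominus>\<^bsub>Q\<^esub> proj a"
      using proj_minus[OF b(1) a] b(2) by simp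
    also have "\<dots> = \<zero>\<^bsub>Q\<^esub>"
      by (simp only: a_minus_def Q.M.r_neg[OF proj_closed[OF a]])
    finally have "proj (b \<ominus>\<^bsub>A\<^esub> a) = \<zero>\<^bsub>Q\<^esub>" .
    then have "h (b \<ominus>\<^bsub>A\<^esub> a) = \<zero>\<^bsub>W\<^esub>"
      using a b by (intro zero) (simp del: quotient_algebra_simps add: proj_zero_iff)
    then have "h b = h a"
      using a b lin_map_closed[OF h] by (simp add: A.lin_map_minus[OF h W] W.M.minus_eq_iff)
    then show ?thesis by (simp add: h'_def b_def)
  qed
  have "lin_map R Q W h'"
    by (rule lin_mapI)
      (auto simp del: quotient_algebra_simps simp: carrier_quotient_algebra h'_proj lin_map_closed[OF h] lin_map_plus[OF h] lin_map_smult[OF h]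
        simp flip: proj_add proj_smult)
  then have "restrict h' (carrier Q) \<in> linear_maps R Q W"
    by (rule restrict_linear_maps[OF Q.module])
  then show thesis
    by (rule that) (simp del: quotient_algebra_simps add: h'_proj)
qed

lemma spanning_proj:
  assumes "spanning R A X"
  shows "spanning R Q (proj ` X)"
  using spanning_image[OF assms A.module algebra.module[OF quotient_algebra_algebra] proj_lin] by (simp add: carrier_quotient_algebra del: quotient_algebra_simps)

end

section \<open>The universal property of the symmetric algebra\<close>

lemma comm_monoid_monomials: "comm_monoid (monomials X)"
  by (rule comm_monoidI) (auto simp: monomials_def)

lemma monomials_simps [simp]:
  "m \<in> carrier (monomials X) \<longleftrightarrow> set_mset m \<subseteq> X"
  "m \<otimes>\<^bsub>monomials X\<^esub> m' = m + m'" "\<one>\<^bsub>monomials X\<^esub> = {#}"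
  by (auto simp: monomials_def)

section \<open>S(V) as a quotient of the polynomial algebra\<close>

context module
begin

abbreviation sym_poly where "sym_poly \<equiv> monoid_algebra R (monomials (carrier M))"
abbreviation Sym where "Sym \<equiv> sym_algebra R M"

definition sym_relations where
  "sym_relations = {basis_elt R {#x \<oplus>\<^bsub>M\<^esub> y#} \<ominus>\<^bsub>sym_poly\<^esub> basis_elt R {#x#} \<ominus>\<^bsub>sym_poly\<^esub> basis_elt R {#y#}
      | x y. x \<in> carrier M \<and> y \<in> carrier M} \<union>
    {basis_elt R {#c \<odot>\<^bsub>M\<^esub> x#} \<ominus>\<^bsub>sym_poly\<^esub> c \<odot>\<^bsub>sym_poly\<^esub> basis_elt R {#x#}
      | c x. c \<in> carrier R \<and> x \<in> carrier M}"

lemma sym_ideal_eq: "sym_ideal R M = Idl\<^bsub>sym_poly\<^esub> sym_relations"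
  by (simp add: sym_ideal_def sym_relations_def Let_def)

lemma comm_monoid_algebra_sym: "comm_monoid_algebra R (monomials (carrier M))"
  by (intro comm_monoid_algebra.intro R.is_cring comm_monoid_monomials)

lemma sym_var_closed: "x \<in> carrier M \<Longrightarrow> basis_elt R {#x#} \<in> carrier sym_poly"
  using comm_monoid_algebra.basis_elt_closed[OF comm_monoid_algebra_sym] by simp

lemma sym_relations_subset: "sym_relations \<subseteq> carrier sym_poly"
proof -
  interpret P: algebra R sym_poly
    by (rule comm_monoid_algebra.monoid_algebra_algebra[OF comm_monoid_algebra_sym])
  show ?thesis by (auto simp: sym_relations_def sym_var_closed)
qed

lemma algebra_ideal_sym: "algebra_ideal R sym_poly (sym_ideal R M)"
proof -
  interpret P: algebra R sym_poly
    by (rule comm_monoid_algebra.monoid_algebra_algebra[OF comm_monoid_algebra_sym])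
  have "ideal (sym_ideal R M) sym_poly"
    unfolding sym_ideal_eq
    using ring.genideal_ideal[OF cring.axioms(1)[OF P.M_cring] sym_relations_subset] .
  then show ?thesis
    by (intro algebra_ideal.intro P.algebra_axioms)
qed

lemma sym_algebra_algebra: "algebra R Sym"
  unfolding sym_algebra_def by (rule algebra_ideal.quotient_algebra_algebra[OF algebra_ideal_sym])

lemma sym_prod_Nil [simp]: "sym_prod R M [] = \<one>\<^bsub>Sym\<^esub>"
  and sym_prod_Cons: "sym_prod R M (x # xs) = sym_incl R M x \<otimes>\<^bsub>Sym\<^esub> sym_prod R M xs"
  by (simp_all add: sym_prod_def)

text \<open>A product of classes of variables is the class of a single monomial. Since monomials are
  multisets, invariance under reordering becomes immediate.\<close>

lemma sym_prod_eq:
  assumes "set xs \<subseteq> carrier M"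
  shows "sym_prod R M xs = sym_ideal R M +>\<^bsub>sym_poly\<^esub> basis_elt R (mset xs)"
proof -
  interpret P: comm_monoid_algebra R "monomials (carrier M)" by (rule comm_monoid_algebra_sym)
  interpret I: algebra_ideal R sym_poly "sym_ideal R M" by (rule algebra_ideal_sym)
  show ?thesis
    using assms
  proof (induction xs)
    case Nil
    show ?case
      using I.proj_one by (simp add: sym_algebra_def)
  next
    case (Cons x xs)
    have c: "{#x#} \<in> carrier (monomials (carrier M))" "mset xs \<in> carrier (monomials (carrier M))"
      using Cons.prems by auto
    have "sym_prod R M (x # xs) = I.proj (basis_elt R {#x#} \<otimes>\<^bsub>sym_poly\<^esub> basis_elt R (mset xs))"
      using Cons c I.proj_mult[of "basis_elt R {#x#}" "basis_elt R (mset xs)"]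
      by (simp add: sym_prod_Cons sym_algebra_def sym_incl_def)
    also have "basis_elt R {#x#} \<otimes>\<^bsub>sym_poly\<^esub> basis_elt R (mset xs) = basis_elt R (mset (x # xs))"
      using P.basis_elt_mult[OF c] by simp
    finally show ?case .
  qed
qed

lemma sym_prod_closed [simp]: "set xs \<subseteq> carrier M \<Longrightarrow> sym_prod R M xs \<in> carrier Sym"
  using algebra_ideal.proj_closed[OF algebra_ideal_sym, of "basis_elt R (mset xs)"]
    comm_monoid_algebra.basis_elt_closed[OF comm_monoid_algebra_sym, of "mset xs"]
  by (simp add: sym_prod_eq sym_algebra_def)

lemma sym_prod_mset_eq: "set xs \<subseteq> carrier M \<Longrightarrow> mset xs = mset ys \<Longrightarrow> sym_prod R M xs = sym_prod R M ys"
  using mset_eq_setD[of xs ys] by (simp add: sym_prod_eq)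

lemma sym_prod_single: "x \<in> carrier M \<Longrightarrow> sym_prod R M [x] = sym_incl R M x"
  by (simp add: sym_prod_eq sym_incl_def)

lemma sym_incl_closed [simp]: "x \<in> carrier M \<Longrightarrow> sym_incl R M x \<in> carrier Sym"
  using sym_prod_closed[of "[x]"] sym_prod_single[of x] by simp

lemma sym_prod_append:
  assumes "set xs \<subseteq> carrier M" "set ys \<subseteq> carrier M"
  shows "sym_prod R M (xs @ ys) = sym_prod R M xs \<otimes>\<^bsub>Sym\<^esub> sym_prod R M ys"
proof -
  interpret S: algebra R Sym by (rule sym_algebra_algebra)
  note S = cring.cring_simprules[OF S.M_cring]
  show ?thesis using assms by (induction xs) (auto simp: sym_prod_Cons S(5,11,12))
qed

lemma sym_incl_lin: "lin_map R M Sym (sym_incl R M)"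
proof (rule lin_mapI)
  interpret P: algebra R sym_poly
    by (rule comm_monoid_algebra.monoid_algebra_algebra[OF comm_monoid_algebra_sym])
  interpret I: algebra_ideal R sym_poly "sym_ideal R M" by (rule algebra_ideal_sym)
  interpret S: algebra R Sym by (rule sym_algebra_algebra)
  have Q: "Sym = I.Q" by (simp add: sym_algebra_def)
  have incl: "sym_incl R M x = I.proj (basis_elt R {#x#})" for x by (simp add: sym_incl_def)
  have relation: "I.proj a = \<zero>\<^bsub>Sym\<^esub>" if "a \<in> sym_relations" for a
    unfolding Q
    using that ring.genideal_self[OF cring.axioms(1)[OF P.M_cring] sym_relations_subset]
    by (intro I.proj_zero) (auto simp: sym_ideal_eq)
  fix x assume x: "x \<in> carrier M"
  show "sym_incl R M x \<in> carrier Sym" using x by simp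
  show "sym_incl R M (x \<oplus>\<^bsub>M\<^esub> y) = sym_incl R M x \<oplus>\<^bsub>Sym\<^esub> sym_incl R M y" if y: "y \<in> carrier M" for y
  proof -
    have "I.proj (basis_elt R {#x \<oplus>\<^bsub>M\<^esub> y#} \<ominus>\<^bsub>sym_poly\<^esub> basis_elt R {#x#} \<ominus>\<^bsub>sym_poly\<^esub> basis_elt R {#y#}) = \<zero>\<^bsub>Sym\<^esub>"
      using x y by (intro relation) (auto simp: sym_relations_def)
    then have "sym_incl R M (x \<oplus>\<^bsub>M\<^esub> y) \<ominus>\<^bsub>Sym\<^esub> sym_incl R M x \<ominus>\<^bsub>Sym\<^esub> sym_incl R M y = \<zero>\<^bsub>Sym\<^esub>"
      using x y by (simp add: I.proj_minus incl Q sym_var_closed del: I.quotient_algebra_simps)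
    then show ?thesis
      using x y by (simp add: S.M.minus_eq_iff S.M.a_comm)
  qed
  show "sym_incl R M (c \<odot>\<^bsub>M\<^esub> x) = c \<odot>\<^bsub>Sym\<^esub> sym_incl R M x" if c: "c \<in> carrier R" for c
  proof -
    have "I.proj (basis_elt R {#c \<odot>\<^bsub>M\<^esub> x#} \<ominus>\<^bsub>sym_poly\<^esub> c \<odot>\<^bsub>sym_poly\<^esub> basis_elt R {#x#}) = \<zero>\<^bsub>Sym\<^esub>"
      using x c by (intro relation) (auto simp: sym_relations_def)
    then have "sym_incl R M (c \<odot>\<^bsub>M\<^esub> x) \<ominus>\<^bsub>Sym\<^esub> c \<odot>\<^bsub>Sym\<^esub> sym_incl R M x = \<zero>\<^bsub>Sym\<^esub>"
      using x c by (simp add: I.proj_minus I.proj_smult incl Q sym_var_closed del: I.quotient_algebra_simps)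
    then show ?thesis
      using x c by (simp add: S.M.minus_eq_iff)
  qed
qed

lemma sym_prod_spanning: "spanning R Sym (sym_prod R M ` lists (carrier M))"
proof -
  interpret P: comm_monoid_algebra R "monomials (carrier M)" by (rule comm_monoid_algebra_sym)
  interpret I: algebra_ideal R sym_poly "sym_ideal R M" by (rule algebra_ideal_sym)
  have "I.proj ` basis_elt R ` carrier (monomials (carrier M)) = sym_prod R M ` lists (carrier M)"
  proof (intro subset_antisym subsetI)
    fix z assume "z \<in> I.proj ` basis_elt R ` carrier (monomials (carrier M))"
    then obtain m where m: "set_mset m \<subseteq> carrier M" "z = I.proj (basis_elt R m)"
      by auto
    obtain xs where "mset xs = m" using ex_mset by blast
    then show "z \<in> sym_prod R M ` lists (carrier M)"
      using m by (intro image_eqI[of _ _ xs]) (auto simp: sym_prod_eq)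
  next
    fix z assume "z \<in> sym_prod R M ` lists (carrier M)"
    then show "z \<in> I.proj ` basis_elt R ` carrier (monomials (carrier M))"
      by (auto simp: sym_prod_eq in_lists_conv_set subset_iff intro!: imageI)
  qed
  then show ?thesis
    using I.spanning_proj[OF P.basis_spanning] by (simp add: sym_algebra_def)
qed

text \<open>Braces are linear but not multiplicative in S(V), so the universal property is needed
  for linear maps: symmetric multilinear functions of all arities at once. Linearity in the head is
  enough, because symmetry moves any argument there.\<close>

lemma sym_lift:
  assumes W: "module R W"
    and sym: "\<And>xs ys. set xs \<subseteq> carrier M \<Longrightarrow> mset xs = mset ys \<Longrightarrow> F xs = F ys"
    and nil: "F [] \<in> carrier W"
    and lin: "\<And>xs. set xs \<subseteq> carrier M \<Longrightarrow> lin_map R M W (\<lambda>x. F (x # xs))"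
  obtains h where "h \<in> linear_maps R Sym W" "\<And>xs. set xs \<subseteq> carrier M \<Longrightarrow> h (sym_prod R M xs) = F xs"
proof -
  interpret P: comm_monoid_algebra R "monomials (carrier M)" by (rule comm_monoid_algebra_sym)
  interpret PA: algebra R sym_poly by (rule P.monoid_algebra_algebra)
  interpret I: algebra_ideal R sym_poly "sym_ideal R M" by (rule algebra_ideal_sym)
  interpret W: module R W by fact
  \<comment> \<open>A monomial carries no order of its factors; symmetry of \<open>F\<close> makes
    the chosen order immaterial.\<close>
  define u where "u m = F (SOME xs. mset xs = m)" for m
  have u: "u (mset xs) = F xs" if "set xs \<subseteq> carrier M" for xs
    unfolding u_def using that by (rule sym[symmetric]) (metis (mono_tags) someI)
  have closed: "F xs \<in> carrier W" if "set xs \<subseteq> carrier M" for xs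
    using that nil lin_map_closed[OF lin] by (cases xs) auto
  have u_closed: "u \<in> carrier (monomials (carrier M)) \<rightarrow> carrier W"
  proof
    fix m assume "m \<in> carrier (monomials (carrier M))"
    moreover obtain xs where "mset xs = m" using ex_mset by blast
    ultimately show "u m \<in> carrier W" using u[of xs] closed[of xs] by auto
  qed
  define h0 where "h0 = lin_extend R W u"
  have h0: "lin_map R sym_poly W h0"
    unfolding h0_def by (rule P.lin_extend_lin[OF W u_closed])
  have h0_basis: "h0 (basis_elt R (mset xs)) = F xs" if "set xs \<subseteq> carrier M" for xs
    unfolding h0_def using that P.lin_extend_basis[OF W u_closed] u by simp
  have kills: "h0 a = \<zero>\<^bsub>W\<^esub>" if a: "a \<in> sym_ideal R M" for a
  proof (rule PA.lin_map_genideal_zero[OF h0 W P.basis_spanning sym_relations_subset])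
    show "a \<in> Idl\<^bsub>sym_poly\<^esub> sym_relations" using a by (simp add: sym_ideal_eq)
    fix z s assume "z \<in> basis_elt R ` carrier (monomials (carrier M))" and s: "s \<in> sym_relations"
    then obtain m where m: "set_mset m \<subseteq> carrier M" "z = basis_elt R m" by auto
    obtain xs where xs: "mset xs = m" using ex_mset by blast
    have xsM: "set xs \<subseteq> carrier M" using xs m by auto
    have z: "z \<in> carrier sym_poly" using m by auto
    \<comment> \<open>Multiplication by the monomial \<open>z\<close> is absorbed into the map. On a
      variable \<open>[x]\<close> the result is \<open>F (x # xs)\<close>, so the two kinds of
      relations become the two clauses of linearity of \<open>F\<close> in its head.\<close>
    define g where "g y = h0 (z \<otimes>\<^bsub>sym_poly\<^esub> y)" for y
    have g: "lin_map R sym_poly W g"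
      unfolding g_def by (rule lin_map_compose[OF PA.lin_map_mult_left[OF z] h0])
    have g_var: "g (basis_elt R {#x#}) = F (x # xs)" if x: "x \<in> carrier M" for x
      using P.basis_elt_mult[of m "{#x#}"] h0_basis[of "x # xs"] m x xsM
      by (simp add: g_def xs)
    consider x y where "x \<in> carrier M" "y \<in> carrier M"
        "s = basis_elt R {#x \<oplus>\<^bsub>M\<^esub> y#} \<ominus>\<^bsub>sym_poly\<^esub> basis_elt R {#x#} \<ominus>\<^bsub>sym_poly\<^esub> basis_elt R {#y#}"
      | c x where "c \<in> carrier R" "x \<in> carrier M"
        "s = basis_elt R {#c \<odot>\<^bsub>M\<^esub> x#} \<ominus>\<^bsub>sym_poly\<^esub> c \<odot>\<^bsub>sym_poly\<^esub> basis_elt R {#x#}"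
      using s by (auto simp: sym_relations_def)
    then have "g s = \<zero>\<^bsub>W\<^esub>"
    proof cases
      case 1
      have "g s = F ((x \<oplus>\<^bsub>M\<^esub> y) # xs) \<ominus>\<^bsub>W\<^esub> F (x # xs) \<ominus>\<^bsub>W\<^esub> F (y # xs)"
        using 1 by (simp add: PA.lin_map_minus[OF g W] sym_var_closed g_var del: P.monoid_algebra_simps)
      then show ?thesis
        using 1 xsM closed[of "x # xs"] closed[of "y # xs"]
        by (simp add: lin_map_plus[OF lin] W.M.minus_eq_iff W.M.a_comm)
    next
      case 2
      have "g s = F ((c \<odot>\<^bsub>M\<^esub> x) # xs) \<ominus>\<^bsub>W\<^esub> c \<odot>\<^bsub>W\<^esub> F (x # xs)"
        using 2 by (simp add: PA.lin_map_minus[OF g W] lin_map_smult[OF g] sym_var_closed g_var del: P.monoid_algebra_simps)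
      then show ?thesis
        using 2 xsM closed[of "x # xs"] by (simp add: lin_map_smult[OF lin] W.M.minus_eq W.M.r_neg)
    qed
    then show "h0 (z \<otimes>\<^bsub>sym_poly\<^esub> s) = \<zero>\<^bsub>W\<^esub>" by (simp add: g_def)
  qed
  obtain h where h: "h \<in> linear_maps R I.Q W"
    "\<And>a. a \<in> carrier sym_poly \<Longrightarrow> h (I.proj a) = h0 a"
    using I.quotient_lift[OF W h0 kills] by metis
  show thesis
  proof (rule that)
    show "h \<in> linear_maps R Sym W" using h(1) by (simp add: sym_algebra_def)
    show "h (sym_prod R M xs) = F xs" if "set xs \<subseteq> carrier M" for xs
      using that h(2)[of "basis_elt R (mset xs)"] h0_basis[OF that] P.basis_elt_closed[of "mset xs"]
      by (simp add: sym_prod_eq)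
  qed
qed

end

section \<open>The universal property of tensor powers\<close>

definition multilin ::
  "('k, 'r) ring_scheme \<Rightarrow> ('k, 'a, 's) module_scheme \<Rightarrow> ('k, 'b, 't) module_scheme \<Rightarrow> nat
    \<Rightarrow> ('a list \<Rightarrow> 'b) \<Rightarrow> bool" where
  "multilin R M N n F \<longleftrightarrow> (\<forall>xs. set xs \<subseteq> carrier M \<longrightarrow> length xs = n \<longrightarrow> F xs \<in> carrier N) \<and>
    (\<forall>xs ys. set xs \<subseteq> carrier M \<longrightarrow> set ys \<subseteq> carrier M \<longrightarrow> Suc (length xs + length ys) = n \<longrightarrow>
      lin_map R M N (\<lambda>x. F (xs @ x # ys)))"

lemma multilinI:
  assumes "\<And>xs. set xs \<subseteq> carrier M \<Longrightarrow> length xs = n \<Longrightarrow> F xs \<in> carrier N"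
    and "\<And>xs ys. set xs \<subseteq> carrier M \<Longrightarrow> set ys \<subseteq> carrier M \<Longrightarrow> Suc (length xs + length ys) = n \<Longrightarrow>
      lin_map R M N (\<lambda>x. F (xs @ x # ys))"
  shows "multilin R M N n F"
  using assms by (simp add: multilin_def)

lemma multilin_closed: "multilin R M N n F \<Longrightarrow> set xs \<subseteq> carrier M \<Longrightarrow> length xs = n \<Longrightarrow> F xs \<in> carrier N"
  by (simp add: multilin_def)

lemma multilin_lin:
  "multilin R M N n F \<Longrightarrow> set xs \<subseteq> carrier M \<Longrightarrow> set ys \<subseteq> carrier M \<Longrightarrow> Suc (length xs + length ys) = n \<Longrightarrow>
    lin_map R M N (\<lambda>x. F (xs @ x # ys))"
  by (simp add: multilin_def)

lemma multilin_Cons: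
  "multilin R M N (Suc n) F \<Longrightarrow> y \<in> carrier M \<Longrightarrow> multilin R M N n (\<lambda>ys. F (y # ys))"
  using multilin_lin[of R M N "Suc n" F "y # xs" for xs] multilin_closed[of R M N "Suc n" F "y # xs" for xs]
  by (intro multilinI) auto

lemma multilin_head:
  "multilin R M N (Suc n) F \<Longrightarrow> set ys \<subseteq> carrier M \<Longrightarrow> length ys = n \<Longrightarrow> lin_map R M N (\<lambda>y. F (y # ys))"
  using multilin_lin[of R M N "Suc n" F "[]" ys] by simp

text \<open>Bridge between the splitting \<open>xs @ x # ys\<close> used by \<open>multilin\<close>
  and the list updates in the relations of \<open>tensor_ideal\<close>.\<close>

lemma multilin_update:
  assumes "multilin R M N n F" "set xs \<subseteq> carrier M" "length xs = n" "i < n"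
  shows "lin_map R M N (\<lambda>x. F (xs[i := x]))"
proof -
  have "set (take i xs) \<subseteq> carrier M" "set (drop (Suc i) xs) \<subseteq> carrier M"
    using assms(2) by (auto dest: in_set_takeD in_set_dropD)
  from multilin_lin[OF assms(1) this] show ?thesis
    using assms(3,4) by (simp add: upd_conv_take_nth_drop)
qed

context algebra
begin

abbreviation tensor_poly where "tensor_poly n \<equiv> monoid_algebra R (tuples n M)"
abbreviation T where "T n \<equiv> tensor_power R M n"

lemma tuples_simps [simp]:
  "xs \<in> carrier (tuples n M) \<longleftrightarrow> length xs = n \<and> set xs \<subseteq> carrier M"
  "xs \<otimes>\<^bsub>tuples n M\<^esub> ys = map2 (monoid.mult M) xs ys" "\<one>\<^bsub>tuples n M\<^esub> = replicate n \<one>\<^bsub>M\<^esub>"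
  by (auto simp: tuples_def)

lemma set_map2_mult:
  assumes "set xs \<subseteq> carrier M" "set ys \<subseteq> carrier M"
  shows "set (map2 (monoid.mult M) xs ys) \<subseteq> carrier M"
proof -
  have "a \<in> carrier M \<and> b \<in> carrier M" if "(a, b) \<in> set (zip xs ys)" for a b
    using assms set_zip_leftD[OF that] set_zip_rightD[OF that] by blast
  then show ?thesis using cring.cring_simprules(5)[OF M_cring] by auto
qed

lemma comm_monoid_tuples: "comm_monoid (tuples n M)"
proof -
  note cr = cring.cring_simprules[OF M_cring]
  have nth: "xs ! i \<in> carrier M" if "set xs \<subseteq> carrier M" "i < length xs" for xs i
    using that by auto
  show ?thesis
    by (rule comm_monoidI)
      (use cr(6) set_map2_mult in \<open>auto intro!: nth_equalityI cr(14) nth simp: cr(11,12) nth\<close>)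
qed

lemma comm_monoid_algebra_tensor: "comm_monoid_algebra R (tuples n M)"
  by (intro comm_monoid_algebra.intro R_cring comm_monoid_tuples)

lemma tensor_basis_closed: "set xs \<subseteq> carrier M \<Longrightarrow> basis_elt R xs \<in> carrier (tensor_poly (length xs))"
  using comm_monoid_algebra.basis_elt_closed[OF comm_monoid_algebra_tensor, of xs "length xs"] by simp

definition tensor_relations where
  "tensor_relations n =
    {basis_elt R (xs[i := x \<oplus>\<^bsub>M\<^esub> y]) \<ominus>\<^bsub>tensor_poly n\<^esub> basis_elt R (xs[i := x]) \<ominus>\<^bsub>tensor_poly n\<^esub> basis_elt R (xs[i := y])
      | xs i x y. xs \<in> carrier (tuples n M) \<and> i < n \<and> x \<in> carrier M \<and> y \<in> carrier M} \<union>
    {basis_elt R (xs[i := c \<odot>\<^bsub>M\<^esub> x]) \<ominus>\<^bsub>tensor_poly n\<^esub> c \<odot>\<^bsub>tensor_poly n\<^esub> basis_elt R (xs[i := x])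
      | xs i c x. xs \<in> carrier (tuples n M) \<and> i < n \<and> c \<in> carrier R \<and> x \<in> carrier M}"

lemma tensor_ideal_eq: "tensor_ideal R M n = Idl\<^bsub>tensor_poly n\<^esub> tensor_relations n"
  by (simp add: tensor_ideal_def tensor_relations_def Let_def)

lemma tensor_update_closed:
  assumes "set xs \<subseteq> carrier M" "length xs = n" "x \<in> carrier M"
  shows "basis_elt R (xs[i := x]) \<in> carrier (tensor_poly n)"
  using assms set_update_subset_insert[of xs i x] tensor_basis_closed[of "xs[i := x]"] by auto

lemma tensor_relations_subset: "tensor_relations n \<subseteq> carrier (tensor_poly n)"
proof -
  interpret P: algebra R "tensor_poly n"
    by (rule comm_monoid_algebra.monoid_algebra_algebra[OF comm_monoid_algebra_tensor])
  show ?thesis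
    unfolding tensor_relations_def tuples_simps
    by (intro subsetI, elim UnE CollectE exE conjE) (simp_all add: tensor_update_closed)
qed

lemma algebra_ideal_tensor: "algebra_ideal R (tensor_poly n) (tensor_ideal R M n)"
proof -
  interpret P: algebra R "tensor_poly n"
    by (rule comm_monoid_algebra.monoid_algebra_algebra[OF comm_monoid_algebra_tensor])
  have "ideal (tensor_ideal R M n) (tensor_poly n)"
    unfolding tensor_ideal_eq
    using ring.genideal_ideal[OF cring.axioms(1)[OF P.M_cring] tensor_relations_subset] .
  then show ?thesis
    by (intro algebra_ideal.intro P.algebra_axioms)
qed

lemma tensor_power_algebra: "algebra R (T n)"
  unfolding tensor_power_def by (rule algebra_ideal.quotient_algebra_algebra[OF algebra_ideal_tensor])

lemma tensor_power_module: "module R (T n)"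
  by (rule algebra.module[OF tensor_power_algebra])

lemma pure_tensor_eq:
  "length xs = n \<Longrightarrow> pure_tensor R M xs = tensor_ideal R M n +>\<^bsub>tensor_poly n\<^esub> basis_elt R xs"
  by (auto simp: pure_tensor_def)

lemma pure_tensor_closed: "set xs \<subseteq> carrier M \<Longrightarrow> length xs = n \<Longrightarrow> pure_tensor R M xs \<in> carrier (T n)"
  using algebra_ideal.proj_closed[OF algebra_ideal_tensor, of "basis_elt R xs" n] tensor_basis_closed[of xs]
  by (auto simp: pure_tensor_eq tensor_power_def)

lemma pure_tensor_mult:
  assumes "set xs \<subseteq> carrier M" "length xs = n" "set ys \<subseteq> carrier M" "length ys = n"
  shows "pure_tensor R M xs \<otimes>\<^bsub>T n\<^esub> pure_tensor R M ys = pure_tensor R M (map2 (monoid.mult M) xs ys)"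
  using assms comm_monoid_algebra.basis_elt_mult[OF comm_monoid_algebra_tensor, of xs n ys]
    algebra_ideal.proj_mult[OF algebra_ideal_tensor, of "basis_elt R xs" n "basis_elt R ys"]
    tensor_basis_closed[of xs] tensor_basis_closed[of ys]
  by (simp add: pure_tensor_eq[of _ n] tensor_power_def)

lemma pure_tensor_one: "pure_tensor R M (replicate n \<one>\<^bsub>M\<^esub>) = \<one>\<^bsub>T n\<^esub>"
  using algebra_ideal.proj_one[OF algebra_ideal_tensor, of n]
    comm_monoid_algebra.monoid_algebra_simps(4)[OF comm_monoid_algebra_tensor, of n]
  by (simp add: pure_tensor_eq[of _ n] tensor_power_def)

lemma pure_tensor_spanning: "spanning R (T n) (pure_tensor R M ` {xs. length xs = n \<and> set xs \<subseteq> carrier M})"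
proof -
  interpret I: algebra_ideal R "tensor_poly n" "tensor_ideal R M n" by (rule algebra_ideal_tensor)
  have "pure_tensor R M ` {xs. length xs = n \<and> set xs \<subseteq> carrier M} = I.proj ` basis_elt R ` carrier (tuples n M)"
    by (auto simp: pure_tensor_eq[of _ n] image_image intro!: image_eqI)
  then show ?thesis
    using I.spanning_proj[OF comm_monoid_algebra.basis_spanning[OF comm_monoid_algebra_tensor]]
    by (simp add: tensor_power_def)
qed

lemma pure_tensor_multilin: "multilin R M (T n) n (pure_tensor R M)"
proof (rule multilinI)
  show "pure_tensor R M xs \<in> carrier (T n)" if "set xs \<subseteq> carrier M" "length xs = n" for xs
    using that by (rule pure_tensor_closed)
next
  interpret P: algebra R "tensor_poly n"
    by (rule comm_monoid_algebra.monoid_algebra_algebra[OF comm_monoid_algebra_tensor])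
  interpret I: algebra_ideal R "tensor_poly n" "tensor_ideal R M n" by (rule algebra_ideal_tensor)
  interpret T: algebra R "T n" by (rule tensor_power_algebra)
  have Q: "T n = I.Q" by (simp add: tensor_power_def)
  have relation: "I.proj a = \<zero>\<^bsub>T n\<^esub>" if "a \<in> tensor_relations n" for a
    unfolding Q
    using that ring.genideal_self[OF cring.axioms(1)[OF P.M_cring] tensor_relations_subset]
    by (intro I.proj_zero) (auto simp: tensor_ideal_eq)
  fix us vs assume uv: "set us \<subseteq> carrier M" "set vs \<subseteq> carrier M" "Suc (length us + length vs) = n"
  define i where "i = length us"
  \<comment> \<open>The unit is only a placeholder in slot \<open>i\<close>; every use of
    \<open>xs\<close> overwrites it.\<close>
  define xs where "xs = us @ \<one>\<^bsub>M\<^esub> # vs"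
  have xs: "xs \<in> carrier (tuples n M)" "set xs \<subseteq> carrier M" "length xs = n" and i: "i < n"
    using uv cring.cring_simprules(6)[OF M_cring] by (auto simp: xs_def i_def)
  have upd: "us @ x # vs = xs[i := x]" for x by (simp add: xs_def i_def)
  have pure: "pure_tensor R M (us @ x # vs) = I.proj (basis_elt R (xs[i := x]))" for x
    unfolding upd using xs by (simp add: pure_tensor_eq[of _ n])
  have closed: "pure_tensor R M (us @ x # vs) \<in> carrier (T n)" if "x \<in> carrier M" for x
    using that uv by (intro pure_tensor_closed) auto
  show "lin_map R M (T n) (\<lambda>x. pure_tensor R M (us @ x # vs))"
  proof (rule lin_mapI)
    fix x assume x: "x \<in> carrier M"
    show "pure_tensor R M (us @ x # vs) \<in> carrier (T n)" by (rule closed[OF x])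
    show "pure_tensor R M (us @ (x \<oplus>\<^bsub>M\<^esub> y) # vs) =
        pure_tensor R M (us @ x # vs) \<oplus>\<^bsub>T n\<^esub> pure_tensor R M (us @ y # vs)" if y: "y \<in> carrier M" for y
    proof -
      have "I.proj (basis_elt R (xs[i := x \<oplus>\<^bsub>M\<^esub> y]) \<ominus>\<^bsub>tensor_poly n\<^esub> basis_elt R (xs[i := x])
          \<ominus>\<^bsub>tensor_poly n\<^esub> basis_elt R (xs[i := y])) = \<zero>\<^bsub>T n\<^esub>"
        using x y xs i by (intro relation) (unfold tensor_relations_def, blast)
      then have "pure_tensor R M (us @ (x \<oplus>\<^bsub>M\<^esub> y) # vs) \<ominus>\<^bsub>T n\<^esub> pure_tensor R M (us @ x # vs)
          \<ominus>\<^bsub>T n\<^esub> pure_tensor R M (us @ y # vs) = \<zero>\<^bsub>T n\<^esub>"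
        using x y xs by (simp add: I.proj_minus Q pure tensor_update_closed del: I.quotient_algebra_simps)
      then show ?thesis
        using x y by (simp add: closed T.M.minus_eq_iff T.M.a_comm)
    qed
    show "pure_tensor R M (us @ (c \<odot>\<^bsub>M\<^esub> x) # vs) = c \<odot>\<^bsub>T n\<^esub> pure_tensor R M (us @ x # vs)"
      if c: "c \<in> carrier R" for c
    proof -
      have "I.proj (basis_elt R (xs[i := c \<odot>\<^bsub>M\<^esub> x]) \<ominus>\<^bsub>tensor_poly n\<^esub>
          c \<odot>\<^bsub>tensor_poly n\<^esub> basis_elt R (xs[i := x])) = \<zero>\<^bsub>T n\<^esub>"
        using x c xs i by (intro relation) (unfold tensor_relations_def, blast)
      then have "pure_tensor R M (us @ (c \<odot>\<^bsub>M\<^esub> x) # vs) \<ominus>\<^bsub>T n\<^esub>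
          c \<odot>\<^bsub>T n\<^esub> pure_tensor R M (us @ x # vs) = \<zero>\<^bsub>T n\<^esub>"
        using x c xs by (simp add: I.proj_minus I.proj_smult Q pure tensor_update_closed del: I.quotient_algebra_simps)
      then show ?thesis
        using x c by (simp add: closed T.M.minus_eq_iff)
    qed
  qed
qed

text \<open>The tensor relations are killed together with all their multiples: multiplying a
  multilinearity relation by a tuple \<open>b\<close> gives another such relation, with
  \<open>b ! i \<otimes> x\<close> in place of \<open>x\<close>.\<close>

lemma tensor_lift_exists:
  assumes W: "module R W" and F: "multilin R M W n F"
  obtains h where "h \<in> linear_maps R (T n) W"
    "\<And>xs. set xs \<subseteq> carrier M \<Longrightarrow> length xs = n \<Longrightarrow> h (pure_tensor R M xs) = F xs"
proof -
  interpret P: comm_monoid_algebra R "tuples n M" by (rule comm_monoid_algebra_tensor)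
  interpret PA: algebra R "tensor_poly n" by (rule P.monoid_algebra_algebra)
  interpret I: algebra_ideal R "tensor_poly n" "tensor_ideal R M n" by (rule algebra_ideal_tensor)
  interpret W: module R W by fact
  have F_closed: "F \<in> carrier (tuples n M) \<rightarrow> carrier W"
    using multilin_closed[OF F] by auto
  define h0 where "h0 = lin_extend R W F"
  have h0: "lin_map R (tensor_poly n) W h0"
    unfolding h0_def by (rule P.lin_extend_lin[OF W F_closed])
  have h0_basis: "h0 (basis_elt R xs) = F xs" if "set xs \<subseteq> carrier M" "length xs = n" for xs
    unfolding h0_def using that P.lin_extend_basis[OF W F_closed] by simp
  have kills: "h0 a = \<zero>\<^bsub>W\<^esub>" if a: "a \<in> tensor_ideal R M n" for a
  proof (rule PA.lin_map_genideal_zero[OF h0 W P.basis_spanning tensor_relations_subset])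
    show "a \<in> Idl\<^bsub>tensor_poly n\<^esub> tensor_relations n" using a by (simp add: tensor_ideal_eq)
    fix z s assume "z \<in> basis_elt R ` carrier (tuples n M)" and s: "s \<in> tensor_relations n"
    then obtain b where b: "set b \<subseteq> carrier M" "length b = n" "z = basis_elt R b" by auto
    have z: "z \<in> carrier (tensor_poly n)" using b tensor_basis_closed by auto
    define g where "g y = h0 (z \<otimes>\<^bsub>tensor_poly n\<^esub> y)" for y
    have g: "lin_map R (tensor_poly n) W g"
      unfolding g_def by (rule lin_map_compose[OF PA.lin_map_mult_left[OF z] h0])
    have g_lin: "lin_map R M W (\<lambda>x. g (basis_elt R (xs[i := x])))"
      if xs: "set xs \<subseteq> carrier M" "length xs = n" and i: "i < n" for xs i
    proof -
      \<comment> \<open>Products of tuples are slotwise, so multiplying \<open>xs[i := x]\<close> by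
        \<open>b\<close> yields a fixed tuple \<open>c\<close> in which only slot \<open>i\<close>
        depends on \<open>x\<close>.\<close>
      define c where "c = map2 (monoid.mult M) b xs"
      have c: "set c \<subseteq> carrier M" "length c = n"
        using set_map2_mult b xs by (auto simp: c_def)
      have "b ! i \<in> carrier M" using b i by auto
      then have "lin_map R M W (\<lambda>x. F (c[i := b ! i \<otimes>\<^bsub>M\<^esub> x]))"
        by (rule lin_map_compose[OF lin_map_mult_left multilin_update[OF F c i]])
      moreover have "g (basis_elt R (xs[i := x])) = F (c[i := b ! i \<otimes>\<^bsub>M\<^esub> x])" if x: "x \<in> carrier M" for x
      proof -
        have xs': "set (xs[i := x]) \<subseteq> carrier M" using xs x set_update_subset_insert[of xs i x] by auto
        have "map2 (monoid.mult M) b (xs[i := x]) = c[i := b ! i \<otimes>\<^bsub>M\<^esub> x]"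
          using b xs i by (intro nth_equalityI) (auto simp: c_def nth_list_update)
        then show ?thesis
          using P.basis_elt_mult[of b "xs[i := x]"] b xs xs' set_map2_mult[OF b(1) xs'] c
          by (simp add: g_def h0_basis)
      qed
      ultimately show ?thesis by (subst lin_map_cong[OF module]) auto
    qed
    consider xs i x y where "set xs \<subseteq> carrier M" "length xs = n" "i < n" "x \<in> carrier M" "y \<in> carrier M"
        "s = basis_elt R (xs[i := x \<oplus>\<^bsub>M\<^esub> y]) \<ominus>\<^bsub>tensor_poly n\<^esub> basis_elt R (xs[i := x])
          \<ominus>\<^bsub>tensor_poly n\<^esub> basis_elt R (xs[i := y])"
      | xs i c x where "set xs \<subseteq> carrier M" "length xs = n" "i < n" "c \<in> carrier R" "x \<in> carrier M"
        "s = basis_elt R (xs[i := c \<odot>\<^bsub>M\<^esub> x]) \<ominus>\<^bsub>tensor_poly n\<^esub> c \<odot>\<^bsub>tensor_poly n\<^esub> basis_elt R (xs[i := x])"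
      using s unfolding tensor_relations_def tuples_simps by blast
    then have "g s = \<zero>\<^bsub>W\<^esub>"
    proof cases
      case 1
      note G = g_lin[OF 1(1-3)]
      have "g s = g (basis_elt R (xs[i := x \<oplus>\<^bsub>M\<^esub> y])) \<ominus>\<^bsub>W\<^esub> g (basis_elt R (xs[i := x]))
          \<ominus>\<^bsub>W\<^esub> g (basis_elt R (xs[i := y]))"
        using 1 by (simp add: PA.lin_map_minus[OF g W] tensor_update_closed del: P.monoid_algebra_simps)
      then show ?thesis
        using 1 lin_map_closed[OF G] by (simp add: lin_map_plus[OF G] W.M.minus_eq_iff W.M.a_comm)
    next
      case 2
      note G = g_lin[OF 2(1-3)]
      have "g s = g (basis_elt R (xs[i := c \<odot>\<^bsub>M\<^esub> x])) \<ominus>\<^bsub>W\<^esub> c \<odot>\<^bsub>W\<^esub> g (basis_elt R (xs[i := x]))"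
        using 2 by (simp add: PA.lin_map_minus[OF g W] lin_map_smult[OF g] tensor_update_closed del: P.monoid_algebra_simps)
      then show ?thesis
        using 2 lin_map_closed[OF G] by (simp add: lin_map_smult[OF G] W.M.minus_eq_iff)
    qed
    then show "h0 (z \<otimes>\<^bsub>tensor_poly n\<^esub> s) = \<zero>\<^bsub>W\<^esub>" by (simp add: g_def)
  qed
  obtain h where h: "h \<in> linear_maps R I.Q W"
    "\<And>a. a \<in> carrier (tensor_poly n) \<Longrightarrow> h (I.proj a) = h0 a"
    using I.quotient_lift[OF W h0 kills] by metis
  show thesis
  proof (rule that)
    show "h \<in> linear_maps R (T n) W" using h(1) by (simp add: tensor_power_def)
    show "h (pure_tensor R M xs) = F xs" if "set xs \<subseteq> carrier M" "length xs = n" for xs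
      using that h(2)[of "basis_elt R xs"] h0_basis[OF that] tensor_basis_closed[of xs]
      by (simp add: pure_tensor_eq[of _ n])
  qed
qed

lemma tensor_map_unique:
  assumes W: "module R W" and g: "lin_map R (T n) W g" and h: "lin_map R (T n) W h"
    and eq: "\<And>xs. set xs \<subseteq> carrier M \<Longrightarrow> length xs = n \<Longrightarrow> g (pure_tensor R M xs) = h (pure_tensor R M xs)"
    and t: "t \<in> carrier (T n)"
  shows "g t = h t"
  by (rule lin_map_eq_on_spanning[OF pure_tensor_spanning tensor_power_module W g h _ t]) (auto intro: eq)

text \<open>Pure tensors span the tensor power, and \<open>linear_maps\<close> consists of
  extensional functions; this makes the map from \<open>tensor_lift_exists\<close> unique and
  justifies the definite description in \<open>tensor_lift\<close>.\<close>

lemma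
  assumes W: "module R W" and F: "multilin R M W n F"
  shows tensor_lift_linear: "tensor_lift R M n W F \<in> linear_maps R (T n) W"
    and tensor_lift_pure:
      "\<And>xs. set xs \<subseteq> carrier M \<Longrightarrow> length xs = n \<Longrightarrow> tensor_lift R M n W F (pure_tensor R M xs) = F xs"
proof -
  obtain h where h: "h \<in> linear_maps R (T n) W"
    "\<And>xs. set xs \<subseteq> carrier M \<Longrightarrow> length xs = n \<Longrightarrow> h (pure_tensor R M xs) = F xs"
    using tensor_lift_exists[OF W F] by metis
  have unique: "g = h"
    if g: "g \<in> linear_maps R (T n) W" "\<forall>xs\<in>carrier (tuples n M). g (pure_tensor R M xs) = F xs" for g
  proof (rule linear_maps_eqI[OF g(1) h(1)])
    show "g t = h t" if t: "t \<in> carrier (T n)" for t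
      by (rule tensor_map_unique[OF W linear_maps_lin[OF g(1)] linear_maps_lin[OF h(1)] _ t])
        (simp add: h(2) g(2))
  qed
  have lift: "tensor_lift R M n W F = h"
    unfolding tensor_lift_def
  proof (rule the_equality)
    show "h \<in> linear_maps R (T n) W \<and> (\<forall>xs\<in>carrier (tuples n M). h (pure_tensor R M xs) = F xs)"
      by (simp add: h)
  qed (elim conjE, rule unique)
  show "tensor_lift R M n W F \<in> linear_maps R (T n) W"
    unfolding lift by (rule h(1))
  show "tensor_lift R M n W F (pure_tensor R M xs) = F xs" if "set xs \<subseteq> carrier M" "length xs = n" for xs
    unfolding lift using that by (rule h(2))
qed

end

section \<open>The iterated coproduct on products\<close>

text \<open>Adjacent transpositions generate all permutations. The length is fixed so that
  invariance is only demanded for lists of that length.\<close>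

lemma swap_invariant_mset_eq:
  assumes swap: "\<And>xs a b ys. set (xs @ a # b # ys) \<subseteq> C \<Longrightarrow> length (xs @ a # b # ys) = n \<Longrightarrow>
      F (xs @ a # b # ys) = F (xs @ b # a # ys)"
    and "set xs \<subseteq> C" "length xs = n" "mset xs = mset ys"
  shows "F xs = F ys"
  using assms
proof (induction xs arbitrary: ys F n)
  case Nil
  then show ?case by simp
next
  case (Cons a xs)
  from Cons.prems(4) have "a \<in> set ys" by (metis list.set_intros(1) mset_eq_setD)
  then obtain us vs where ys: "ys = us @ a # vs" by (meson split_list)
  have "mset xs = mset (us @ vs)" using Cons.prems(4) by (simp add: ys)
  then have sub: "set (a # us @ vs) \<subseteq> C" "length (a # us @ vs) = n" "mset xs = mset (us @ vs)"
    using Cons.prems(2,3) mset_eq_setD[of xs "us @ vs"] mset_eq_length[of xs "us @ vs"] by auto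
  \<comment> \<open>The induction hypothesis is used for the function that keeps \<open>a\<close> in
    front, which is swap invariant on lists shorter by one.\<close>
  have "F (a # xs) = F (a # us @ vs)"
    using Cons.prems(1)[of "a # _"] Cons.prems sub by (intro Cons.IH[of "n - 1" "\<lambda>l. F (a # l)"]) auto
  \<comment> \<open>The entry \<open>a\<close> travels to the front by adjacent swaps; reverse
    induction exposes its left neighbour \<open>b\<close>, which then joins
    \<open>vs\<close>.\<close>
  also have "F (us @ a # vs) = F (a # us @ vs)" if "set us \<subseteq> C" "set vs \<subseteq> C" "a \<in> C" "Suc (length us + length vs) = n" for us vs
    using that
  proof (induction us arbitrary: vs rule: rev_induct)
    case (snoc b us)
    then have "F (us @ b # a # vs) = F (us @ a # b # vs)" by (intro Cons.prems(1)) auto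
    also have "\<dots> = F (a # us @ b # vs)" using snoc by (intro snoc.IH) auto
    finally show ?case by simp
  qed simp
  then have "F (a # us @ vs) = F ys" using sub by (simp add: ys)
  finally show ?case .
qed

section \<open>The coproduct as an algebra morphism, and its iterates\<close>

context module
begin

text \<open>Universal property of S(V) among commutative algebras. The map sends a product to the
  product of the values of \<delta>; \<open>sym_lift\<close> makes it linear, and multiplicativity
  is then checked on products. Together with uniqueness this gives meaning to
  \<open>sym_coproduct\<close>.\<close>

lemma sym_algebra_hom_unique:
  assumes B: "algebra R B" and \<delta>: "lin_map R M B \<delta>"
  shows "\<exists>!d. d \<in> algebra_homs R Sym B \<and> (\<forall>x\<in>carrier M. d (sym_incl R M x) = \<delta> x)"
proof -
  interpret S: algebra R Sym by (rule sym_algebra_algebra)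
  interpret B: algebra R B by fact
  note cr = cring.cring_simprules[OF B.M_cring]
  define F where "F Ys = foldr (\<lambda>Y A. \<delta> Y \<otimes>\<^bsub>B\<^esub> A) Ys \<one>\<^bsub>B\<^esub>" for Ys
  have \<delta>_closed: "\<delta> x \<in> carrier B" if "x \<in> carrier M" for x by (rule lin_map_closed[OF \<delta> that])
  have F_simps: "F [] = \<one>\<^bsub>B\<^esub>" "F (y # ys) = \<delta> y \<otimes>\<^bsub>B\<^esub> F ys" for y ys by (simp_all add: F_def)
  have F_closed: "F Ys \<in> carrier B" if "set Ys \<subseteq> carrier M" for Ys
    using that by (induction Ys) (auto simp: F_simps \<delta>_closed cr(5,6))
  have F_append: "F (xs @ ys) = F xs \<otimes>\<^bsub>B\<^esub> F ys" if "set xs \<subseteq> carrier M" "set ys \<subseteq> carrier M" for xs ys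
    using that by (induction xs) (auto simp: F_simps F_closed \<delta>_closed cr(11,12))
  have "F (xs @ a # b # ys) = F (xs @ b # a # ys)" if "set (xs @ a # b # ys) \<subseteq> carrier M" for xs a b ys
    using that cr(24)[of "\<delta> a" "\<delta> b" "F ys"] by (simp add: F_append F_simps F_closed \<delta>_closed)
  then have F_mset: "F xs = F ys" if "set xs \<subseteq> carrier M" "mset xs = mset ys" for xs ys
    using swap_invariant_mset_eq[of "carrier M" "length xs" F xs ys] that by auto
  have F_lin: "lin_map R M B (\<lambda>x. F (x # xs))" if "set xs \<subseteq> carrier M" for xs
    unfolding F_simps by (rule lin_map_compose[OF \<delta> B.lin_map_mult_right[OF F_closed[OF that]]])
  obtain d where d: "d \<in> linear_maps R Sym B" "\<And>xs. set xs \<subseteq> carrier M \<Longrightarrow> d (sym_prod R M xs) = F xs"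
    using sym_lift[OF B.module F_mset _ F_lin] F_closed[of "[]"] by auto
  note d_lin = linear_maps_lin[OF d(1)]
  have d_mult: "d (x \<otimes>\<^bsub>Sym\<^esub> y) = d x \<otimes>\<^bsub>B\<^esub> d y" if "x \<in> carrier Sym" "y \<in> carrier Sym" for x y
    by (rule lin_map_mult_on_spanning[OF sym_algebra_algebra B sym_prod_spanning d_lin _ that])
      (auto simp: sym_prod_append[symmetric] d(2) F_append lists_eq_set)
  have "d \<in> algebra_homs R Sym B"
    using d d(2)[of "[]"] d_mult lin_map_closed[OF d_lin]
    by (auto simp: algebra_homs_def ring_hom_def F_simps lin_map_plus[OF d_lin])
  moreover have "d (sym_incl R M x) = \<delta> x" if "x \<in> carrier M" for x
    using d(2)[of "[x]"] that by (simp add: sym_prod_single F_simps cr(16) \<delta>_closed)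
  moreover have "d' = d"
    if d': "d' \<in> algebra_homs R Sym B" "\<forall>x\<in>carrier M. d' (sym_incl R M x) = \<delta> x" for d'
  proof (rule linear_maps_eqI[OF _ d(1)])
    show lin': "d' \<in> linear_maps R Sym B" using d'(1) by (simp add: algebra_homs_def)
    have "d' (sym_prod R M xs) = F xs" if "set xs \<subseteq> carrier M" for xs
      using that d' by (induction xs) (auto simp: algebra_homs_def ring_hom_def F_simps sym_prod_Cons)
    then show "d' t = d t" if "t \<in> carrier Sym" for t
      by (intro lin_map_eq_on_spanning[OF sym_prod_spanning S.module B.module linear_maps_lin[OF lin'] d_lin _ that])
        (auto simp: d(2) lists_eq_set)
  qed
  ultimately show ?thesis by blast
qed

abbreviation SymT where "SymT n \<equiv> tensor_power R Sym n"
abbreviation pure where "pure \<equiv> pure_tensor R Sym"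

lemma sym_tensor_power_algebra: "algebra R (SymT n)"
  by (rule algebra.tensor_power_algebra[OF sym_algebra_algebra])

lemma sym_tensor_power_module: "module R (SymT n)"
  by (rule algebra.tensor_power_module[OF sym_algebra_algebra])

lemma
  shows sym_coproduct_hom: "sym_coproduct R M \<in> algebra_homs R Sym (SymT 2)"
    and sym_coproduct_incl: "x \<in> carrier M \<Longrightarrow> sym_coproduct R M (sym_incl R M x) =
      pure [sym_incl R M x, \<one>\<^bsub>Sym\<^esub>] \<oplus>\<^bsub>SymT 2\<^esub> pure [\<one>\<^bsub>Sym\<^esub>, sym_incl R M x]"
proof -
  interpret S: algebra R Sym by (rule sym_algebra_algebra)
  interpret T: module R "SymT 2" by (rule sym_tensor_power_module)
  have one: "\<one>\<^bsub>Sym\<^esub> \<in> carrier Sym" using cring.cring_simprules(6)[OF S.M_cring] .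
  have "lin_map R Sym (SymT 2) (\<lambda>A. pure [A, \<one>\<^bsub>Sym\<^esub>])" "lin_map R Sym (SymT 2) (\<lambda>A. pure [\<one>\<^bsub>Sym\<^esub>, A])"
    using multilin_lin[OF S.pure_tensor_multilin, of "[]" "[\<one>\<^bsub>Sym\<^esub>]" 2]
      multilin_lin[OF S.pure_tensor_multilin, of "[\<one>\<^bsub>Sym\<^esub>]" "[]" 2] one by auto
  then have "lin_map R M (SymT 2) (\<lambda>x. pure [sym_incl R M x, \<one>\<^bsub>Sym\<^esub>] \<oplus>\<^bsub>SymT 2\<^esub> pure [\<one>\<^bsub>Sym\<^esub>, sym_incl R M x])"
    by (intro T.lin_map_add lin_map_compose[OF sym_incl_lin])
  from theI'[OF sym_algebra_hom_unique[OF sym_tensor_power_algebra this]]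
  show "sym_coproduct R M \<in> algebra_homs R Sym (SymT 2)"
    "x \<in> carrier M \<Longrightarrow> sym_coproduct R M (sym_incl R M x) =
      pure [sym_incl R M x, \<one>\<^bsub>Sym\<^esub>] \<oplus>\<^bsub>SymT 2\<^esub> pure [\<one>\<^bsub>Sym\<^esub>, sym_incl R M x]"
    by (simp_all add: sym_coproduct_def Let_def)
qed

lemma sym_coproduct_lin: "lin_map R Sym (SymT 2) (sym_coproduct R M)"
  using sym_coproduct_hom by (simp add: algebra_homs_def linear_maps_lin)

lemma map_sym_prod_closed: "set Ls \<subseteq> lists (carrier M) \<Longrightarrow> set (map (sym_prod R M) Ls) \<subseteq> carrier Sym"
  by (auto simp: lists_eq_set intro!: sym_prod_closed)

text \<open>Each factor \<open>z\<close> is primitive, and multiplying a pure tensor by \<Delta>(z)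
  = z \<otimes> 1 + 1 \<otimes> z places \<open>z\<close> in one of the two slots. This is exactly
  \<open>insert_one z\<close>.\<close>

lemma sym_coproduct_sym_prod:
  assumes "set zs \<subseteq> carrier M"
  shows "sym_coproduct R M (sym_prod R M zs) =
    msum (SymT 2) (\<lambda>Ls. pure (map (sym_prod R M) Ls)) (unshuffles 2 zs)"
proof -
  interpret S: algebra R Sym by (rule sym_algebra_algebra)
  interpret T: algebra R "SymT 2" by (rule sym_tensor_power_algebra)
  note cr = cring.cring_simprules[OF S.M_cring] and T_cr = cring.cring_simprules[OF T.M_cring]
  let ?G = "\<lambda>Ls. pure (map (sym_prod R M) Ls)"
  have closed: "?G Ls \<in> carrier (SymT 2)" if "set Ls \<subseteq> lists (carrier M)" "length Ls = 2" for Ls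
    using that by (intro S.pure_tensor_closed map_sym_prod_closed) auto
  show ?thesis
    using assms
  proof (induction zs)
    case Nil
    have "sym_coproduct R M \<one>\<^bsub>Sym\<^esub> = \<one>\<^bsub>SymT 2\<^esub>"
      using sym_coproduct_hom by (simp add: algebra_homs_def ring_hom_def)
    then show ?case
      using S.pure_tensor_one[of 2] T_cr(6) by (simp add: T.M.r_zero)
  next
    case (Cons z zs)
    let ?\<delta> = "pure [sym_incl R M z, \<one>\<^bsub>Sym\<^esub>] \<oplus>\<^bsub>SymT 2\<^esub> pure [\<one>\<^bsub>Sym\<^esub>, sym_incl R M z]"
    have pures: "pure [sym_incl R M z, \<one>\<^bsub>Sym\<^esub>] \<in> carrier (SymT 2)"
        "pure [\<one>\<^bsub>Sym\<^esub>, sym_incl R M z] \<in> carrier (SymT 2)"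
      using Cons.prems cr(6) by (auto intro!: S.pure_tensor_closed)
    have "sym_coproduct R M (sym_prod R M (z # zs)) =
        ?\<delta> \<otimes>\<^bsub>SymT 2\<^esub> sym_coproduct R M (sym_prod R M zs)"
      using sym_coproduct_hom Cons.prems
      by (simp add: algebra_homs_def ring_hom_def sym_prod_Cons sym_coproduct_incl)
    also have "\<dots> = msum (SymT 2) (\<lambda>Ls. ?\<delta> \<otimes>\<^bsub>SymT 2\<^esub> ?G Ls) (unshuffles 2 zs)"
      using Cons pures
      by (simp add: T.lin_map_msum_apply[OF T.lin_map_mult_left T.module] closed
          length_unshuffles set_unshuffles[of _ 2 zs])
    also have "\<dots> = msum (SymT 2) (\<lambda>Ls. msum (SymT 2) ?G (insert_one z Ls)) (unshuffles 2 zs)"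
    proof (rule T.M.msum_cong)
      fix Ls assume Ls: "Ls \<in># unshuffles 2 zs"
      obtain A B where AB: "Ls = [A, B]"
        using length_unshuffles[OF Ls] by (auto simp: numeral_2_eq_2 length_Suc_conv)
      have sub: "set A \<subseteq> carrier M" "set B \<subseteq> carrier M" "z \<in> carrier M"
        using set_unshuffles[OF Ls, of "carrier M"] Cons.prems by (auto simp: AB)
      have "?\<delta> \<otimes>\<^bsub>SymT 2\<^esub> ?G Ls = pure [sym_incl R M z, \<one>\<^bsub>Sym\<^esub>] \<otimes>\<^bsub>SymT 2\<^esub> ?G Ls
          \<oplus>\<^bsub>SymT 2\<^esub> pure [\<one>\<^bsub>Sym\<^esub>, sym_incl R M z] \<otimes>\<^bsub>SymT 2\<^esub> ?G Ls"
        using pures closed[of Ls] sub AB by (intro T_cr(13)) auto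
      also have "\<dots> = ?G [z # A, B] \<oplus>\<^bsub>SymT 2\<^esub> ?G [A, z # B]"
        using sub cr(6) by (simp add: AB S.pure_tensor_mult sym_prod_Cons cr(12))
      also have "\<dots> = msum (SymT 2) ?G (insert_one z Ls)"
        using closed[of "[z # A, B]"] closed[of "[A, z # B]"] sub by (simp add: AB lists_eq_set T.M.r_zero T.M.a_comm)
      finally show "?\<delta> \<otimes>\<^bsub>SymT 2\<^esub> ?G Ls = msum (SymT 2) ?G (insert_one z Ls)" .
    qed
    also have "\<dots> = msum (SymT 2) ?G (unshuffles 2 (z # zs))"
      by (simp add: T.M.msum_bind)
    finally show ?case .
  qed
qed

text \<open>The inner lift of \<open>coproduct_first\<close>: it appends the fixed factors
  \<open>us\<close> to a 2-tensor. With \<open>us\<close> as a parameter, linearity in the 2-tensor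
  and in the entries of \<open>us\<close> can be treated separately.\<close>

definition coproduct_head where
  "coproduct_head n us = tensor_lift R Sym 2 (SymT (Suc (Suc n))) (\<lambda>Bs. pure (Bs @ us))"

lemma pure_append_multilin:
  assumes "set us \<subseteq> carrier Sym" "length us = n"
  shows "multilin R Sym (SymT (Suc (Suc n))) 2 (\<lambda>Bs. pure (Bs @ us))"
proof -
  interpret S: algebra R Sym by (rule sym_algebra_algebra)
  show ?thesis
    using assms multilin_lin[OF S.pure_tensor_multilin, of xs "ys @ us" "Suc (Suc n)" for xs ys]
    by (intro multilinI) (auto intro!: S.pure_tensor_closed)
qed

lemma
  assumes "set us \<subseteq> carrier Sym" "length us = n"
  shows coproduct_head_lin: "lin_map R (SymT 2) (SymT (Suc (Suc n))) (coproduct_head n us)"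
    and coproduct_head_pure: "set Bs \<subseteq> carrier Sym \<Longrightarrow> length Bs = 2 \<Longrightarrow>
      coproduct_head n us (pure Bs) = pure (Bs @ us)"
proof -
  interpret S: algebra R Sym by (rule sym_algebra_algebra)
  show "lin_map R (SymT 2) (SymT (Suc (Suc n))) (coproduct_head n us)"
    "set Bs \<subseteq> carrier Sym \<Longrightarrow> length Bs = 2 \<Longrightarrow> coproduct_head n us (pure Bs) = pure (Bs @ us)"
    using S.tensor_lift_linear[OF sym_tensor_power_module pure_append_multilin[OF assms]]
      S.tensor_lift_pure[OF sym_tensor_power_module pure_append_multilin[OF assms], of Bs]
    by (auto simp: coproduct_head_def linear_maps_lin)
qed

text \<open>For a pure tensor in place of \<open>t\<close> this is multilinearity of pure tensors.
  The value of the coproduct is only a sum of pure tensors, hence the passage through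
  \<open>lin_map_param_spanning\<close>.\<close>

lemma coproduct_head_lin_tail:
  assumes us: "set us \<subseteq> carrier Sym" "set vs \<subseteq> carrier Sym" "Suc (length us + length vs) = n"
    and t: "t \<in> carrier (SymT 2)"
  shows "lin_map R Sym (SymT (Suc (Suc n))) (\<lambda>x. coproduct_head n (us @ x # vs) t)"
proof -
  interpret S: algebra R Sym by (rule sym_algebra_algebra)
  show ?thesis
  proof (rule lin_map_param_spanning[OF S.pure_tensor_spanning sym_tensor_power_module S.module sym_tensor_power_module _ _ t])
    show "lin_map R (SymT 2) (SymT (Suc (Suc n))) (coproduct_head n (us @ x # vs))" if "x \<in> carrier Sym" for x
      using us that by (intro coproduct_head_lin) auto
    fix s assume "s \<in> pure ` {xs. length xs = 2 \<and> set xs \<subseteq> carrier Sym}"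
    then obtain Bs where Bs: "length Bs = 2" "set Bs \<subseteq> carrier Sym" "s = pure Bs" by auto
    have "lin_map R Sym (SymT (Suc (Suc n))) (\<lambda>x. pure ((Bs @ us) @ x # vs))"
      using Bs us by (intro multilin_lin[OF S.pure_tensor_multilin]) auto
    moreover have "coproduct_head n (us @ x # vs) s = pure ((Bs @ us) @ x # vs)" if "x \<in> carrier Sym" for x
      using us that Bs by (simp add: coproduct_head_pure)
    ultimately show "lin_map R Sym (SymT (Suc (Suc n))) (\<lambda>x. coproduct_head n (us @ x # vs) s)"
      by (subst lin_map_cong[OF S.module]) auto
  qed
qed

lemma coproduct_first_multilin:
  "multilin R Sym (SymT (Suc (Suc n))) (Suc n) (\<lambda>As. coproduct_head n (tl As) (sym_coproduct R M (hd As)))"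
proof (rule multilinI)
  fix xs assume "set xs \<subseteq> carrier Sym" "length xs = Suc n"
  then show "coproduct_head n (tl xs) (sym_coproduct R M (hd xs)) \<in> carrier (SymT (Suc (Suc n)))"
    by (cases xs) (auto intro!: lin_map_closed[OF coproduct_head_lin] lin_map_closed[OF sym_coproduct_lin])
next
  fix xs ys assume xs: "set xs \<subseteq> carrier Sym" and ys: "set ys \<subseteq> carrier Sym"
    and len: "Suc (length xs + length ys) = Suc n"
  show "lin_map R Sym (SymT (Suc (Suc n)))
      (\<lambda>x. coproduct_head n (tl (xs @ x # ys)) (sym_coproduct R M (hd (xs @ x # ys))))"
  proof (cases xs)
    case Nil
    then show ?thesis
      using lin_map_compose[OF sym_coproduct_lin coproduct_head_lin[OF ys]] len by simp
  next
    case (Cons A us)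
    then show ?thesis
      using xs ys len by (auto intro!: coproduct_head_lin_tail lin_map_closed[OF sym_coproduct_lin])
  qed
qed

lemma
  shows coproduct_first_lin: "lin_map R (SymT (Suc n)) (SymT (Suc (Suc n))) (coproduct_first R M n)"
    and coproduct_first_pure: "A \<in> carrier Sym \<Longrightarrow> set us \<subseteq> carrier Sym \<Longrightarrow> length us = n \<Longrightarrow>
      coproduct_first R M n (pure (A # us)) = coproduct_head n us (sym_coproduct R M A)"
proof -
  interpret S: algebra R Sym by (rule sym_algebra_algebra)
  have eq: "coproduct_first R M n = tensor_lift R Sym (Suc n) (SymT (Suc (Suc n)))
      (\<lambda>As. coproduct_head n (tl As) (sym_coproduct R M (hd As)))"
    by (simp add: coproduct_first_def coproduct_head_def Let_def)
  show "lin_map R (SymT (Suc n)) (SymT (Suc (Suc n))) (coproduct_first R M n)"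
    unfolding eq by (rule linear_maps_lin[OF S.tensor_lift_linear[OF sym_tensor_power_module coproduct_first_multilin]])
  show "A \<in> carrier Sym \<Longrightarrow> set us \<subseteq> carrier Sym \<Longrightarrow> length us = n \<Longrightarrow>
      coproduct_first R M n (pure (A # us)) = coproduct_head n us (sym_coproduct R M A)"
    unfolding eq by (subst S.tensor_lift_pure[OF sym_tensor_power_module coproduct_first_multilin]) auto
qed

lemma iterated_coproduct_lin: "lin_map R Sym (SymT (Suc n)) (iterated_coproduct R M n)"
proof (induction n)
  case 0
  show ?case
    using multilin_lin[OF algebra.pure_tensor_multilin[OF sym_algebra_algebra], of "[]" "[]" 1] by simp
next
  case (Suc n)
  then show ?case using lin_map_compose[OF Suc coproduct_first_lin] by simp
qed

text \<open>The recursion of the iterated coproduct and that of \<open>unshuffles_Suc\<close> agree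
  term by term: \<Delta> acts on the first slot, and its value on a product is the sum over
  \<open>unshuffles 2\<close>.\<close>

lemma iterated_coproduct_sym_prod:
  assumes "set zs \<subseteq> carrier M"
  shows "iterated_coproduct R M n (sym_prod R M zs) =
    msum (SymT (Suc n)) (\<lambda>Ls. pure (map (sym_prod R M) Ls)) (unshuffles (Suc n) zs)"
proof (induction n)
  case 0
  interpret T: module R "SymT (Suc 0)" by (rule sym_tensor_power_module)
  have "pure [sym_prod R M zs] \<in> carrier (SymT (Suc 0))"
    using assms by (intro algebra.pure_tensor_closed[OF sym_algebra_algebra]) auto
  then show ?case by (simp add: unshuffles_1 T.M.r_zero)
next
  case (Suc n)
  interpret S: algebra R Sym by (rule sym_algebra_algebra)
  interpret T2: module R "SymT 2" by (rule sym_tensor_power_module)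
  interpret T: module R "SymT (Suc n)" by (rule sym_tensor_power_module)
  interpret T': module R "SymT (Suc (Suc n))" by (rule sym_tensor_power_module)
  let ?sp = "sym_prod R M"
  have closed: "pure (map ?sp Ls) \<in> carrier (SymT m)" if "set Ls \<subseteq> lists (carrier M)" "length Ls = m" for Ls m
    using that by (intro S.pure_tensor_closed map_sym_prod_closed) auto
  have first: "coproduct_first R M n (pure (map ?sp Ls)) =
      msum (SymT (Suc (Suc n))) (\<lambda>Bs. pure (map ?sp (Bs @ tl Ls))) (unshuffles 2 (hd Ls))"
    if Ls: "Ls \<in># unshuffles (Suc n) zs" for Ls
  proof -
    obtain A us where Au: "Ls = A # us" "length us = n"
      using length_unshuffles[OF Ls] by (cases Ls) auto
    have sub: "set A \<subseteq> carrier M" "set us \<subseteq> lists (carrier M)"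
      using set_unshuffles[OF Ls assms] by (auto simp: Au)
    have us: "set (map ?sp us) \<subseteq> carrier Sym" "length (map ?sp us) = n"
      using map_sym_prod_closed[OF sub(2)] Au by auto
    have "coproduct_first R M n (pure (map ?sp Ls)) =
        coproduct_head n (map ?sp us) (msum (SymT 2) (\<lambda>Bs. pure (map ?sp Bs)) (unshuffles 2 A))"
      using us sub by (simp add: Au coproduct_first_pure sym_coproduct_sym_prod)
    also have "\<dots> = msum (SymT (Suc (Suc n))) (\<lambda>Bs. coproduct_head n (map ?sp us) (pure (map ?sp Bs))) (unshuffles 2 A)"
      using length_unshuffles[of _ 2 A] set_unshuffles[of _ 2 A, OF _ sub(1)]
      by (intro T2.lin_map_msum_apply[OF coproduct_head_lin[OF us] sym_tensor_power_module] closed)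
    also have "\<dots> = msum (SymT (Suc (Suc n))) (\<lambda>Bs. pure (map ?sp (Bs @ us))) (unshuffles 2 A)"
      using length_unshuffles[of _ 2 A] set_unshuffles[of _ 2 A, OF _ sub(1)]
      by (intro T'.M.msum_cong) (simp add: coproduct_head_pure[OF us] map_sym_prod_closed del: set_map)
    finally show ?thesis by (simp add: Au)
  qed
  have "iterated_coproduct R M (Suc n) (?sp zs) =
      msum (SymT (Suc (Suc n))) (\<lambda>Ls. coproduct_first R M n (pure (map ?sp Ls))) (unshuffles (Suc n) zs)"
    using length_unshuffles[of _ "Suc n" zs] set_unshuffles[of _ "Suc n" zs, OF _ assms]
    by (simp add: Suc) (intro T.lin_map_msum_apply[OF coproduct_first_lin sym_tensor_power_module] closed)
  also have "\<dots> = msum (SymT (Suc (Suc n))) (\<lambda>Ls. pure (map ?sp Ls)) (unshuffles (Suc (Suc n)) zs)"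
    unfolding unshuffles_Suc by (simp only: T'.M.msum_bind T'.M.msum_image first cong: T'.M.msum_cong)
  finally show ?case .
qed

text \<open>Turns a Sweedler expression, evaluated on a product, into a finite sum over lists. The
  coproduct side of the brace axiom thereby becomes combinatorial.\<close>

lemma tensor_lift_iterated_coproduct:
  assumes W: "module R W" and F: "multilin R Sym W (Suc n) F" and zs: "set zs \<subseteq> carrier M"
  shows "tensor_lift R Sym (Suc n) W F (iterated_coproduct R M n (sym_prod R M zs)) =
    msum W (\<lambda>Ls. F (map (sym_prod R M) Ls)) (unshuffles (Suc n) zs)"
proof -
  interpret S: algebra R Sym by (rule sym_algebra_algebra)
  interpret T: module R "SymT (Suc n)" by (rule sym_tensor_power_module)
  interpret W: module R W by fact
  note lift = linear_maps_lin[OF S.tensor_lift_linear[OF W F]]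
  have Ls: "set (map (sym_prod R M) Ls) \<subseteq> carrier Sym" "length (map (sym_prod R M) Ls) = Suc n"
    if "Ls \<in># unshuffles (Suc n) zs" for Ls
    using length_unshuffles[OF that] map_sym_prod_closed[OF set_unshuffles[OF that zs]] by auto
  show ?thesis
    unfolding iterated_coproduct_sym_prod[OF zs]
    using Ls S.pure_tensor_closed[of _ "Suc n"]
    by (subst T.lin_map_msum_apply[OF lift W]) (auto simp: S.tensor_lift_pure[OF W F] intro!: W.M.msum_cong)
qed

end

section \<open>Multilinear functions summed over altered lists\<close>

context abelian_group
begin

lemma minus_eq_minus_iff:
  assumes "a \<in> carrier G" "b \<in> carrier G" "c \<in> carrier G" "d \<in> carrier G"
  shows "a \<ominus> b = c \<ominus> d \<longleftrightarrow> a \<oplus> d = c \<oplus> b"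
proof -
  have "a \<ominus> b = c \<ominus> d \<longleftrightarrow> a = c \<ominus> d \<oplus> b"
    using assms by (intro minus_eq_iff) auto
  also have "\<dots> \<longleftrightarrow> a \<oplus> d = c \<ominus> d \<oplus> b \<oplus> d"
    using assms by (intro add.right_cancel[symmetric]) auto
  also have "c \<ominus> d \<oplus> b \<oplus> d = c \<oplus> b \<oplus> (\<ominus> d \<oplus> d)"
    using assms by (simp add: minus_eq a_ac)
  finally show ?thesis using assms by (simp add: l_neg)
qed

lemma msum_minus:
  assumes "\<And>x. x \<in># K \<Longrightarrow> F x \<in> carrier G" "\<And>x. x \<in># K \<Longrightarrow> H x \<in> carrier G"
  shows "msum G (\<lambda>x. F x \<ominus> H x) K = msum G F K \<ominus> msum G H K"
proof -
  have neg_zero: "\<ominus> \<zero> = \<zero>" by (rule minus_equality) auto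
  show ?thesis using assms by (induction K) (auto simp: minus_eq minus_add a_ac neg_zero)
qed

end

text \<open>Linearity in the parameter \<open>x\<close> of the alteration. It serves for the first
  argument of a brace, which enters the recursion as the \<open>Z\<close> of the derivation.\<close>

lemma msum_alter_one_lin:
  assumes "module R M" "module R N" "multilin R M N n F"
    and \<phi>: "\<And>y. y \<in> carrier M \<Longrightarrow> lin_map R K M (\<lambda>x. \<phi> x y)" and K: "module R K"
    and "set ys \<subseteq> carrier M" "length ys = n"
  shows "lin_map R K N (\<lambda>x. msum N F (alter_one (\<lambda>y. {#\<phi> x y#}) ys))"
  using assms(3,6,7)
proof (induction ys arbitrary: F n)
  interpret N: module R N by fact
  case Nil
  then show ?case by (simp add: N.lin_map_0)
next
  interpret N: module R N by fact
  case (Cons y ys)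
  obtain m where m: "n = Suc m" "length ys = m" using Cons.prems by auto
  have head: "lin_map R K N (\<lambda>x. F (\<phi> x y # ys))"
    using Cons.prems m by (intro lin_map_compose[OF \<phi> multilin_head]) auto
  have "lin_map R K N (\<lambda>x. F (\<phi> x y # ys) \<oplus>\<^bsub>N\<^esub> msum N (\<lambda>l. F (y # l)) (alter_one (\<lambda>y. {#\<phi> x y#}) ys))"
    using Cons.prems m by (intro N.lin_map_add head Cons.IH[of m] multilin_Cons[of R M N]) auto
  then show ?case
    using lin_map_closed[OF head] by (subst lin_map_cong[OF K]) auto
qed

text \<open>Here \<open>\<phi> y \<oplus> \<psi> y\<close> is one new entry, whereas
  \<open>alter_one_plus\<close> collects two alternatives in a multiset. The two kinds of sums agree
  after applying a multilinear \<open>F\<close>.\<close>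

lemma msum_alter_one_add:
  assumes "module R M" "module R N" "multilin R M N n F"
    and "\<And>y. y \<in> carrier M \<Longrightarrow> \<phi> y \<in> carrier M" "\<And>y. y \<in> carrier M \<Longrightarrow> \<psi> y \<in> carrier M"
    and "set ys \<subseteq> carrier M" "length ys = n"
  shows "msum N F (alter_one (\<lambda>y. {#\<phi> y \<oplus>\<^bsub>M\<^esub> \<psi> y#}) ys) =
    msum N F (alter_one (\<lambda>y. {#\<phi> y#}) ys) \<oplus>\<^bsub>N\<^esub> msum N F (alter_one (\<lambda>y. {#\<psi> y#}) ys)"
  using assms(3,6,7)
proof (induction ys arbitrary: F n)
  interpret N: module R N by fact
  case Nil
  then show ?case by simp
next
  interpret M: module R M by fact
  interpret N: module R N by fact
  case (Cons y ys)
  obtain m where m: "n = Suc m" "length ys = m" using Cons.prems by auto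
  have head: "lin_map R M N (\<lambda>u. F (u # ys))"
    using Cons.prems m by (intro multilin_head) auto
  have "msum N (\<lambda>l. F (y # l)) (alter_one (\<lambda>y. {#\<phi> y \<oplus>\<^bsub>M\<^esub> \<psi> y#}) ys) =
    msum N (\<lambda>l. F (y # l)) (alter_one (\<lambda>y. {#\<phi> y#}) ys) \<oplus>\<^bsub>N\<^esub> msum N (\<lambda>l. F (y # l)) (alter_one (\<lambda>y. {#\<psi> y#}) ys)"
    using Cons.prems m by (intro Cons.IH[of m] multilin_Cons[of R M N]) auto
  then show ?case
    using Cons.prems assms(4,5)
    by (simp add: lin_map_plus[OF head] lin_map_closed[OF head] N.M.a_ac)
qed

text \<open>Linearity in an entry of the list being altered: \<open>x\<close> occurs either
  untouched, next to an alteration elsewhere, or as \<open>\<phi> x\<close>.\<close>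

lemma msum_alter_one_slot_lin:
  assumes "module R M" "module R N" "multilin R M N n F" "lin_map R M M \<phi>"
    and xs: "set xs \<subseteq> carrier M" and ys: "set ys \<subseteq> carrier M" and len: "Suc (length xs + length ys) = n"
  shows "lin_map R M N (\<lambda>x. msum N F (alter_one (\<lambda>y. {#\<phi> y#}) (xs @ x # ys)))"
proof -
  interpret M: module R M by fact
  interpret N: module R N by fact
  let ?D = "alter_one (\<lambda>y. {#\<phi> y#})"
  have slot: "lin_map R M N (\<lambda>x. F (us @ x # vs))"
    if "set us \<subseteq> carrier M" "set vs \<subseteq> carrier M" "Suc (length us + length vs) = n" for us vs
    by (rule multilin_lin[OF assms(3) that])
  have D: "set us \<subseteq> carrier M \<and> length us = length zs" if "us \<in># ?D zs" "set zs \<subseteq> carrier M" for us zs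
    using set_alter_one[OF that] length_alter_one[OF that(1)] lin_map_closed[OF assms(4)] by auto
  have "lin_map R M N (\<lambda>x. msum N (\<lambda>us. F (us @ x # ys)) (?D xs) \<oplus>\<^bsub>N\<^esub>
      (F (xs @ \<phi> x # ys) \<oplus>\<^bsub>N\<^esub> msum N (\<lambda>vs. F (xs @ x # vs)) (?D ys)))"
    by (intro N.lin_map_add N.lin_map_msum slot assms(1) lin_map_compose[OF assms(4) slot])
      (use D xs ys len in auto)
  then show ?thesis
    using lin_map_closed[OF slot[OF xs ys len] lin_map_closed[OF assms(4)]]
    by (subst lin_map_cong[OF assms(1)]) (auto simp: alter_one_append N.M.a_lcomm)
qed

text \<open>Every summand is matched by one adjacent swap: alterations away from the pair keep their
  place, and the terms with \<open>\<phi> a\<close> or \<open>\<phi> b\<close> correspond to each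
  other on the two sides.\<close>

lemma (in abelian_monoid) msum_alter_one_swap:
  assumes swap: "\<And>xs a b ys. set (xs @ a # b # ys) \<subseteq> C \<Longrightarrow> length (xs @ a # b # ys) = n \<Longrightarrow>
      F (xs @ a # b # ys) = F (xs @ b # a # ys)"
    and closed: "\<And>xs. set xs \<subseteq> C \<Longrightarrow> length xs = n \<Longrightarrow> F xs \<in> carrier G"
    and \<phi>: "\<And>y. y \<in> C \<Longrightarrow> \<phi> y \<in> C"
    and C: "set (xs @ a # b # ys) \<subseteq> C" "length (xs @ a # b # ys) = n"
  shows "msum G F (alter_one (\<lambda>y. {#\<phi> y#}) (xs @ a # b # ys)) =
    msum G F (alter_one (\<lambda>y. {#\<phi> y#}) (xs @ b # a # ys))"
proof -
  let ?D = "alter_one (\<lambda>y. {#\<phi> y#})"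
  have D: "set us \<subseteq> C" "length us = length zs" if "us \<in># ?D zs" "set zs \<subseteq> C" for us zs
    using set_alter_one[OF that] length_alter_one[OF that(1)] \<phi> by auto
  have "msum G (\<lambda>us. F (us @ a # b # ys)) (?D xs) = msum G (\<lambda>us. F (us @ b # a # ys)) (?D xs)"
    "msum G (\<lambda>vs. F (xs @ a # b # vs)) (?D ys) = msum G (\<lambda>vs. F (xs @ b # a # vs)) (?D ys)"
    by (intro msum_cong swap; use C in \<open>auto dest: D\<close>)+
  moreover have "F (xs @ \<phi> a # b # ys) = F (xs @ b # \<phi> a # ys)" "F (xs @ a # \<phi> b # ys) = F (xs @ \<phi> b # a # ys)"
    using \<phi> C by (auto intro!: swap)
  moreover have "F (xs @ \<phi> a # b # ys) \<in> carrier G" "F (xs @ \<phi> b # a # ys) \<in> carrier G"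
    using \<phi> C by (auto intro!: closed)
  ultimately show ?thesis
    by (simp add: alter_one_append a_ac)
qed

section \<open>Braces in a pre-Lie algebra\<close>

text \<open>The counter \<open>n\<close> only serves termination: it is the length of the list of arguments.\<close>

primrec brace_len :: "('k, 'v) prelie_alg \<Rightarrow> nat \<Rightarrow> 'v \<Rightarrow> 'v list \<Rightarrow> 'v" where
  "brace_len L 0 X Ys = X"
| "brace_len L (Suc n) X Ys = circ L (brace_len L n X (tl Ys)) (hd Ys) \<ominus>\<^bsub>L\<^esub>
    msum L (brace_len L n X) (alter_one (\<lambda>Y. {#circ L Y (hd Ys)#}) (tl Ys))"

definition list_brace :: "('k, 'v) prelie_alg \<Rightarrow> 'v \<Rightarrow> 'v list \<Rightarrow> 'v" where
  "list_brace L X Ys = brace_len L (length Ys) X Ys"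

context prelie_algebra
begin

sublocale module R L
  using proper_module by (simp add: proper_module_def)

abbreviation D where "D Z \<equiv> alter_one (\<lambda>Y. {#circ L Y Z#})"
abbreviation br where "br \<equiv> list_brace L"

lemma circ_lin_right: "X \<in> carrier L \<Longrightarrow> lin_map R L L (circ L X)"
  using circ_bilinear by (auto simp: bilinear_maps_def linear_maps_iff)

lemma circ_lin_left:
  assumes "Y \<in> carrier L"
  shows "lin_map R L L (\<lambda>X. circ L X Y)"
proof -
  have "lin_map R L L (\<lambda>X\<in>carrier L. circ L X Y)"
    using circ_bilinear assms by (auto simp: bilinear_maps_def linear_maps_iff)
  then show ?thesis by (subst lin_map_cong[OF module_axioms]) auto
qed

lemma circ_closed [simp]: "X \<in> carrier L \<Longrightarrow> Y \<in> carrier L \<Longrightarrow> circ L X Y \<in> carrier L"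
  by (rule lin_map_closed[OF circ_lin_right])

lemma list_brace_Nil [simp]: "br X [] = X"
  by (simp add: list_brace_def)

lemma list_brace_Cons: "br X (Z # Ys) = circ L (br X Ys) Z \<ominus>\<^bsub>L\<^esub> msum L (br X) (D Z Ys)"
proof -
  have "msum L (brace_len L (length Ys) X) (D Z Ys) = msum L (br X) (D Z Ys)"
    by (rule M.msum_cong) (simp add: list_brace_def length_alter_one)
  then show ?thesis by (simp add: list_brace_def)
qed

lemma right_mult_closed:
  assumes "Us \<in># D Z Ys" "set Ys \<subseteq> carrier L" "Z \<in> carrier L"
  shows "set Us \<subseteq> carrier L" "length Us = length Ys"
  using set_alter_one[OF assms(1,2)] length_alter_one[OF assms(1)] assms(3) by auto

text \<open>In the recursion the head enters as right factor of \<open>circ\<close> and as parameter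
  of \<open>D\<close>; any other argument enters through braces with one argument less, which the
  induction covers.\<close>

lemma list_brace_multilin: "X \<in> carrier L \<Longrightarrow> multilin R L L n (br X)"
proof (induction n)
  case 0
  then show ?case by (intro multilinI) auto
next
  case (Suc n)
  note IH = Suc.IH[OF Suc.prems]
  show ?case
  proof (rule multilinI)
    fix Ys assume Ys: "set Ys \<subseteq> carrier L" "length Ys = Suc n"
    then show "br X Ys \<in> carrier L"
      by (cases Ys) (auto simp: list_brace_Cons multilin_closed[OF IH])
  next
    fix xs ys assume xs: "set xs \<subseteq> carrier L" and ys: "set ys \<subseteq> carrier L"
      and len: "Suc (length xs + length ys) = Suc n"
    show "lin_map R L L (\<lambda>x. br X (xs @ x # ys))"
    proof (cases xs)
      case Nil
      have "lin_map R L L (\<lambda>x. circ L (br X ys) x \<ominus>\<^bsub>L\<^esub> msum L (br X) (D x ys))"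
        using ys len Nil
        by (intro lin_map_diff circ_lin_right multilin_closed[OF IH]
            msum_alter_one_lin[OF module_axioms module_axioms IH] module_axioms) auto
      then show ?thesis by (simp add: Nil list_brace_Cons)
    next
      case (Cons c us)
      have "lin_map R L L (\<lambda>x. circ L (br X (us @ x # ys)) c \<ominus>\<^bsub>L\<^esub> msum L (br X) (D c (us @ x # ys)))"
        using xs ys len Cons
        by (intro lin_map_diff lin_map_compose[OF multilin_lin[OF IH] circ_lin_left]
            msum_alter_one_slot_lin[OF module_axioms module_axioms IH] circ_lin_left) auto
      then show ?thesis by (simp add: Cons list_brace_Cons)
    qed
  qed
qed

lemma list_brace_closed [simp]: "X \<in> carrier L \<Longrightarrow> set Ys \<subseteq> carrier L \<Longrightarrow> br X Ys \<in> carrier L"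
  using multilin_closed[OF list_brace_multilin] by blast

lemma map2_list_brace_closed:
  assumes "set Ys \<subseteq> carrier L" "set Bs \<subseteq> lists (carrier L)"
  shows "set (map2 br Ys Bs) \<subseteq> carrier L"
proof -
  have "br Y B \<in> carrier L" if "(Y, B) \<in> set (zip Ys Bs)" for Y B
    using assms set_zip_leftD[OF that] set_zip_rightD[OF that] by (intro list_brace_closed) auto
  then show ?thesis by auto
qed

lemma list_brace_lin_left: "set Ys \<subseteq> carrier L \<Longrightarrow> lin_map R L L (\<lambda>X. br X Ys)"
proof (induction "length Ys" arbitrary: Ys)
  case 0
  then show ?case by (simp add: lin_map_id)
next
  case (Suc n)
  then obtain Z Zs where Ys: "Ys = Z # Zs" by (cases Ys) auto
  show ?case
    unfolding Ys list_brace_Cons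
    using Suc.prems Suc.hyps(2)
    by (intro lin_map_diff lin_map_compose[OF Suc.hyps(1) circ_lin_left] lin_map_msum module_axioms Suc.hyps(1))
      (auto simp: Ys dest: right_mult_closed)
qed

section \<open>Symmetry of the braces\<close>

lemma prelie_identity_add:
  assumes "X \<in> carrier L" "Y \<in> carrier L" "Z \<in> carrier L"
  shows "circ L X (circ L Y Z) \<oplus>\<^bsub>L\<^esub> circ L (circ L X Z) Y = circ L X (circ L Z Y) \<oplus>\<^bsub>L\<^esub> circ L (circ L X Y) Z"
  using prelie_identity[OF assms] assms by (simp add: M.minus_eq_minus_iff)

text \<open>Applying the recursion twice leaves three groups of terms, each symmetric in
  \<open>Z\<close> and \<open>W\<close>: multiplications of the outer brace, by the pre-Lie
  identity; mixed terms, visibly; and terms inside the arguments, by the pre-Lie identity on each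
  entry.\<close>

lemma list_brace_swap_head:
  assumes X: "X \<in> carrier L" and Z: "Z \<in> carrier L" and W: "W \<in> carrier L" and Ys: "set Ys \<subseteq> carrier L"
  shows "br X (Z # W # Ys) = br X (W # Z # Ys)"
proof -
  \<comment> \<open>Here \<open>p\<close> and \<open>q\<close> are the two halves of the associator
    of \<open>br X Ys\<close>. In \<open>a\<close> one element multiplies the brace and the other an
    argument; in \<open>A\<close> and \<open>DD\<close> both act inside the arguments, as a product
    or one after the other.\<close>
  define p where "p Z W = circ L (circ L (br X Ys) W) Z" for Z W
  define q where "q Z W = circ L (br X Ys) (circ L W Z)" for Z W
  define a where "a Z W = msum L (\<lambda>l. circ L (br X l) Z) (D W Ys)" for Z W
  define A where "A Z W = msum L (br X) (D (circ L W Z) Ys)" for Z W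
  define DD where "DD Z W = msum L (\<lambda>l. msum L (br X) (D W l)) (D Z Ys)" for Z W
  \<comment> \<open>This term does not occur in the expansion. It compensates for \<open>Z\<close>
    and \<open>W\<close> hitting the same entry, and is added to both sides and cancelled at the
    end.\<close>
  define c where "c Z W = msum L (br X) (alter_one (\<lambda>Y. {#circ L (circ L Y Z) W#}) Ys)" for Z W
  have closed: "p Z W \<in> carrier L" "q Z W \<in> carrier L" "a Z W \<in> carrier L" "A Z W \<in> carrier L"
      "DD Z W \<in> carrier L" "c Z W \<in> carrier L" if "Z \<in> carrier L" "W \<in> carrier L" for Z W
    using that X Ys by (simp_all add: p_def q_def a_def A_def DD_def c_def)
  have expand: "br X (Z # W # Ys) = (p Z W \<ominus>\<^bsub>L\<^esub> q Z W) \<oplus>\<^bsub>L\<^esub> (A Z W \<oplus>\<^bsub>L\<^esub> DD Z W) \<ominus>\<^bsub>L\<^esub> (a Z W \<oplus>\<^bsub>L\<^esub> a W Z)"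
    if ZW: "Z \<in> carrier L" "W \<in> carrier L" for Z W
  proof -
    have br_D: "br X l \<in> carrier L" if "l \<in># D V Ys" "V \<in> carrier L" for l V
      using right_mult_closed[OF that(1) Ys that(2)] X by simp
    have "circ L (br X (W # Ys)) Z = p Z W \<ominus>\<^bsub>L\<^esub> a Z W"
      using ZW X Ys br_D
      by (simp add: list_brace_Cons lin_map_minus[OF circ_lin_left module_axioms] p_def a_def
          lin_map_msum_apply[OF circ_lin_left module_axioms])
    moreover have "msum L (br X) (D Z (W # Ys)) = (q Z W \<ominus>\<^bsub>L\<^esub> A Z W) \<oplus>\<^bsub>L\<^esub> (a W Z \<ominus>\<^bsub>L\<^esub> DD Z W)"
    proof -
      have "msum L (\<lambda>l. br X (W # l)) (D Z Ys) = a W Z \<ominus>\<^bsub>L\<^esub> DD Z W"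
        unfolding list_brace_Cons a_def DD_def using ZW br_D by (intro M.msum_minus) auto
      moreover have "br X (circ L W Z # Ys) = q Z W \<ominus>\<^bsub>L\<^esub> A Z W"
        by (simp add: list_brace_Cons q_def A_def)
      moreover have "br X (circ L W Z # Ys) \<in> carrier L" using ZW X Ys by simp
      ultimately show ?thesis by (simp add: M.a_comm)
    qed
    ultimately have "br X (Z # W # Ys) =
        (p Z W \<ominus>\<^bsub>L\<^esub> a Z W) \<ominus>\<^bsub>L\<^esub> ((q Z W \<ominus>\<^bsub>L\<^esub> A Z W) \<oplus>\<^bsub>L\<^esub> (a W Z \<ominus>\<^bsub>L\<^esub> DD Z W))"
      by (subst list_brace_Cons) simp
    then show ?thesis
      using closed[OF ZW] closed[OF ZW(2,1)] by (simp add: M.minus_eq M.minus_add M.a_ac)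
  qed
  have "p Z W \<ominus>\<^bsub>L\<^esub> q Z W = p W Z \<ominus>\<^bsub>L\<^esub> q W Z"
    using prelie_identity_add[of "br X Ys" Z W] closed[OF Z W] closed[OF W Z] X Z W Ys
    by (simp add: M.minus_eq_minus_iff p_def q_def M.a_comm)
  moreover have "A Z W \<oplus>\<^bsub>L\<^esub> DD Z W = A W Z \<oplus>\<^bsub>L\<^esub> DD W Z"
  proof -
    have Ac: "A Z W \<oplus>\<^bsub>L\<^esub> c Z W =
        msum L (br X) (alter_one (\<lambda>Y. {#circ L Y (circ L W Z) \<oplus>\<^bsub>L\<^esub> circ L (circ L Y Z) W#}) Ys)"
      if "Z \<in> carrier L" "W \<in> carrier L" for Z W
      unfolding A_def c_def
      using that X Ys by (intro msum_alter_one_add[OF module_axioms module_axioms list_brace_multilin, symmetric]) auto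
    \<comment> \<open>Entry by entry, this is the pre-Lie identity in its subtraction-free
      form.\<close>
    have "alter_one (\<lambda>Y. {#circ L Y (circ L W Z) \<oplus>\<^bsub>L\<^esub> circ L (circ L Y Z) W#}) Ys =
        alter_one (\<lambda>Y. {#circ L Y (circ L Z W) \<oplus>\<^bsub>L\<^esub> circ L (circ L Y W) Z#}) Ys"
      using Ys prelie_identity_add[OF _ W Z] by (induction Ys) auto
    then have 1: "A Z W \<oplus>\<^bsub>L\<^esub> c Z W = A W Z \<oplus>\<^bsub>L\<^esub> c W Z"
      using Ac[OF Z W] Ac[OF W Z] by simp
    have "DD Z W \<oplus>\<^bsub>L\<^esub> c W Z = msum L (br X) ((\<Sum>l\<in>#D Z Ys. D W l) +
        alter_one (\<lambda>Y. \<Sum>U\<in>#{#circ L Y W#}. {#circ L U Z#}) Ys)" for Z W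
      by (simp add: DD_def c_def M.msum_bind)
    then have 2: "DD Z W \<oplus>\<^bsub>L\<^esub> c W Z = DD W Z \<oplus>\<^bsub>L\<^esub> c Z W"
      by (simp only: alter_one_commutator)
    \<comment> \<open>Neither \<open>A\<close> nor \<open>DD\<close> is symmetric alone:
      \<open>A\<close> needs \<open>c Z W\<close> and \<open>DD\<close> needs \<open>c W Z\<close>.
      Since both corrections occur in the total, which is symmetric, they cancel.\<close>
    have "(A Z W \<oplus>\<^bsub>L\<^esub> DD Z W) \<oplus>\<^bsub>L\<^esub> (c Z W \<oplus>\<^bsub>L\<^esub> c W Z) = (A Z W \<oplus>\<^bsub>L\<^esub> c Z W) \<oplus>\<^bsub>L\<^esub> (DD Z W \<oplus>\<^bsub>L\<^esub> c W Z)"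
      using closed[OF Z W] closed[OF W Z] by (simp add: M.a_ac)
    also have "\<dots> = (A W Z \<oplus>\<^bsub>L\<^esub> DD W Z) \<oplus>\<^bsub>L\<^esub> (c Z W \<oplus>\<^bsub>L\<^esub> c W Z)"
      unfolding 1 2 using closed[OF Z W] closed[OF W Z] by (simp add: M.a_ac)
    finally show ?thesis
      using closed[OF Z W] closed[OF W Z] by (subst (asm) M.add.right_cancel) auto
  qed
  moreover have "a Z W \<oplus>\<^bsub>L\<^esub> a W Z = a W Z \<oplus>\<^bsub>L\<^esub> a Z W"
    using closed[OF Z W] closed[OF W Z] by (simp add: M.a_comm)
  ultimately show ?thesis
    unfolding expand[OF Z W] expand[OF W Z] by simp
qed

text \<open>Below the head, both terms of the recursion are braces of lists shorter by one. The
  induction is on the length, with all entries general, because \<open>D c\<close> changes the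
  entries, including those being swapped.\<close>

lemma list_brace_swap:
  assumes "X \<in> carrier L" "set (xs @ a # b # ys) \<subseteq> carrier L"
  shows "br X (xs @ a # b # ys) = br X (xs @ b # a # ys)"
proof -
  have "br X (xs @ a # b # ys) = br X (xs @ b # a # ys)"
    if "set (xs @ a # b # ys) \<subseteq> carrier L" "length (xs @ a # b # ys) = n" for n xs a b ys
    using that
  proof (induction n arbitrary: xs a b ys)
    case (Suc n)
    show ?case
    proof (cases xs)
      case Nil
      then show ?thesis using Suc.prems assms(1) by (simp add: list_brace_swap_head)
    next
      case (Cons c us)
      have "msum L (br X) (D c (us @ a # b # ys)) = msum L (br X) (D c (us @ b # a # ys))"
        using Suc.prems Cons assms(1)
        by (intro M.msum_alter_one_swap[of "carrier L" n] Suc.IH) auto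
      moreover have "br X (us @ a # b # ys) = br X (us @ b # a # ys)"
        using Suc.prems Cons by (intro Suc.IH) auto
      ultimately show ?thesis by (simp add: Cons list_brace_Cons)
    qed
  qed simp
  then show ?thesis using assms(2) by blast
qed

lemma list_brace_mset_eq:
  assumes "X \<in> carrier L" "set xs \<subseteq> carrier L" "mset xs = mset ys"
  shows "br X xs = br X ys"
  by (rule swap_invariant_mset_eq[where F = "br X", OF _ assms(2) refl assms(3)]) (rule list_brace_swap[OF assms(1)])

text \<open>Sums the defining recursion of the inner braces \<open>Y\<^sub>i{B\<^sub>i}\<close> over the slot that receives \<open>Z\<close>.\<close>

lemma multilin_list_brace_alter_one:
  assumes Z: "Z \<in> carrier L"
    and "length Ys = length Bs" "multilin R L L (length Ys) G" "set Ys \<subseteq> carrier L" "set Bs \<subseteq> lists (carrier L)"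
  shows "msum L (\<lambda>Cs. G (map2 br Ys Cs)) (insert_one Z Bs) \<oplus>\<^bsub>L\<^esub>
      msum L (\<lambda>Cs. G (map2 br Ys Cs)) (alter_one (D Z) Bs) = msum L G (D Z (map2 br Ys Bs))"
  using assms(2-)
proof (induction Ys Bs arbitrary: G rule: list_induct2)
  case Nil
  show ?case by simp
next
  case (Cons Y Ys B Bs)
  let ?T = "map2 br Ys Bs"
  let ?H = "\<lambda>T. G (br Y B # T)"
  have sub: "Y \<in> carrier L" "set Ys \<subseteq> carrier L" "set B \<subseteq> carrier L" "set Bs \<subseteq> lists (carrier L)"
    using Cons.prems by auto
  have brY: "br Y B \<in> carrier L" using sub by simp
  have T: "set ?T \<subseteq> carrier L" "length ?T = length Ys"
    using sub Cons.hyps map2_list_brace_closed by auto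
  have g: "lin_map R L L (\<lambda>U. G (U # ?T))"
    using Cons.prems T by (intro multilin_head) auto
  have B': "br Y B' \<in> carrier L" if "B' \<in># D Z B" for B'
    using right_mult_closed[OF that sub(3) Z] sub(1) by simp
  \<comment> \<open>Linearity of \<open>G\<close> in the slot of \<open>Y\<close> gathers the
    altered inner braces into one sum; the recursion, solved for \<open>circ\<close>, turns it into
    \<open>circ L (br Y B) Z\<close>.\<close>
  have head: "G (br Y (Z # B) # ?T) \<oplus>\<^bsub>L\<^esub> msum L (\<lambda>B'. G (br Y B' # ?T)) (D Z B) = G (circ L (br Y B) Z # ?T)"
  proof -
    have "msum L (\<lambda>B'. G (br Y B' # ?T)) (D Z B) = G (msum L (br Y) (D Z B) # ?T)"
      using B' by (rule lin_map_msum_apply[OF g module_axioms, symmetric])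
    then have "G (br Y (Z # B) # ?T) \<oplus>\<^bsub>L\<^esub> msum L (\<lambda>B'. G (br Y B' # ?T)) (D Z B) =
        G ((br Y (Z # B) \<oplus>\<^bsub>L\<^esub> msum L (br Y) (D Z B)) # ?T)"
      using sub Z by (simp add: lin_map_plus[OF g])
    moreover have "br Y (Z # B) \<oplus>\<^bsub>L\<^esub> msum L (br Y) (D Z B) = circ L (br Y B) Z"
      using brY Z sub list_brace_Cons[of Y Z B]
      by (intro M.minus_eq_iff[THEN iffD1, symmetric]) auto
    ultimately show ?thesis by simp
  qed
  have IH: "msum L (\<lambda>Cs. ?H (map2 br Ys Cs)) (insert_one Z Bs) \<oplus>\<^bsub>L\<^esub>
      msum L (\<lambda>Cs. ?H (map2 br Ys Cs)) (alter_one (D Z) Bs) = msum L ?H (D Z ?T)"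
    using Cons.prems brY sub by (intro Cons.IH multilin_Cons) auto
  have closed: "G (br Y (Z # B) # ?T) \<in> carrier L" "G (circ L (br Y B) Z # ?T) \<in> carrier L"
    using sub Z by (auto intro!: lin_map_closed[OF g])
  have "msum L (\<lambda>Cs. G (map2 br (Y # Ys) Cs)) (insert_one Z (B # Bs)) \<oplus>\<^bsub>L\<^esub>
      msum L (\<lambda>Cs. G (map2 br (Y # Ys) Cs)) (alter_one (D Z) (B # Bs)) =
      (G (br Y (Z # B) # ?T) \<oplus>\<^bsub>L\<^esub> msum L (\<lambda>B'. G (br Y B' # ?T)) (D Z B)) \<oplus>\<^bsub>L\<^esub>
      (msum L (\<lambda>Cs. ?H (map2 br Ys Cs)) (insert_one Z Bs) \<oplus>\<^bsub>L\<^esub>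
       msum L (\<lambda>Cs. ?H (map2 br Ys Cs)) (alter_one (D Z) Bs))"
    using closed by (simp add: M.a_ac)
  also have "\<dots> = msum L G (D Z (map2 br (Y # Ys) (B # Bs)))"
    unfolding head IH using closed by simp
  finally show ?case .
qed

text \<open>Inductive step of the brace axiom for a single unshuffle. Multiplying the outer brace by
  \<open>Z\<close> is expanded by the recursion; the alterations of an inner brace
  \<open>br Y B\<close> are then traded for \<open>Z\<close> inserted into \<open>B\<close> or
  multiplied into a factor of \<open>B\<close>.\<close>

lemma list_brace_unshuffle_step:
  assumes X: "X \<in> carrier L" and Ys: "set Ys \<subseteq> carrier L" and Z: "Z \<in> carrier L"
    and Ls: "set Ls \<subseteq> lists (carrier L)" "length Ls = Suc (length Ys)"
  defines "\<Phi> \<equiv> \<lambda>Ls. br X (map2 br Ys (butlast Ls) @ last Ls)"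
  shows "msum L \<Phi> (insert_one Z Ls) \<oplus>\<^bsub>L\<^esub> msum L \<Phi> (alter_one (D Z) Ls) = circ L (\<Phi> Ls) Z"
proof -
  obtain Bs C where BC: "Ls = Bs @ [C]" "length Bs = length Ys"
    using Ls(2) by (cases Ls rule: rev_cases) auto
  let ?T = "map2 br Ys Bs"
  \<comment> \<open>In \<open>i\<close> the element \<open>Z\<close> is inserted into an inner slot,
    in \<open>j\<close> it multiplies a factor of an inner slot, in \<open>k\<close> a factor of the
    last slot.\<close>
  define i where "i = msum L (\<lambda>Cs. br X (map2 br Ys Cs @ C)) (insert_one Z Bs)"
  define j where "j = msum L (\<lambda>Cs. br X (map2 br Ys Cs @ C)) (alter_one (D Z) Bs)"
  define k where "k = msum L (\<lambda>C'. br X (?T @ C')) (D Z C)"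
  have sub: "set C \<subseteq> carrier L" "set Bs \<subseteq> lists (carrier L)" using Ls BC by auto
  have T: "set ?T \<subseteq> carrier L"
    using sub Ys by (intro map2_list_brace_closed)
  have closed: "i \<in> carrier L" "j \<in> carrier L" "k \<in> carrier L" "circ L (br X (?T @ C)) Z \<in> carrier L"
      "br X (?T @ Z # C) \<in> carrier L"
    using X T sub Z by (auto simp: i_def j_def k_def)
  have "multilin R L L (length Ys) (\<lambda>T. br X (T @ C))"
  proof (rule multilinI)
    fix xs ys assume "set xs \<subseteq> carrier L" "set ys \<subseteq> carrier L"
    then show "lin_map R L L (\<lambda>x. br X ((xs @ x # ys) @ C))"
      using multilin_lin[OF list_brace_multilin[OF X], of xs "ys @ C"] sub by simp
  qed (use X sub in auto)
  then have ij: "i \<oplus>\<^bsub>L\<^esub> j = msum L (\<lambda>T. br X (T @ C)) (D Z ?T)"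
    unfolding i_def j_def using Z Ys sub BC by (intro multilin_list_brace_alter_one) auto
  \<comment> \<open>Insertion into the last slot puts \<open>Z\<close> behind the inner braces;
    symmetry brings it to the front, where the recursion applies.\<close>
  have "br X (?T @ Z # C) = br X (Z # ?T @ C)"
    using X Z T sub by (intro list_brace_mset_eq) auto
  also have "\<dots> = circ L (br X (?T @ C)) Z \<ominus>\<^bsub>L\<^esub> (i \<oplus>\<^bsub>L\<^esub> j \<oplus>\<^bsub>L\<^esub> k)"
    by (simp add: list_brace_Cons alter_one_append ij k_def)
  finally have e: "br X (?T @ Z # C) \<oplus>\<^bsub>L\<^esub> (i \<oplus>\<^bsub>L\<^esub> j \<oplus>\<^bsub>L\<^esub> k) = circ L (br X (?T @ C)) Z"
    using closed by (intro M.minus_eq_iff[THEN iffD1, symmetric]) auto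
  have insert: "msum L \<Phi> (insert_one Z Ls) = i \<oplus>\<^bsub>L\<^esub> br X (?T @ Z # C)"
    using closed by (simp add: BC alter_one_append \<Phi>_def i_def M.r_zero M.a_comm)
  have alter: "msum L \<Phi> (alter_one (D Z) Ls) = j \<oplus>\<^bsub>L\<^esub> k"
    by (simp add: BC alter_one_append \<Phi>_def j_def k_def image_mset.compositionality comp_def)
  have "(i \<oplus>\<^bsub>L\<^esub> br X (?T @ Z # C)) \<oplus>\<^bsub>L\<^esub> (j \<oplus>\<^bsub>L\<^esub> k) =
      br X (?T @ Z # C) \<oplus>\<^bsub>L\<^esub> (i \<oplus>\<^bsub>L\<^esub> j \<oplus>\<^bsub>L\<^esub> k)"
    using closed by (simp add: M.a_ac)
  then show ?thesis
    unfolding insert alter e by (simp add: \<Phi>_def BC)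
qed

text \<open>The recursion is used for the outer list \<open>Zs\<close>. Its product term yields
  insertions of \<open>Z\<close> into unshuffles plus derivations of the slots; its correction term
  cancels the latter, because derivations are coderivations.\<close>

theorem list_brace_list_brace:
  assumes X: "X \<in> carrier L" and Ys: "set Ys \<subseteq> carrier L" and Zs: "set Zs \<subseteq> carrier L"
  shows "br (br X Ys) Zs =
    msum L (\<lambda>Ls. br X (map2 br Ys (butlast Ls) @ last Ls)) (unshuffles (Suc (length Ys)) Zs)"
  using Zs
proof (induction "length Zs" arbitrary: Zs)
  case 0
  \<comment> \<open>The empty product has a single unshuffle, with all slots empty, and an inner
    brace without arguments returns \<open>Y\<close> itself.\<close>
  have "map2 br Ys (replicate (length Ys) []) = Ys"
    by (induction Ys) auto
  moreover have "replicate (Suc (length Ys)) [] = replicate (length Ys) [] @ [[] :: 'v list]"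
    by (simp add: replicate_append_same)
  ultimately show ?case
    using 0 X Ys by (simp add: M.r_zero del: replicate.simps)
next
  case (Suc m)
  then obtain Z Zs' where ZZ: "Zs = Z # Zs'" by (cases Zs) auto
  have Z: "Z \<in> carrier L" "set Zs' \<subseteq> carrier L" using Suc.prems ZZ by auto
  let ?\<Phi> = "\<lambda>Ls. br X (map2 br Ys (butlast Ls) @ last Ls)"
  let ?U = "unshuffles (Suc (length Ys))"
  have Ls: "set Ls \<subseteq> lists (carrier L)" "length Ls = Suc (length Ys)" if "Ls \<in># ?U Zs'" for Ls
    using set_unshuffles[OF that Z(2)] length_unshuffles[OF that] by auto
  have \<Phi>_closed: "?\<Phi> Ls \<in> carrier L" if Ls_in: "Ls \<in># ?U Zs'" for Ls
  proof -
    obtain Bs C where "Ls = Bs @ [C]" using Ls(2)[OF Ls_in] by (cases Ls rule: rev_cases) auto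
    then show ?thesis
      using Ls(1)[OF Ls_in] X Ys map2_list_brace_closed[OF Ys, of Bs] by (intro list_brace_closed) auto
  qed
  \<comment> \<open>Altered lists keep the length \<open>m\<close>, so the induction hypothesis
    covers them; \<open>unshuffles_alter_one\<close> then moves the alteration from the list into
    the slots.\<close>
  have "msum L (br (br X Ys)) (D Z Zs') = msum L (\<lambda>l. msum L ?\<Phi> (?U l)) (D Z Zs')"
    using right_mult_closed[OF _ Z(2,1)] Suc.hyps(2) ZZ by (intro M.msum_cong Suc.hyps(1)) auto
  also have "\<dots> = msum L ?\<Phi> (\<Sum>l\<in>#D Z Zs'. ?U l)" by (simp only: M.msum_bind)
  also have "\<dots> = msum L (\<lambda>Ls. msum L ?\<Phi> (alter_one (D Z) Ls)) (?U Zs')"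
    by (simp only: unshuffles_alter_one M.msum_bind)
  finally have alter: "msum L (br (br X Ys)) (D Z Zs') = \<dots>" .
  have "circ L (br (br X Ys) Zs') Z = circ L (msum L ?\<Phi> (?U Zs')) Z"
    using Suc.hyps ZZ Z by simp
  also have "\<dots> = msum L (\<lambda>Ls. circ L (?\<Phi> Ls) Z) (?U Zs')"
    using \<Phi>_closed by (rule lin_map_msum_apply[OF circ_lin_left[OF Z(1)] module_axioms])
  also have "\<dots> = msum L (\<lambda>Ls. msum L ?\<Phi> (insert_one Z Ls) \<oplus>\<^bsub>L\<^esub> msum L ?\<Phi> (alter_one (D Z) Ls)) (?U Zs')"
    using Ls by (intro M.msum_cong list_brace_unshuffle_step[OF X Ys Z(1), symmetric])
  also have "\<dots> = msum L ?\<Phi> (?U (Z # Zs')) \<oplus>\<^bsub>L\<^esub> msum L (br (br X Ys)) (D Z Zs')"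
    unfolding alter unshuffles.simps M.msum_bind by (rule M.msum_add) auto
  finally have eq: "circ L (br (br X Ys) Zs') Z = \<dots>" .
  have closed: "circ L (br (br X Ys) Zs') Z \<in> carrier L" using X Ys Z by simp
  have "br (br X Ys) (Z # Zs') = circ L (br (br X Ys) Zs') Z \<ominus>\<^bsub>L\<^esub> msum L (br (br X Ys)) (D Z Zs')"
    by (rule list_brace_Cons)
  also have "\<dots> = msum L ?\<Phi> (?U (Z # Zs'))"
    by (rule M.minus_eq_iff[THEN iffD2, OF closed M.msum_closed M.msum_closed eq])
  finally show ?case unfolding ZZ .
qed

text \<open>Isolates what a given symmetric brace algebra must satisfy for its braces to be
  recovered from its pre-Lie product: the unit law and the recursion.\<close>

lemma list_brace_unique:
  assumes "\<And>X. X \<in> carrier L \<Longrightarrow> B X [] = X"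
    and "\<And>X Z Ys. X \<in> carrier L \<Longrightarrow> Z \<in> carrier L \<Longrightarrow> set Ys \<subseteq> carrier L \<Longrightarrow>
      B X (Z # Ys) = circ L (B X Ys) Z \<ominus>\<^bsub>L\<^esub> msum L (B X) (D Z Ys)"
    and "X \<in> carrier L" "set Ys \<subseteq> carrier L"
  shows "B X Ys = br X Ys"
  using assms(4)
proof (induction "length Ys" arbitrary: Ys)
  case 0
  then show ?case using assms(1,3) by simp
next
  case (Suc n)
  then obtain Z Zs where Ys: "Ys = Z # Zs" by (cases Ys) auto
  have "msum L (B X) (D Z Zs) = msum L (br X) (D Z Zs)"
    using Suc.prems Suc.hyps(2) by (intro M.msum_cong Suc.hyps(1)) (auto simp: Ys dest: right_mult_closed)
  then show ?case using Suc assms(2,3) by (simp add: Ys list_brace_Cons)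
qed

end

text \<open>A map compatible with \<open>circ\<close> intertwines the derivations \<open>D\<close>,
  and the recursion involves nothing else but linear operations.\<close>

lemma list_brace_hom:
  assumes "prelie_algebra R L" "prelie_algebra R L'" "f \<in> prelie_homs R L L'"
    and X: "X \<in> carrier L" and "set Ys \<subseteq> carrier L"
  shows "f (list_brace L X Ys) = list_brace L' (f X) (map f Ys)"
proof -
  interpret L: prelie_algebra R L by fact
  interpret L': prelie_algebra R L' by fact
  have f: "lin_map R L L' f" and f_circ: "f (circ L X Y) = circ L' (f X) (f Y)"
    if "X \<in> carrier L" "Y \<in> carrier L" for X Y
    using assms(3) that by (auto simp: prelie_homs_def linear_maps_lin)
  have fD: "L'.D (f Z) (map f Zs) = image_mset (map f) (L.D Z Zs)"
    if "Z \<in> carrier L" "set Zs \<subseteq> carrier L" for Z Zs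
    using that by (induction Zs) (auto simp: f_circ image_mset.compositionality comp_def)
  show ?thesis
    using assms(5)
  proof (induction "length Ys" arbitrary: Ys)
    case 0
    then show ?case by simp
  next
    case (Suc n)
    then obtain Z Zs where Ys: "Ys = Z # Zs" by (cases Ys) auto
    have Z: "Z \<in> carrier L" "set Zs \<subseteq> carrier L" using Suc.prems Ys by auto
    have "f (msum L (list_brace L X) (L.D Z Zs)) = msum L' (\<lambda>l. f (list_brace L X l)) (L.D Z Zs)"
      using X Z L.right_mult_closed[OF _ Z(2,1)] by (intro L.lin_map_msum_apply[OF f L'.module_axioms]) auto
    also have "\<dots> = msum L' (\<lambda>l. list_brace L' (f X) (map f l)) (L.D Z Zs)"
      using Suc.hyps(2) Ys L.right_mult_closed[OF _ Z(2,1)] by (intro L'.M.msum_cong Suc.hyps(1)) auto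
    finally have "f (msum L (list_brace L X) (L.D Z Zs)) = msum L' (list_brace L' (f X)) (L'.D (f Z) (map f Zs))"
      using Z by (simp add: fD)
    moreover have "f (list_brace L X Zs) = list_brace L' (f X) (map f Zs)"
      using Suc.hyps Ys Z by simp
    ultimately show ?case
      using X Z by (simp add: Ys L.list_brace_Cons L'.list_brace_Cons L.lin_map_minus[OF f L'.module_axioms] f_circ)
  qed
qed

section \<open>The two functors\<close>

lemma alter_one_cong: "(\<And>y. y \<in> set ys \<Longrightarrow> \<phi> y = \<psi> y) \<Longrightarrow> alter_one \<phi> ys = alter_one \<psi> ys"
  by (induction ys) auto

text \<open>Brace and pre-Lie algebras extend modules by different fields, so having the same
  underlying module cannot be an equation between the records. The ring fields are compared too
  because \<open>proper_module\<close> prescribes their values.\<close>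

definition same_module :: "('k, 'v, 's) module_scheme \<Rightarrow> ('k, 'v, 't) module_scheme \<Rightarrow> bool" where
  "same_module M N \<longleftrightarrow> carrier N = carrier M \<and> monoid.mult N = monoid.mult M \<and> \<one>\<^bsub>N\<^esub> = \<one>\<^bsub>M\<^esub> \<and>
    \<zero>\<^bsub>N\<^esub> = \<zero>\<^bsub>M\<^esub> \<and> ring.add N = ring.add M \<and> smult N = smult M"

lemma same_moduleD:
  assumes "same_module M N"
  shows "carrier N = carrier M" "ring.add N = ring.add M" "\<zero>\<^bsub>N\<^esub> = \<zero>\<^bsub>M\<^esub>" "smult N = smult M"
    "monoid.mult N = monoid.mult M" "\<one>\<^bsub>N\<^esub> = \<one>\<^bsub>M\<^esub>"
  using assms by (simp_all add: same_module_def)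

lemma same_module_module:
  assumes same: "same_module M N" and M: "module R M"
  shows "module R N"
proof -
  interpret M: module R M by fact
  note eqs = same_moduleD[OF same]
  show ?thesis
  proof (rule moduleI)
    show "abelian_group N"
      by (rule abelian_groupI) (auto simp: eqs M.M.a_ac intro: M.M.l_neg)
  qed (auto simp: eqs M.R.is_cring M.smult_l_distr M.smult_r_distr M.smult_assoc1)
qed

lemma same_module_proper: "same_module M N \<Longrightarrow> proper_module R M \<Longrightarrow> proper_module R N"
  using same_module_module[of M N R] by (auto simp: proper_module_def same_moduleD)

lemma same_module_linear_maps:
  "same_module M N \<Longrightarrow> same_module M' N' \<Longrightarrow> linear_maps R N N' = linear_maps R M M'"
  by (simp add: linear_maps_def same_moduleD)

lemma
  assumes same: "same_module M N"
  shows same_module_sym_algebra: "sym_algebra R N = sym_algebra R M"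
    and same_module_sym_incl: "sym_incl R N = sym_incl R M"
    and same_module_sym_prod: "sym_prod R N = sym_prod R M"
    and same_module_iterated_coproduct: "iterated_coproduct R N n = iterated_coproduct R M n"
    and same_module_tensor_lift: "tensor_lift R A n N = tensor_lift R A n M"
    and same_module_minus: "x \<ominus>\<^bsub>N\<^esub> y = x \<ominus>\<^bsub>M\<^esub> y"
    and same_module_msum: "msum N = msum M"
proof -
  note eqs = same_moduleD[OF same]
  have ideal: "sym_ideal R N = sym_ideal R M" by (simp add: sym_ideal_def eqs)
  show alg: "sym_algebra R N = sym_algebra R M" by (simp add: sym_algebra_def eqs ideal)
  show incl: "sym_incl R N = sym_incl R M" by (simp add: sym_incl_def eqs ideal fun_eq_iff)
  show "sym_prod R N = sym_prod R M" by (simp add: sym_prod_def alg incl fun_eq_iff)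
  have coproduct: "sym_coproduct R N = sym_coproduct R M"
    by (simp add: sym_coproduct_def alg incl eqs)
  have first: "coproduct_first R N n = coproduct_first R M n" for n
    by (simp add: coproduct_first_def alg coproduct)
  show "iterated_coproduct R N n = iterated_coproduct R M n"
    by (induction n) (simp_all add: fun_eq_iff alg first)
  have "linear_maps R (tensor_power R A n) N = linear_maps R (tensor_power R A n) M"
    by (simp add: linear_maps_def eqs)
  then show "tensor_lift R A n N = tensor_lift R A n M"
    by (simp add: tensor_lift_def fun_eq_iff)
  show "x \<ominus>\<^bsub>N\<^esub> y = x \<ominus>\<^bsub>M\<^esub> y" by (simp add: a_minus_def a_inv_def m_inv_def eqs)
  show "msum N = msum M" by (simp add: msum_def eqs fun_eq_iff cong: if_cong)
qed

section \<open>The right-hand side of the brace axiom on lists\<close>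

context module
begin

lemma sym_prod_multilin: "multilin R M Sym n (sym_prod R M)"
proof (rule multilinI)
  fix xs ys assume "set xs \<subseteq> carrier M" "set ys \<subseteq> carrier M"
  moreover have "lin_map R M Sym (\<lambda>x. sym_prod R M xs \<otimes>\<^bsub>Sym\<^esub> (sym_incl R M x \<otimes>\<^bsub>Sym\<^esub> sym_prod R M ys))"
    using calculation
    by (intro lin_map_compose[OF lin_map_compose[OF sym_incl_lin
        algebra.lin_map_mult_right[OF sym_algebra_algebra]] algebra.lin_map_mult_left[OF sym_algebra_algebra]]) auto
  ultimately show "lin_map R M Sym (\<lambda>x. sym_prod R M (xs @ x # ys))"
    by (subst lin_map_cong[OF module_axioms]) (auto simp: sym_prod_append sym_prod_Cons)
qed simp

lemma map2_lin_closed: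
  assumes b: "\<And>Y. Y \<in> carrier M \<Longrightarrow> lin_map R Sym M (b Y)"
    and Ys: "set Ys \<subseteq> carrier M" and Bs: "set Bs \<subseteq> carrier Sym"
  shows "set (map2 b Ys Bs) \<subseteq> carrier M"
proof -
  have "b Y B \<in> carrier M" if "(Y, B) \<in> set (zip Ys Bs)" for Y B
    using Ys Bs set_zip_leftD[OF that] set_zip_rightD[OF that] by (intro lin_map_closed[OF b]) auto
  then show ?thesis by auto
qed

text \<open>Needed before the brace axiom can be evaluated at all: \<open>tensor_lift\<close> is a
  definite description, and its existence result is for multilinear functions. The varying slot is
  either the last one, a factor in S(V), or the argument of an inner brace.\<close>

lemma brace_composite_multilin:
  assumes b: "\<And>Y. Y \<in> carrier M \<Longrightarrow> lin_map R Sym M (b Y)"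
    and X: "X \<in> carrier M" and Ys: "set Ys \<subseteq> carrier M"
  shows "multilin R Sym M (Suc (length Ys))
    (\<lambda>Bs. b X (sym_prod R M (map2 b Ys (butlast Bs)) \<otimes>\<^bsub>Sym\<^esub> last Bs))"
proof -
  interpret S: algebra R Sym by (rule sym_algebra_algebra)
  note cr = cring.cring_simprules[OF S.M_cring]
  show ?thesis
  proof (rule multilinI)
    fix Bs assume "set Bs \<subseteq> carrier Sym" "length Bs = Suc (length Ys)"
    moreover obtain Cs C where "Bs = Cs @ [C]" using calculation(2) by (cases Bs rule: rev_cases) auto
    moreover have "set (map2 b Ys Cs) \<subseteq> carrier M"
      by (rule map2_lin_closed[OF b Ys]) (use calculation in auto)
    ultimately show "b X (sym_prod R M (map2 b Ys (butlast Bs)) \<otimes>\<^bsub>Sym\<^esub> last Bs) \<in> carrier M"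
      by (auto intro!: lin_map_closed[OF b[OF X]] cr(5) sym_prod_closed simp del: set_map)
  next
    fix xs ys assume xs: "set xs \<subseteq> carrier Sym" and ys: "set ys \<subseteq> carrier Sym"
      and len: "Suc (length xs + length ys) = Suc (length Ys)"
    show "lin_map R Sym M (\<lambda>x. b X (sym_prod R M (map2 b Ys (butlast (xs @ x # ys))) \<otimes>\<^bsub>Sym\<^esub> last (xs @ x # ys)))"
    proof (cases ys rule: rev_cases)
      case Nil
      have "lin_map R Sym M (\<lambda>x. b X (sym_prod R M (map2 b Ys xs) \<otimes>\<^bsub>Sym\<^esub> x))"
        by (rule lin_map_compose[OF S.lin_map_mult_left b[OF X]])
          (rule sym_prod_closed[OF map2_lin_closed[OF b Ys xs]])
      then show ?thesis by (simp add: Nil)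
    next
      case (snoc us C)
      \<comment> \<open>The varying slot feeds the inner brace of the argument at position
        \<open>length xs\<close>, which is one factor of a product and therefore enters
        linearly.\<close>
      have split: "Ys = take (length xs) Ys @ (Ys ! length xs) # drop (Suc (length xs)) Ys"
        using len snoc by (simp add: id_take_nth_drop)
      obtain Y1 Y Y2 where Ys_eq: "Ys = Y1 @ Y # Y2" "length Y1 = length xs"
        using split len snoc by (metis length_take min.absorb2 le_add1 length_append add_Suc_right diff_Suc_Suc
            diff_zero length_Cons)
      have sub: "set Y1 \<subseteq> carrier M" "Y \<in> carrier M" "set Y2 \<subseteq> carrier M" "C \<in> carrier Sym" "set us \<subseteq> carrier Sym"
        using Ys ys by (auto simp: Ys_eq snoc)
      have "lin_map R Sym M (\<lambda>x. b X (sym_prod R M (map2 b Y1 xs @ b Y x # map2 b Y2 us) \<otimes>\<^bsub>Sym\<^esub> C))"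
        by (rule lin_map_compose[OF lin_map_compose[OF lin_map_compose[OF b[OF sub(2)]
            multilin_lin[OF sym_prod_multilin map2_lin_closed[OF b sub(1) xs] map2_lin_closed[OF b sub(3,5)] refl]]
            S.lin_map_mult_right[OF sub(4)]] b[OF X]])
      then show ?thesis
        using Ys_eq by (simp add: snoc butlast_append)
    qed
  qed
qed

text \<open>Stated for an arbitrary family \<open>b\<close> of linear maps, since it serves in both
  directions: to unfold the axiom for a given brace and to verify it for the constructed
  one.\<close>

lemma brace_composite_eval:
  assumes b: "\<And>Y. Y \<in> carrier M \<Longrightarrow> lin_map R Sym M (b Y)"
    and X: "X \<in> carrier M" and Ys: "set Ys \<subseteq> carrier M" and Zs: "set Zs \<subseteq> carrier M"
  shows "tensor_lift R Sym (Suc (length Ys)) M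
      (\<lambda>Bs. b X (sym_prod R M (map2 b Ys (butlast Bs)) \<otimes>\<^bsub>Sym\<^esub> last Bs))
      (iterated_coproduct R M (length Ys) (sym_prod R M Zs)) =
    msum M (\<lambda>Ls. b X (sym_prod R M (map2 (\<lambda>Y L. b Y (sym_prod R M L)) Ys (butlast Ls) @ last Ls)))
      (unshuffles (Suc (length Ys)) Zs)"
    (is "?lhs = _")
proof -
  let ?F = "\<lambda>Bs. b X (sym_prod R M (map2 b Ys (butlast Bs)) \<otimes>\<^bsub>Sym\<^esub> last Bs)"
  have "multilin R Sym M (Suc (length Ys)) ?F"
    using b X Ys by (rule brace_composite_multilin)
  from tensor_lift_iterated_coproduct[OF module_axioms this Zs]
  have "?lhs = msum M (\<lambda>Ls. ?F (map (sym_prod R M) Ls)) (unshuffles (Suc (length Ys)) Zs)" .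
  also have "\<dots> = msum M (\<lambda>Ls. b X (sym_prod R M (map2 (\<lambda>Y L. b Y (sym_prod R M L)) Ys (butlast Ls) @ last Ls)))
      (unshuffles (Suc (length Ys)) Zs)"
  proof (rule M.msum_cong)
    fix Ls assume Ls: "Ls \<in># unshuffles (Suc (length Ys)) Zs"
    obtain Bs C where BC: "Ls = Bs @ [C]"
      using length_unshuffles[OF Ls] by (cases Ls rule: rev_cases) auto
    have sub: "set Bs \<subseteq> lists (carrier M)" "set C \<subseteq> carrier M"
      using set_unshuffles[OF Ls Zs] by (auto simp: BC)
    have "map2 b Ys (map (sym_prod R M) Bs) = map2 (\<lambda>Y L. b Y (sym_prod R M L)) Ys Bs"
      by (simp add: zip_map2 case_prod_unfold)
    moreover have "set (map2 b Ys (map (sym_prod R M) Bs)) \<subseteq> carrier M"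
      by (rule map2_lin_closed[OF b Ys map_sym_prod_closed[OF sub(1)]])
    ultimately show "b X (sym_prod R M (map2 b Ys (butlast (map (sym_prod R M) Ls))) \<otimes>\<^bsub>Sym\<^esub>
          last (map (sym_prod R M) Ls)) =
        b X (sym_prod R M (map2 (\<lambda>Y L. b Y (sym_prod R M L)) Ys (butlast Ls) @ last Ls))"
      using sub(2) by (simp add: BC sym_prod_append)
  qed
  finally show ?thesis .
qed

end

text \<open>The product is restricted to the carrier because \<open>bilinear_maps\<close> consists
  of extensional functions and objects are compared as records.\<close>

definition prelie_of_brace :: "('k, 'r) ring_scheme \<Rightarrow> ('k, 'v) brace_alg \<Rightarrow> ('k, 'v) prelie_alg" where
  "prelie_of_brace R V = \<lparr>carrier = carrier V, monoid.mult = monoid.mult V, one = \<one>\<^bsub>V\<^esub>, zero = \<zero>\<^bsub>V\<^esub>,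
    add = ring.add V, smult = smult V,
    circ = (\<lambda>X\<in>carrier V. \<lambda>Y\<in>carrier V. brace V X (sym_incl R V Y))\<rparr>"

text \<open>Existence in the description is symmetry and multilinearity of
  \<open>list_brace\<close>; uniqueness holds since products span S(L) and members of
  \<open>linear_maps\<close> are extensional.\<close>

definition brace_of_prelie :: "('k, 'r) ring_scheme \<Rightarrow> ('k, 'v) prelie_alg \<Rightarrow> ('k, 'v) brace_alg" where
  "brace_of_prelie R L = \<lparr>carrier = carrier L, monoid.mult = monoid.mult L, one = \<one>\<^bsub>L\<^esub>, zero = \<zero>\<^bsub>L\<^esub>,
    add = ring.add L, smult = smult L,
    brace = (\<lambda>X\<in>carrier L. THE h. h \<in> linear_maps R (sym_algebra R L) L \<and>
      (\<forall>Ys. set Ys \<subseteq> carrier L \<longrightarrow> h (sym_prod R L Ys) = list_brace L X Ys))\<rparr>"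

lemma same_module_prelie_of_brace: "same_module V (prelie_of_brace R V)"
  by (simp add: same_module_def prelie_of_brace_def)

lemma same_module_brace_of_prelie: "same_module L (brace_of_prelie R L)"
  by (simp add: same_module_def brace_of_prelie_def)

section \<open>From symmetric brace algebras to pre-Lie algebras\<close>

context symmetric_brace_algebra
begin

sublocale module R V
  using proper_module by (simp add: proper_module_def)

abbreviation B where "B X Ys \<equiv> brace V X (sym_prod R V Ys)"

lemma brace_linear: "X \<in> carrier V \<Longrightarrow> brace V X \<in> linear_maps R Sym V"
  using brace_bilinear by (auto simp: bilinear_maps_def)

lemma brace_lin: "X \<in> carrier V \<Longrightarrow> lin_map R Sym V (brace V X)"
  by (rule linear_maps_lin[OF brace_linear])

lemma brace_lin_left:
  assumes "A \<in> carrier Sym"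
  shows "lin_map R V V (\<lambda>X. brace V X A)"
proof -
  have "lin_map R V V (\<lambda>X\<in>carrier V. brace V X A)"
    using brace_bilinear assms by (auto simp: bilinear_maps_def linear_maps_iff)
  then show ?thesis by (subst lin_map_cong[OF module_axioms]) auto
qed

lemma brace_list_closed [simp]: "X \<in> carrier V \<Longrightarrow> set Ys \<subseteq> carrier V \<Longrightarrow> B X Ys \<in> carrier V"
  by (rule lin_map_closed[OF brace_lin]) auto

lemma brace_list_Nil [simp]: "X \<in> carrier V \<Longrightarrow> brace V X \<one>\<^bsub>Sym\<^esub> = X"
  by (rule brace_one)

lemma brace_list_brace_list:
  assumes "X \<in> carrier V" "set Ys \<subseteq> carrier V" "set Zs \<subseteq> carrier V"
  shows "B (B X Ys) Zs = msum V (\<lambda>Ls. B X (map2 B Ys (butlast Ls) @ last Ls)) (unshuffles (Suc (length Ys)) Zs)"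
  using brace_brace[OF assms(1,2) sym_prod_closed[OF assms(3)]]
    brace_composite_eval[OF brace_lin assms] by simp

text \<open>A single \<open>Z\<close> goes to exactly one slot, and the empty slots contribute Y{1}
  = Y. The last slot gives a brace with \<open>Z\<close> as an extra argument, the others give Y{Z}
  in place of Y.\<close>

lemma brace_list_brace_single:
  assumes X: "X \<in> carrier V" and Ys: "set Ys \<subseteq> carrier V" and Z: "Z \<in> carrier V"
  shows "B (B X Ys) [Z] = B X (Z # Ys) \<oplus>\<^bsub>V\<^esub> msum V (B X) (alter_one (\<lambda>Y. {#B Y [Z]#}) Ys)"
proof -
  let ?nils = "replicate (length Ys) ([] :: 'v list)"
  have nils: "map2 B Ys (replicate (length Ys) []) = Ys" if "set Ys \<subseteq> carrier V" for Ys
    using that by (induction Ys) auto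
  \<comment> \<open>Applying the inner braces to all distributions of \<open>Z\<close> over empty
    slots multiplies one entry of \<open>Ys\<close> by \<open>Z\<close>, which is the derivation of
    \<open>Ys\<close>.\<close>
  have map2: "image_mset (map2 B Ys) (insert_one Z ?nils) = alter_one (\<lambda>Y. {#B Y [Z]#}) Ys"
    using Ys
  proof (induction Ys)
    case (Cons Y Ys)
    have "image_mset (\<lambda>Bs. Y # map2 B Ys Bs) (insert_one Z (replicate (length Ys) [])) =
        image_mset ((#) Y) (image_mset (map2 B Ys) (insert_one Z (replicate (length Ys) [])))"
      by (simp add: image_mset.compositionality comp_def)
    also have "\<dots> = image_mset ((#) Y) (alter_one (\<lambda>Y. {#B Y [Z]#}) Ys)"
      using Cons by simp
    finally show ?case
      using Cons by (simp add: image_mset.compositionality comp_def nils)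
  qed simp
  have snoc: "replicate (Suc (length Ys)) ([] :: 'v list) = ?nils @ [[]]"
    by (simp add: replicate_append_same)
  have "B X (Ys @ [Z]) = B X (Z # Ys)"
    using X Ys Z sym_prod_mset_eq[of "Ys @ [Z]" "Z # Ys"] by simp
  moreover have "B X (Z # Ys) \<in> carrier V" using X Ys Z by simp
  moreover have "msum V (\<lambda>Bs. B X (map2 B Ys Bs)) (insert_one Z ?nils) = msum V (B X) (alter_one (\<lambda>Y. {#B Y [Z]#}) Ys)"
    unfolding map2[symmetric] M.msum_image ..
  ultimately show ?thesis
    using X Ys Z
    by (simp add: brace_list_brace_list snoc alter_one_append nils M.r_zero M.a_comm del: replicate.simps)
qed

abbreviation L where "L \<equiv> prelie_of_brace R V"

lemma circ_prelie_of_brace: "X \<in> carrier V \<Longrightarrow> Y \<in> carrier V \<Longrightarrow> circ L X Y = B X [Y]"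
  by (simp add: prelie_of_brace_def sym_prod_single)

lemma prelie_algebra_prelie_of_brace: "prelie_algebra R L"
proof
  note same = same_module_prelie_of_brace[of V R]
  note eqs = same_moduleD[OF same]
  show "proper_module R L" by (rule same_module_proper[OF same proper_module])
  have lin_right: "circ L X \<in> linear_maps R V V" if X: "X \<in> carrier V" for X
  proof -
    have "circ L X = (\<lambda>Y\<in>carrier V. brace V X (sym_incl R V Y))" using X by (simp add: prelie_of_brace_def)
    then show ?thesis
      using restrict_linear_maps[OF module_axioms lin_map_compose[OF sym_incl_lin brace_lin[OF X]]] by simp
  qed
  have lin_left: "(\<lambda>X\<in>carrier V. circ L X Y) \<in> linear_maps R V V" if Y: "Y \<in> carrier V" for Y
  proof -
    have "(\<lambda>X\<in>carrier V. circ L X Y) = (\<lambda>X\<in>carrier V. brace V X (sym_incl R V Y))"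
      using Y by (auto simp: prelie_of_brace_def)
    then show ?thesis
      using restrict_linear_maps[OF module_axioms brace_lin_left] Y by simp
  qed
  have "circ L \<in> extensional (carrier V)" by (simp add: prelie_of_brace_def)
  then show "circ L \<in> bilinear_maps R L L L"
    using lin_right lin_left
    by (simp add: bilinear_maps_def same_module_linear_maps[OF same same] eqs PiE_def)
  fix X Y Z assume "X \<in> carrier L" "Y \<in> carrier L" "Z \<in> carrier L"
  then have XYZ: "X \<in> carrier V" "Y \<in> carrier V" "Z \<in> carrier V" by (simp_all add: eqs)
  have "B X [Y, Z] = B X [Z, Y]"
    using XYZ sym_prod_mset_eq[of "[Y, Z]" "[Z, Y]"] by (simp add: add_mset_commute)
  then show "circ L X (circ L Y Z) \<ominus>\<^bsub>L\<^esub> circ L (circ L X Y) Z = circ L X (circ L Z Y) \<ominus>\<^bsub>L\<^esub> circ L (circ L X Z) Y"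
    using XYZ brace_list_brace_single[of X "[Y]" Z] brace_list_brace_single[of X "[Z]" Y]
    by (simp add: circ_prelie_of_brace same_module_minus[OF same] M.minus_eq_minus_iff M.r_zero M.a_ac)
qed

text \<open>The brace axiom for one argument, solved for the brace with the longer list, is the
  defining recursion of \<open>list_brace\<close>; so the pre-Lie product determines all
  braces.\<close>

lemma brace_eq_list_brace:
  assumes "X \<in> carrier V" "set Ys \<subseteq> carrier V"
  shows "B X Ys = list_brace L X Ys"
proof -
  interpret L: prelie_algebra R L by (rule prelie_algebra_prelie_of_brace)
  note same = same_module_prelie_of_brace[of V R]
  note eqs = same_moduleD[OF same]
  show ?thesis
  proof (rule L.list_brace_unique)
    fix X Z Ys assume "X \<in> carrier L" "Z \<in> carrier L" "set Ys \<subseteq> carrier L"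
    then have X: "X \<in> carrier V" and Z: "Z \<in> carrier V" and Ys: "set Ys \<subseteq> carrier V" by (simp_all add: eqs)
    have D: "alter_one (\<lambda>Y. {#circ L Y Z#}) Ys = alter_one (\<lambda>Y. {#B Y [Z]#}) Ys"
      using Ys Z by (intro alter_one_cong) (auto simp: circ_prelie_of_brace)
    show "B X (Z # Ys) = circ L (B X Ys) Z \<ominus>\<^bsub>L\<^esub> msum L (B X) (alter_one (\<lambda>Y. {#circ L Y Z#}) Ys)"
      unfolding D same_module_minus[OF same] same_module_msum[OF same]
      using X Z Ys brace_list_brace_single[OF X Ys Z]
      by (subst M.minus_eq_iff[THEN iffD2]) (auto simp: circ_prelie_of_brace)
  qed (use assms in \<open>simp_all add: eqs\<close>)
qed

end

section \<open>From pre-Lie algebras to symmetric brace algebras\<close>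

context prelie_algebra
begin

abbreviation V where "V \<equiv> brace_of_prelie R L"

lemma brace_of_prelie_sym_prod:
  assumes X: "X \<in> carrier L"
  shows "brace V X \<in> linear_maps R Sym L"
    and "\<And>Ys. set Ys \<subseteq> carrier L \<Longrightarrow> brace V X (sym_prod R L Ys) = br X Ys"
proof -
  have lin: "lin_map R L L (\<lambda>x. br X (x # xs))" if "set xs \<subseteq> carrier L" for xs
    using multilin_head[OF list_brace_multilin[OF X] that] by simp
  obtain h where h: "h \<in> linear_maps R Sym L" "\<And>xs. set xs \<subseteq> carrier L \<Longrightarrow> h (sym_prod R L xs) = br X xs"
    using sym_lift[OF module_axioms list_brace_mset_eq[OF X] _ lin] X by auto
  have "g = h" if g: "g \<in> linear_maps R Sym L" "\<forall>Ys. set Ys \<subseteq> carrier L \<longrightarrow> g (sym_prod R L Ys) = br X Ys" for g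
  proof (rule linear_maps_eqI[OF g(1) h(1)])
    show "g t = h t" if "t \<in> carrier Sym" for t
      by (rule lin_map_eq_on_spanning[OF sym_prod_spanning algebra.module[OF sym_algebra_algebra] module_axioms
            linear_maps_lin[OF g(1)] linear_maps_lin[OF h(1)] _ that])
        (auto simp: g(2) h(2) lists_eq_set)
  qed
  then have "(THE h. h \<in> linear_maps R Sym L \<and> (\<forall>Ys. set Ys \<subseteq> carrier L \<longrightarrow> h (sym_prod R L Ys) = br X Ys)) = h"
    by (rule the_equality[rotated]) (auto simp: h)
  then have "brace V X = h"
    using X by (simp add: brace_of_prelie_def)
  then show "brace V X \<in> linear_maps R Sym L"
    "\<And>Ys. set Ys \<subseteq> carrier L \<Longrightarrow> brace V X (sym_prod R L Ys) = br X Ys"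
    by (simp_all add: h)
qed

lemma brace_of_prelie_lin: "X \<in> carrier L \<Longrightarrow> lin_map R Sym L (brace V X)"
  by (rule linear_maps_lin[OF brace_of_prelie_sym_prod(1)])

text \<open>The maps \<open>brace V X\<close> are described separately for each \<open>X\<close>, so
  linearity in \<open>X\<close> is not built in. It holds on products by
  \<open>list_brace_lin_left\<close> and extends by linearity in the other argument.\<close>

lemma brace_of_prelie_lin_left:
  assumes "A \<in> carrier Sym"
  shows "lin_map R L L (\<lambda>X. brace V X A)"
proof (rule lin_map_param_spanning[OF sym_prod_spanning algebra.module[OF sym_algebra_algebra] module_axioms module_axioms
    brace_of_prelie_lin _ assms])
  fix s assume "s \<in> sym_prod R L ` lists (carrier L)"
  then obtain Ys where Ys: "set Ys \<subseteq> carrier L" "s = sym_prod R L Ys" by auto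
  show "lin_map R L L (\<lambda>X. brace V X s)"
    using list_brace_lin_left[OF Ys(1)] by (subst lin_map_cong[OF module_axioms]) (auto simp: Ys brace_of_prelie_sym_prod)
qed

text \<open>Both sides are linear in \<open>A\<close>, so it is enough to take a product; there
  \<open>brace_composite_eval\<close> reduces the axiom to
  \<open>list_brace_list_brace\<close>.\<close>

lemma brace_of_prelie_brace:
  assumes X: "X \<in> carrier L" and Ys: "set Ys \<subseteq> carrier L" and A: "A \<in> carrier Sym"
  shows "brace V (brace V X (sym_prod R L Ys)) A = tensor_lift R Sym (Suc (length Ys)) L
    (\<lambda>Bs. brace V X (sym_prod R L (map2 (brace V) Ys (butlast Bs)) \<otimes>\<^bsub>Sym\<^esub> last Bs))
    (iterated_coproduct R L (length Ys) A)"
proof (rule lin_map_eq_on_spanning[OF sym_prod_spanning algebra.module[OF sym_algebra_algebra] module_axioms _ _ _ A])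
  interpret S: algebra R Sym by (rule sym_algebra_algebra)
  have XYs: "br X Ys \<in> carrier L" using X Ys by simp
  show "lin_map R Sym L (brace V (brace V X (sym_prod R L Ys)))"
    using XYs by (simp add: brace_of_prelie_sym_prod X Ys brace_of_prelie_lin)
  show "lin_map R Sym L (\<lambda>A. tensor_lift R Sym (Suc (length Ys)) L
      (\<lambda>Bs. brace V X (sym_prod R L (map2 (brace V) Ys (butlast Bs)) \<otimes>\<^bsub>Sym\<^esub> last Bs))
      (iterated_coproduct R L (length Ys) A))"
    by (rule lin_map_compose[OF iterated_coproduct_lin linear_maps_lin[OF
        S.tensor_lift_linear[OF module_axioms brace_composite_multilin[OF brace_of_prelie_lin X Ys]]]])
  fix s assume "s \<in> sym_prod R L ` lists (carrier L)"
  then obtain Zs where Zs: "set Zs \<subseteq> carrier L" "s = sym_prod R L Zs" by auto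
  have "brace V X (sym_prod R L (map2 (\<lambda>Y L'. brace V Y (sym_prod R L L')) Ys (butlast Ls) @ last Ls)) =
      br X (map2 br Ys (butlast Ls) @ last Ls)" if Ls: "Ls \<in># unshuffles (Suc (length Ys)) Zs" for Ls
  proof -
    obtain Bs C where BC: "Ls = Bs @ [C]"
      using length_unshuffles[OF Ls] by (cases Ls rule: rev_cases) auto
    have sub: "set Bs \<subseteq> lists (carrier L)" "set C \<subseteq> carrier L"
      using set_unshuffles[OF Ls Zs(1)] by (auto simp: BC)
    have "brace V Y (sym_prod R L B) = br Y B" if "(Y, B) \<in> set (zip Ys Bs)" for Y B
      using sub(1) Ys set_zip_leftD[OF that] set_zip_rightD[OF that] by (intro brace_of_prelie_sym_prod) auto
    then have map2: "map2 (\<lambda>Y L'. brace V Y (sym_prod R L L')) Ys Bs = map2 br Ys Bs"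
      by (intro map_cong) auto
    have "brace V X (sym_prod R L (map2 br Ys Bs @ C)) = br X (map2 br Ys Bs @ C)"
      using X sub(2) map2_list_brace_closed[OF Ys sub(1)] by (intro brace_of_prelie_sym_prod) auto
    then show ?thesis
      unfolding BC butlast_snoc last_snoc map2 .
  qed
  then have "msum L (\<lambda>Ls. brace V X (sym_prod R L (map2 (\<lambda>Y L'. brace V Y (sym_prod R L L')) Ys (butlast Ls) @ last Ls)))
      (unshuffles (Suc (length Ys)) Zs) = br (br X Ys) Zs"
    unfolding list_brace_list_brace[OF X Ys Zs(1)] by (rule M.msum_cong)
  then show "brace V (brace V X (sym_prod R L Ys)) s = tensor_lift R Sym (Suc (length Ys)) L
      (\<lambda>Bs. brace V X (sym_prod R L (map2 (brace V) Ys (butlast Bs)) \<otimes>\<^bsub>Sym\<^esub> last Bs))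
      (iterated_coproduct R L (length Ys) s)"
    using X Ys Zs(1) XYs unfolding Zs(2)
    by (subst brace_composite_eval[where b = "brace V"]) (auto simp: brace_of_prelie_sym_prod brace_of_prelie_lin)
qed

lemma symmetric_brace_algebra_brace_of_prelie: "symmetric_brace_algebra R V"
proof
  note same = same_module_brace_of_prelie[of L R]
  note eqs = same_moduleD[OF same] same_module_sym_algebra[OF same] same_module_sym_prod[OF same]
  show "proper_module R V" by (rule same_module_proper[OF same proper_module])
  interpret V: module R V by (rule same_module_module[OF same module_axioms])
  have "(\<lambda>X\<in>carrier L. brace V X A) \<in> linear_maps R L L" if "A \<in> carrier Sym" for A
    by (rule restrict_linear_maps[OF module_axioms brace_of_prelie_lin_left[OF that]])
  moreover have "linear_maps R Sym V = linear_maps R Sym L"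
    using same by (intro same_module_linear_maps) (simp_all add: same_module_def)
  moreover have "brace V \<in> extensional (carrier L)" by (simp add: brace_of_prelie_def)
  ultimately show "brace V \<in> bilinear_maps R V (sym_algebra R V) V"
    using brace_of_prelie_sym_prod(1) by (simp add: bilinear_maps_def eqs same_module_linear_maps[OF same same] PiE_def)
  fix X assume "X \<in> carrier V"
  then have X: "X \<in> carrier L" by (simp add: eqs)
  show "brace V X \<one>\<^bsub>sym_algebra R V\<^esub> = X"
    using brace_of_prelie_sym_prod(2)[OF X, of "[]"] by (simp add: eqs)
  fix Ys A assume "set Ys \<subseteq> carrier V" "A \<in> carrier (sym_algebra R V)"
  then have "set Ys \<subseteq> carrier L" "A \<in> carrier Sym" by (simp_all add: eqs)
  from brace_of_prelie_brace[OF X this] show "brace V (brace V X (sym_prod R V Ys)) A =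
      tensor_lift R (sym_algebra R V) (length Ys + 1) V
        (\<lambda>Bs. brace V X (sym_prod R V (map2 (brace V) Ys (butlast Bs)) \<otimes>\<^bsub>sym_algebra R V\<^esub> last Bs))
        (iterated_coproduct R V (length Ys) A)"
    by (simp add: eqs same_module_tensor_lift[OF same] same_module_iterated_coproduct[OF same])
qed

end

section \<open>The two constructions are mutually inverse\<close>

lemma prelie_of_brace_of_prelie:
  assumes "prelie_algebra R L"
  shows "prelie_of_brace R (brace_of_prelie R L) = L"
proof -
  interpret prelie_algebra R L by fact
  note same = same_module_brace_of_prelie[of L R]
  have "circ (prelie_of_brace R V) X Y = circ L X Y" for X Y
  proof (cases "X \<in> carrier L \<and> Y \<in> carrier L")
    case True
    then have "circ (prelie_of_brace R V) X Y = br X [Y]"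
      by (simp add: prelie_of_brace_def same_moduleD[OF same] same_module_sym_incl[OF same]
          brace_of_prelie_sym_prod flip: sym_prod_single)
    then show ?thesis using True by (simp add: list_brace_Cons M.minus_eq_iff)
  next
    \<comment> \<open>Equality of records concerns all arguments; outside the carrier both products
      are \<open>undefined\<close> by extensionality.\<close>
    case False
    have "circ L \<in> extensional (carrier L)"
      using circ_bilinear by (simp add: bilinear_maps_def PiE_def)
    then have "circ L X = undefined" if "X \<notin> carrier L"
      using that by (rule extensional_arb)
    moreover have "circ L X Y = undefined" if "X \<in> carrier L" "Y \<notin> carrier L"
    proof -
      have "circ L X \<in> extensional (carrier L)"
        using circ_bilinear that(1) by (auto simp: bilinear_maps_def linear_maps_iff)
      then show ?thesis using that(2) by (rule extensional_arb)
    qed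
    ultimately show ?thesis
      using False by (auto simp: prelie_of_brace_def same_moduleD[OF same])
  qed
  then show ?thesis
    by (intro prelie_alg.equality) (auto simp: prelie_of_brace_def brace_of_prelie_def fun_eq_iff)
qed

text \<open>For \<open>X\<close> in the carrier both braces are extensional linear maps on S(V), and
  on products both equal \<open>list_brace\<close> of the associated pre-Lie algebra.\<close>

lemma brace_of_prelie_of_brace:
  assumes "symmetric_brace_algebra R V"
  shows "brace_of_prelie R (prelie_of_brace R V) = V"
proof -
  interpret symmetric_brace_algebra R V by fact
  interpret L: prelie_algebra R L by (rule prelie_algebra_prelie_of_brace)
  note same = same_module_prelie_of_brace[of V R]
  note eqs = same_moduleD[OF same] same_module_sym_algebra[OF same] same_module_sym_prod[OF same]
  have Sym_L: "linear_maps R Sym L = linear_maps R Sym V"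
    by (simp add: linear_maps_def eqs)
  have "brace (brace_of_prelie R L) X = brace V X" for X
  proof (cases "X \<in> carrier V")
    case True
    then have X: "X \<in> carrier L" by (simp add: eqs)
    show ?thesis
    proof (rule linear_maps_eqI)
      show lin: "brace (brace_of_prelie R L) X \<in> linear_maps R Sym V"
        using L.brace_of_prelie_sym_prod(1)[OF X] by (simp add: eqs Sym_L)
      show lin': "brace V X \<in> linear_maps R Sym V" by (rule brace_linear[OF True])
      have "brace (brace_of_prelie R L) X (sym_prod R V Ys) = brace V X (sym_prod R V Ys)"
        if "set Ys \<subseteq> carrier V" for Ys
        using L.brace_of_prelie_sym_prod(2)[OF X, of Ys] brace_eq_list_brace[OF True that] that by (simp add: eqs)
      then show "brace (brace_of_prelie R L) X t = brace V X t" if "t \<in> carrier Sym" for t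
        by (intro lin_map_eq_on_spanning[OF sym_prod_spanning algebra.module[OF sym_algebra_algebra] module_axioms
            linear_maps_lin[OF lin] linear_maps_lin[OF lin'] _ that]) (auto simp: lists_eq_set)
    qed
  next
    case False
    moreover have "brace V \<in> extensional (carrier V)"
      using brace_bilinear by (simp add: bilinear_maps_def PiE_def)
    ultimately show ?thesis
      by (auto simp: brace_of_prelie_def eqs extensional_def)
  qed
  then show ?thesis
    by (intro brace_alg.equality) (auto simp: prelie_of_brace_def brace_of_prelie_def fun_eq_iff)
qed

section \<open>Comparison of the morphisms\<close>

lemma brace_homs_prelie_homs:
  assumes "symmetric_brace_algebra R V" "symmetric_brace_algebra R W"
  shows "brace_homs R V W \<subseteq> prelie_homs R (prelie_of_brace R V) (prelie_of_brace R W)"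
proof
  interpret V: symmetric_brace_algebra R V by fact
  interpret W: symmetric_brace_algebra R W by fact
  note same = same_module_prelie_of_brace
  fix f assume f: "f \<in> brace_homs R V W"
  have closed: "f X \<in> carrier W" if "X \<in> carrier V" for X
    using f that by (auto simp: brace_homs_def linear_maps_def)
  have "f (circ V.L X Y) = circ W.L (f X) (f Y)" if "X \<in> carrier V" "Y \<in> carrier V" for X Y
  proof -
    have "\<forall>Ys. set Ys \<subseteq> carrier V \<longrightarrow> f (V.B X Ys) = W.B (f X) (map f Ys)"
      using f that by (simp add: brace_homs_def)
    from this[rule_format, of "[Y]"] show ?thesis using that closed by (simp add: V.circ_prelie_of_brace W.circ_prelie_of_brace)
  qed
  then show "f \<in> prelie_homs R V.L W.L"
    using f by (simp add: prelie_homs_def brace_homs_def same_moduleD[OF same]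
        same_module_linear_maps[OF same same])
qed

lemma prelie_homs_brace_homs:
  assumes "prelie_algebra R L" "prelie_algebra R L'"
  shows "prelie_homs R L L' \<subseteq> brace_homs R (brace_of_prelie R L) (brace_of_prelie R L')"
proof
  interpret L: prelie_algebra R L by fact
  interpret L': prelie_algebra R L' by fact
  note same = same_module_brace_of_prelie
  fix f assume f: "f \<in> prelie_homs R L L'"
  have closed: "f X \<in> carrier L'" if "X \<in> carrier L" for X
    using f that by (auto simp: prelie_homs_def linear_maps_def)
  have "f (brace L.V X (sym_prod R L Ys)) = brace L'.V (f X) (sym_prod R L' (map f Ys))"
    if "X \<in> carrier L" "set Ys \<subseteq> carrier L" for X Ys
  proof -
    have "set (map f Ys) \<subseteq> carrier L'" using that closed by auto
    then show ?thesis
      using list_brace_hom[OF assms f that] that closed by (simp add: L.brace_of_prelie_sym_prod L'.brace_of_prelie_sym_prod del: set_map)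
  qed
  then show "f \<in> brace_homs R L.V L'.V"
    using f by (simp add: prelie_homs_def brace_homs_def same_moduleD[OF same]
        same_module_linear_maps[OF same same] same_module_sym_prod[OF same])
qed

section \<open>The two categories and their isomorphism\<close>

lemma linear_maps_ident: "module R M \<Longrightarrow> (\<lambda>x\<in>carrier M. x) \<in> linear_maps R M M"
  by (rule restrict_linear_maps[OF _ lin_map_id])

lemma linear_maps_compose:
  assumes "module R M" "f \<in> linear_maps R M N" "g \<in> linear_maps R N P"
  shows "compose (carrier M) g f \<in> linear_maps R M P"
  unfolding compose_def
  using lin_map_compose[OF linear_maps_lin[OF assms(2)] linear_maps_lin[OF assms(3)]]
  by (rule restrict_linear_maps[OF assms(1)])

lemma linear_maps_PiE: "f \<in> linear_maps R M N \<Longrightarrow> f \<in> carrier M \<rightarrow>\<^sub>E carrier N"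
  by (simp add: linear_maps_def)

lemma compose_Ident:
  assumes "f \<in> A \<rightarrow>\<^sub>E B"
  shows "compose A f (\<lambda>x\<in>A. x) = f" "compose A (\<lambda>x\<in>B. x) f = f"
  using assms by (auto simp: compose_def PiE_def Pi_def extensional_def fun_eq_iff)

lemma prelie_category: "category (prelie_cat R)"
proof
  fix L assume "L \<in> Obj (prelie_cat R)"
  then interpret prelie_algebra R L by (simp add: prelie_cat_def)
  show "Ident (prelie_cat R) L \<in> Hom (prelie_cat R) L L"
    by (simp add: prelie_cat_def prelie_homs_def linear_maps_ident module_axioms)
next
  fix L M N f g
  assume *: "L \<in> Obj (prelie_cat R)" "M \<in> Obj (prelie_cat R)" "N \<in> Obj (prelie_cat R)"
    "f \<in> Hom (prelie_cat R) L M" "g \<in> Hom (prelie_cat R) M N"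
  interpret prelie_algebra R L using *(1) by (simp add: prelie_cat_def)
  have "f X \<in> carrier M" if "X \<in> carrier L" for X
    using * linear_maps_PiE[of f R L M] that by (auto simp: prelie_cat_def prelie_homs_def)
  then show "Comp (prelie_cat R) L M N g f \<in> Hom (prelie_cat R) L N"
    using *
    by (auto simp: prelie_cat_def prelie_homs_def linear_maps_compose module_axioms compose_eq)
next
  fix K L M N f g h
  assume "f \<in> Hom (prelie_cat R) K L"
  then show "Comp (prelie_cat R) K L N (Comp (prelie_cat R) L M N h g) f =
      Comp (prelie_cat R) K M N h (Comp (prelie_cat R) K L M g f)"
    using linear_maps_PiE[of f R K L]
    by (auto simp: prelie_cat_def prelie_homs_def compose_def fun_eq_iff)
qed (auto simp: prelie_cat_def prelie_homs_def dest!: linear_maps_PiE intro: compose_Ident)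

lemma brace_category: "category (brace_cat R)"
proof
  fix U assume "U \<in> Obj (brace_cat R)"
  then interpret symmetric_brace_algebra R U by (simp add: brace_cat_def)
  have "map (\<lambda>x\<in>carrier U. x) Ys = Ys" if "set Ys \<subseteq> carrier U" for Ys
    using that by (intro map_idI) auto
  then show "Ident (brace_cat R) U \<in> Hom (brace_cat R) U U"
    by (simp add: brace_cat_def brace_homs_def linear_maps_ident module_axioms)
next
  fix U V W f g
  assume *: "U \<in> Obj (brace_cat R)" "V \<in> Obj (brace_cat R)" "W \<in> Obj (brace_cat R)"
    "f \<in> Hom (brace_cat R) U V" "g \<in> Hom (brace_cat R) V W"
  interpret symmetric_brace_algebra R U using *(1) by (simp add: brace_cat_def)
  have fg: "f \<in> linear_maps R U V" "g \<in> linear_maps R V W"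
    using * by (auto simp: brace_cat_def brace_homs_def)
  have f: "f (B X Ys) = brace V (f X) (sym_prod R V (map f Ys))" if "X \<in> carrier U" "set Ys \<subseteq> carrier U" for X Ys
    using * that by (auto simp: brace_cat_def brace_homs_def)
  have g: "g (brace V X (sym_prod R V Ys)) = brace W (g X) (sym_prod R W (map g Ys))"
    if "X \<in> carrier V" "set Ys \<subseteq> carrier V" for X Ys
    using * that by (auto simp: brace_cat_def brace_homs_def)
  have f_closed: "f X \<in> carrier V" if "X \<in> carrier U" for X
    using linear_maps_PiE[OF fg(1)] that by auto
  have "compose (carrier U) g f (B X Ys) =
      brace W (compose (carrier U) g f X) (sym_prod R W (map (compose (carrier U) g f) Ys))"
    if X: "X \<in> carrier U" and Ys: "set Ys \<subseteq> carrier U" for X Ys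
  proof -
    have "map (compose (carrier U) g f) Ys = map g (map f Ys)"
      using Ys by (auto simp: compose_eq)
    moreover have "set (map f Ys) \<subseteq> carrier V" using Ys f_closed by auto
    ultimately show ?thesis
      using X Ys f_closed by (simp add: compose_eq f g del: map_map set_map)
  qed
  then show "Comp (brace_cat R) U V W g f \<in> Hom (brace_cat R) U W"
    using linear_maps_compose[OF module_axioms fg] by (simp add: brace_cat_def brace_homs_def)
next
  fix K L M N f g h
  assume "f \<in> Hom (brace_cat R) K L"
  then show "Comp (brace_cat R) K L N (Comp (brace_cat R) L M N h g) f =
      Comp (brace_cat R) K M N h (Comp (brace_cat R) K L M g f)"
    using linear_maps_PiE[of f R K L]
    by (auto simp: brace_cat_def brace_homs_def compose_def fun_eq_iff)
qed (auto simp: brace_cat_def brace_homs_def dest!: linear_maps_PiE intro: compose_Ident)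

theorem corollary4p5:
  fixes R :: "('k, 'r) ring_scheme"
  assumes "cring R"
  shows "isomorphic_categories
    (brace_cat R :: (('k, 'v) brace_alg, 'v \<Rightarrow> 'v) cat)
    (prelie_cat R :: (('k, 'v) prelie_alg, 'v \<Rightarrow> 'v) cat)"
proof -
  let ?B = "brace_cat R :: (('k, 'v) brace_alg, 'v \<Rightarrow> 'v) cat"
  let ?P = "prelie_cat R :: (('k, 'v) prelie_alg, 'v \<Rightarrow> 'v) cat"
  \<comment> \<open>Both constructions leave carriers unchanged, and morphisms are functions on
    carriers, so the functors can act as the identity on morphisms.\<close>
  have "cat_functor ?B ?P (prelie_of_brace R) (\<lambda>_ _ f. f)"
  proof (intro cat_functor.intro cat_functor_axioms.intro brace_category prelie_category)
    show "prelie_of_brace R V \<in> Obj ?P" if "V \<in> Obj ?B" for V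
      using that symmetric_brace_algebra.prelie_algebra_prelie_of_brace by (auto simp: brace_cat_def prelie_cat_def)
    show "f \<in> Hom ?P (prelie_of_brace R V) (prelie_of_brace R W)"
      if "V \<in> Obj ?B" "W \<in> Obj ?B" "f \<in> Hom ?B V W" for V W f
      using that brace_homs_prelie_homs by (auto simp: brace_cat_def prelie_cat_def)
  qed (simp_all add: brace_cat_def prelie_cat_def prelie_of_brace_def)
  moreover have "cat_functor ?P ?B (brace_of_prelie R) (\<lambda>_ _ f. f)"
  proof (intro cat_functor.intro cat_functor_axioms.intro brace_category prelie_category)
    show "brace_of_prelie R L \<in> Obj ?B" if "L \<in> Obj ?P" for L
      using that prelie_algebra.symmetric_brace_algebra_brace_of_prelie by (auto simp: brace_cat_def prelie_cat_def)
    show "f \<in> Hom ?B (brace_of_prelie R L) (brace_of_prelie R L')"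
      if "L \<in> Obj ?P" "L' \<in> Obj ?P" "f \<in> Hom ?P L L'" for L L' f
      using that prelie_homs_brace_homs by (auto simp: brace_cat_def prelie_cat_def)
  qed (simp_all add: brace_cat_def prelie_cat_def brace_of_prelie_def)
  moreover have "left_inverse_functor ?B (prelie_of_brace R) (\<lambda>_ _ f. f) (brace_of_prelie R) (\<lambda>_ _ f. f)"
    "left_inverse_functor ?P (brace_of_prelie R) (\<lambda>_ _ f. f) (prelie_of_brace R) (\<lambda>_ _ f. f)"
    by (auto simp: left_inverse_functor_def brace_cat_def prelie_cat_def
        brace_of_prelie_of_brace prelie_of_brace_of_prelie)
  ultimately show ?thesis
    unfolding isomorphic_categories_def by blast
qed

end
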